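(* Let $G=(V,E)$ be a cycle-disjoint directed graph, and let $(S,T)\in\mathcal M^{2,3}(G)$ be the second- and third-order moments of a random vector $X=(I-\Lambda)^{-T}\varepsilon$ following the linear structural equation model based on $G$. Assume that the coefficients $\Lambda$ and the moments $\Omega^{(2)},\Omega^{(3)}$ of the noise vector $\varepsilon$ are generic. Then the Causal Graph Discovery algorithm (described in the context) recovers a graph $G'$ that is distribution equivalent to $G$, as well as appropriate coefficients $\Lambda'$ for $G'$. Moreover, all graphs distribution equivalent to $G$ may be constructed, by applying the characterization that they are the graphs $\pi(G')$ for permutations $\pi$ of $V$ that factor according to vertex-disjoint cycles in $G'$.
   Context: **Model.** $G$ is cycle-disjoint if each node belongs to at most one directed cycle (2-cycles allowed). $\mathbb R^E$ is the set of real $|V|\times|V|$ matrices $\Lambda=(\lambda_{ij})$ with $I-\Lambda$ invertible and $\lambda_{ij}=0$ whenever $i\to j\notin E$; $\mathbb R^E_*$ is the subset with $\lambda_{ij}\ne0$ for all $i\to j\in E$. The noise vector $\varepsilon$ is centered with independent components; $\Omega^{(2)}=(\mathbb E[\varepsilon_i\varepsilon_j])$ and $\Omega^{(3)}=(\mathbb E[\varepsilon_i\varepsilon_j\varepsilon_k])$ are then diagonal. With $M^{-T}=(M^{-1})^T$, put $S(\Lambda,\Omega^{(2)})=(I-\Lambda)^{-T}\Omega^{(2)}(I-\Lambda)^{-1}$ and $T(\Lambda,\Omega^{(3)})_{ijk}=\sum_{a\in V}[(I-\Lambda)^{-1}]_{ai}[(I-\Lambda)^{-1}]_{aj}[(I-\Lambda)^{-1}]_{ak}\,\Omega^{(3)}_{aaa}$;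 these are the moments $s_{ij}=\mathbb E[X_iX_j]$, $t_{ijk}=\mathbb E[X_iX_jX_k]$ of $X=(I-\Lambda)^{-T}\varepsilon$. $\mathcal M^{2,3}(G)$ is the set of all pairs $(S(\Lambda,\Omega^{(2)}),T(\Lambda,\Omega^{(3)}))$ with $\Lambda\in\mathbb R^E$, $\Omega^{(2)}$ diagonal positive definite, $\Omega^{(3)}$ diagonal. "Generic" means that the distribution behaves like a typical member of the model with regard to the polynomial constraints tested by the algorithm; only a measure-zero set of parameters violates this. **Distribution equivalence.** $\mathcal P(G)$ is the set of distributions of $X=(I-\Lambda)^{-T}\varepsilon$ with $\Lambda\in\mathbb R^E_*$ and $\varepsilon$ a noise vector with independent non-Gaussian components. $G,G'$ on the same vertex set are distribution equivalent if $\mathcal P(G)=\mathcal P(G')$. A permutation $\pi$ of $V$ factors according to vertex-disjoint cycles in $G$ if for each (nontrivial) cycle $(i_1\cdots i_s)$ in the disjoint cycle decomposition of $\pi$ the directed cycle $i_1\to\cdots\to i_s\to i_1$ is in $G$; then $\pi(G)=(V,\pi(E))$ is defined, for $i\ne j$, by: if $i=\pi(j)$ then $i\to j\in\pi(E)$; if $i\neq\pi(j)$ then $i\to j\in\pi(E)$ iff $i\to\pi(j)\in E$. **Algorithm** (input $(S,T)$). For remaining vertices put $d_{uv}^{2\times2}=s_{uu}t_{uuv}-s_{uv}t_{uuu}$ and $d_{uv}^{3\times3}=\det\begin{pmatrix}s_{uu}&s_{uv}&s_{vv}\\t_{uuu}&t_{uuv}&t_{uvv}\\t_{uuv}&t_{uvv}&t_{vvv}\end{pmatrix}$.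 "Regressing $V\setminus A$ on $A$" means replacing the current vector by the residuals $X_{V\setminus A}-R_{V\setminus A,A}X_A$, where $R_{B,A}=S_{B,A}S_{A,A}^{-1}$, with $V$ replaced by $V\setminus A$ and $(S,T)$ by the residual moments. Part 1 (strong components, their order, edges and weights within components). Repeat while vertices remain: 1. Compute all $d_{uv}^{2\times2}$ and $d_{uv}^{3\times3}$. 2. Let $A$ be the set of all vertices $r$ with $d_{ru}^{2\times2}=0$ for all $u$ (the root nodes). Record $A$. If $A\ne\emptyset$, regress $V\setminus A$ on $A$ and go to 1. 3. Otherwise, let $\mathcal C$ be the collection of maximal $C\subseteq V$ with $d_{uv}^{3\times3}=0$ and $d_{uv}^{2\times2}\neq0$ for all distinct $u,v\in C$. Prune $\mathcal C$ to the collection $\mathcal C'$ of all root cycles: those $C\in\mathcal C$ such that for all $D\in\mathcal C\setminus\{C\}$ the matrix $(\mathbb E[X_c^2(X_D-R_{D,C}X_C)_d])_{c\in C,d\in D}$ is zero. Record $\mathcal C'$. 4. Compute the edges and edge weights along each $C\in\mathcal C'$: $u,v\in C$ are adjacent iff the $(u,v)$ entry of $(S_{C,C})^{-1}$ is nonzero; choose any one of the two possible orientations of the resulting cycle. If $|C|\ge3$, for consecutive $u\to v\to w$ the weight $\lambda_{uv}$ is obtained from the linear equation $\det(a_1,a_4,a_5)\,\lambda_{uv}=\det(a_2,a_4,a_5)$, where $a_1=(s_{uu},t_{uuu},t_{uuv})^T$, $a_2=(s_{uv},t_{uuv},t_{uvv})^T$, $a_4=(s_{uw},t_{uuw},t_{uvw})^T$,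 $a_5=(s_{vw},t_{uvw},t_{vvw})^T$. If $C=\{u,v\}$, the weight $\lambda_{uv}$ is obtained from the quadratic equation $(s_{uu}t_{uuv}-s_{uv}t_{uuu})\lambda_{uv}^2+(s_{vv}t_{uuu}-s_{uu}t_{uvv})\lambda_{uv}+s_{uv}t_{uvv}-s_{vv}t_{uuv}=0$, which gives two solutions for $\lambda_{uv}$. 5. Regress $V\setminus\bigcup\mathcal C'$ on $\bigcup\mathcal C'$ and go to 1. Part 2 (edges and weights between components). Working backwards in the topological ordering found in Part 1, regress each component $D$ on the set $C$ of all vertices in earlier components (all possible parents) and set $\Lambda_{C,D}=R_{D,C}^T(I-\Lambda_{D,D})$; the nonzero entries give the edges from $C$ to $D$. Output the graph and the edge weights. *)

theory Defs
  imports "HOL-Probability.Probability" "HOL-Combinatorics.Permutations"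
begin

section \<open>Directed graphs and cycles\<close>

text \<open>The vertex set is the finite type \<open>'n\<close>; a graph is its edge relation, where \<open>(i, j)\<close>
  stands for \<open>i \<rightarrow> j\<close>. Graphs are loopless (\<^const>\<open>irrefl\<close>).\<close>

type_synonym 'n digraph = "('n \<times> 'n) set"

text \<open>The edges of \<open>v\<^sub>1 \<rightarrow> \<dots> \<rightarrow> v\<^sub>s \<rightarrow> v\<^sub>1\<close>. This set does not change when the list is rotated, so it
  is what identifies a cycle.\<close>

definition cycle_edges :: "'n list \<Rightarrow> 'n digraph" where
  "cycle_edges vs = set (zip vs (rotate1 vs))"

definition dicycle :: "'n digraph \<Rightarrow> 'n list \<Rightarrow> bool" where
  "dicycle E vs \<longleftrightarrow> distinct vs \<and> 2 \<le> length vs \<and> cycle_edges vs \<subseteq> E"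

definition cycle_disjoint :: "'n digraph \<Rightarrow> bool" where
  "cycle_disjoint E \<longleftrightarrow> (\<forall>v us vs. dicycle E us \<and> dicycle E vs \<and> v \<in> set us \<and> v \<in> set vs
     \<longrightarrow> cycle_edges us = cycle_edges vs)"

definition perm_cycle :: "('n \<Rightarrow> 'n) \<Rightarrow> 'n list \<Rightarrow> bool" where
  "perm_cycle \<pi> vs \<longleftrightarrow> distinct vs \<and> 2 \<le> length vs \<and> (\<forall>(i, j) \<in> cycle_edges vs. \<pi> i = j)"

definition factors_through_cycles :: "('n \<Rightarrow> 'n) \<Rightarrow> 'n digraph \<Rightarrow> bool" where
  "factors_through_cycles \<pi> E \<longleftrightarrow> \<pi> permutes UNIV \<and> (\<forall>vs. perm_cycle \<pi> vs \<longrightarrow> dicycle E vs)"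

definition permute_graph :: "('n \<Rightarrow> 'n) \<Rightarrow> 'n digraph \<Rightarrow> 'n digraph" where
  "permute_graph \<pi> E = {(i, j). i \<noteq> j \<and> (i = \<pi> j \<or> (i, \<pi> j) \<in> E)}"


section \<open>The linear structural equation model\<close>

definition edge_coeffs :: "'n::finite digraph \<Rightarrow> (real^'n^'n) set" where
  "edge_coeffs E = {\<Lambda>. invertible (mat 1 - \<Lambda>) \<and> (\<forall>i j. (i, j) \<notin> E \<longrightarrow> \<Lambda>$i$j = 0)}"

definition edge_coeffs_star :: "'n::finite digraph \<Rightarrow> (real^'n^'n) set" where
  "edge_coeffs_star E = {\<Lambda> \<in> edge_coeffs E. \<forall>(i, j) \<in> E. \<Lambda>$i$j \<noteq> 0}"

definition second_moments :: "(real^'n) measure \<Rightarrow> real^'n^'n" where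
  "second_moments \<mu> = (\<chi> i j. \<integral>x. x$i * x$j \<partial>\<mu>)"

definition third_moments :: "(real^'n) measure \<Rightarrow> real^'n^'n^'n" where
  "third_moments \<mu> = (\<chi> i j k. \<integral>x. x$i * x$j * x$k \<partial>\<mu>)"

text \<open>A noise vector is represented by its law on \<open>real^'n\<close>. Integrability of the cubes makes the
  moments of order at most three exist.\<close>

definition noise_law :: "(real^'n::finite) measure \<Rightarrow> bool" where
  "noise_law \<nu> \<longleftrightarrow> prob_space \<nu> \<and> sets \<nu> = sets borel \<and>
     (\<forall>i. integrable \<nu> (\<lambda>x. \<bar>x$i\<bar> ^ 3)) \<and>
     (\<forall>i. (\<integral>x. x$i \<partial>\<nu>) = 0) \<and>
     prob_space.indep_vars \<nu> (\<lambda>_. borel) (\<lambda>i x. x$i) UNIV"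

text \<open>Point masses count as (degenerate) Gaussian laws.\<close>

definition gaussian :: "real measure \<Rightarrow> bool" where
  "gaussian \<mu> \<longleftrightarrow> (\<exists>m. \<mu> = return borel m) \<or>
     (\<exists>m \<sigma>. 0 < \<sigma> \<and> \<mu> = density lborel (\<lambda>x. ennreal (normal_density m \<sigma> x)))"

definition lsem_law :: "real^'n^'n \<Rightarrow> (real^'n::finite) measure \<Rightarrow> (real^'n) measure" where
  "lsem_law \<Lambda> \<nu> = distr \<nu> borel (\<lambda>\<epsilon>. transpose (matrix_inv (mat 1 - \<Lambda>)) *v \<epsilon>)"

definition model_laws :: "'n::finite digraph \<Rightarrow> (real^'n) measure set" where
  "model_laws E = {lsem_law \<Lambda> \<nu> | \<Lambda> \<nu>. \<Lambda> \<in> edge_coeffs_star E \<and> noise_law \<nu> \<and>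
     (\<forall>i. \<not> gaussian (distr \<nu> borel (\<lambda>x. x$i)))}"

definition dist_equivalent :: "'n::finite digraph \<Rightarrow> 'n digraph \<Rightarrow> bool" where
  "dist_equivalent E E' \<longleftrightarrow> model_laws E = model_laws E'"

definition model_second :: "real^'n^'n \<Rightarrow> real^'n^'n \<Rightarrow> real^'n^'n::finite" where
  "model_second \<Lambda> \<Omega>2 = transpose (matrix_inv (mat 1 - \<Lambda>)) ** \<Omega>2 ** matrix_inv (mat 1 - \<Lambda>)"

definition model_third :: "real^'n^'n \<Rightarrow> real^'n^'n^'n \<Rightarrow> real^'n^'n^'n::finite" where
  "model_third \<Lambda> \<Omega>3 = (let B = matrix_inv (mat 1 - \<Lambda>) in
     \<chi> i j k. \<Sum>a\<in>UNIV. B$a$i * B$a$j * B$a$k * \<Omega>3$a$a$a)"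

definition moment_model :: "'n::finite digraph \<Rightarrow> ((real^'n^'n) \<times> (real^'n^'n^'n)) set" where
  "moment_model E = {(model_second \<Lambda> \<Omega>2, model_third \<Lambda> \<Omega>3) | \<Lambda> \<Omega>2 \<Omega>3.
     \<Lambda> \<in> edge_coeffs E \<and>
     (\<forall>i j. i \<noteq> j \<longrightarrow> \<Omega>2$i$j = 0) \<and> (\<forall>x. x \<noteq> 0 \<longrightarrow> 0 < x \<bullet> (\<Omega>2 *v x)) \<and>
     (\<forall>i j k. \<not> (i = j \<and> j = k) \<longrightarrow> \<Omega>3$i$j$k = 0)}"

text \<open>Coordinates of the parameter space: the coefficients on the edges and the diagonals of the two
  noise moment tensors. ``Generic'' refers to the Lebesgue measure in these coordinates.\<close>

definition parameters ::
  "'n::finite digraph \<Rightarrow> real^'n^'n \<Rightarrow> real^'n^'n \<Rightarrow> real^'n^'n^'n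
     \<Rightarrow> ('n \<times> 'n \<Rightarrow> real) \<times> (real^'n) \<times> (real^'n)" where
  "parameters E \<Lambda> \<Omega>2 \<Omega>3 =
     (\<lambda>e\<in>E. \<Lambda> $ fst e $ snd e, \<chi> i. \<Omega>2$i$i, \<chi> i. \<Omega>3$i$i$i)"

definition parameter_measure ::
  "'n::finite digraph \<Rightarrow> (('n \<times> 'n \<Rightarrow> real) \<times> (real^'n) \<times> (real^'n)) measure" where
  "parameter_measure E = (\<Pi>\<^sub>M e\<in>E. lborel) \<Otimes>\<^sub>M (lborel \<Otimes>\<^sub>M lborel)"


section \<open>Regression on a set of vertices\<close>

text \<open>The inverse of the submatrix \<open>S\<^bsub>A,A\<^esub>\<close>: the matrix is padded by the identity outside
  \<open>A \<times> A\<close> before it is inverted, and only the entries in \<open>A \<times> A\<close> are used.\<close>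

definition sub_inverse :: "'n::finite set \<Rightarrow> real^'n^'n \<Rightarrow> real^'n^'n" where
  "sub_inverse A S =
     matrix_inv (\<chi> i j. if i \<in> A \<and> j \<in> A then S$i$j else if i = j then 1 else 0)"

text \<open>The entry \<open>(b, a)\<close> of \<open>R\<^bsub>B,A\<^esub> = S\<^bsub>B,A\<^esub> S\<^bsub>A,A\<^esub>\<^sup>-\<^sup>1\<close>, for \<open>a \<in> A\<close>; it does not depend on
  \<open>B\<close>.\<close>

definition regression :: "real^'n^'n \<Rightarrow> 'n set \<Rightarrow> 'n \<Rightarrow> 'n::finite \<Rightarrow> real" where
  "regression S A b a = (\<Sum>c\<in>A. S$b$c * sub_inverse A S $c$a)"

text \<open>The matrix sending \<open>X\<close> to the residuals \<open>X\<^sub>b - (R\<^bsub>B,A\<^esub> X\<^sub>A)\<^sub>b\<close>. Its rows in \<open>A\<close> vanish when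
  \<open>S\<^bsub>A,A\<^esub>\<close> is invertible and are never used.\<close>

definition residual_map :: "'n::finite set \<Rightarrow> real^'n^'n \<Rightarrow> real^'n^'n" where
  "residual_map A S = (\<chi> b j. (if b = j then 1 else 0) - (if j \<in> A then regression S A b j else 0))"

definition residual_second :: "'n::finite set \<Rightarrow> real^'n^'n \<Rightarrow> real^'n^'n" where
  "residual_second A S = residual_map A S ** S ** transpose (residual_map A S)"

definition residual_third :: "'n::finite set \<Rightarrow> real^'n^'n \<Rightarrow> real^'n^'n^'n \<Rightarrow> real^'n^'n^'n" where
  "residual_third A S T = (let Q = residual_map A S in
     \<chi> i j k. \<Sum>a\<in>UNIV. \<Sum>b\<in>UNIV. \<Sum>c\<in>UNIV. Q$i$a * Q$j$b * Q$k$c * T$a$b$c)"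


section \<open>Part 1: strong components\<close>

text \<open>\<open>W\<close> is the set of remaining vertices; \<open>S\<close> and \<open>T\<close> are the current moments, whose entries
  with an index outside \<open>W\<close> are irrelevant.\<close>

definition d22 :: "real^'n^'n \<Rightarrow> real^'n^'n^'n \<Rightarrow> 'n \<Rightarrow> 'n \<Rightarrow> real" where
  "d22 S T u v = S$u$u * T$u$u$v - S$u$v * T$u$u$u"

definition d33 :: "real^'n^'n \<Rightarrow> real^'n^'n^'n \<Rightarrow> 'n \<Rightarrow> 'n \<Rightarrow> real" where
  "d33 S T u v = det (vector [
     vector [S$u$u, S$u$v, S$v$v],
     vector [T$u$u$u, T$u$u$v, T$u$v$v],
     vector [T$u$u$v, T$u$v$v, T$v$v$v]] :: real^3^3)"

definition root_nodes :: "'n set \<Rightarrow> real^'n^'n \<Rightarrow> real^'n^'n^'n \<Rightarrow> 'n set" where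
  "root_nodes W S T = {r \<in> W. \<forall>u\<in>W. d22 S T r u = 0}"

definition cycle_like :: "real^'n^'n \<Rightarrow> real^'n^'n^'n \<Rightarrow> 'n set \<Rightarrow> bool" where
  "cycle_like S T C \<longleftrightarrow> (\<forall>u\<in>C. \<forall>v\<in>C. u \<noteq> v \<longrightarrow> d33 S T u v = 0 \<and> d22 S T u v \<noteq> 0)"

definition candidates :: "'n set \<Rightarrow> real^'n^'n \<Rightarrow> real^'n^'n^'n \<Rightarrow> 'n set set" where
  "candidates W S T = {C. C \<subseteq> W \<and> cycle_like S T C \<and>
     (\<forall>D. C \<subset> D \<and> D \<subseteq> W \<longrightarrow> \<not> cycle_like S T D)}"

text \<open>The expression tested is \<open>\<E>[X\<^sub>c\<^sup>2 (X\<^sub>D - R\<^bsub>D,C\<^esub> X\<^sub>C)\<^sub>d]\<close>, written out in the moments.\<close>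

definition root_cycles :: "'n::finite set \<Rightarrow> real^'n^'n \<Rightarrow> real^'n^'n^'n \<Rightarrow> 'n set set" where
  "root_cycles W S T = {C \<in> candidates W S T. \<forall>D \<in> candidates W S T - {C}. \<forall>c\<in>C. \<forall>d\<in>D.
     T$c$c$d - (\<Sum>a\<in>C. regression S C d a * T$c$c$a) = 0}"

text \<open>The orientations of the undirected cycle on \<open>C\<close>; for \<open>card C = 2\<close> there is only one, the
  2-cycle.\<close>

definition orientations :: "real^'n^'n \<Rightarrow> 'n::finite set \<Rightarrow> 'n digraph set" where
  "orientations S C = {cycle_edges vs | vs. distinct vs \<and> 2 \<le> length vs \<and> set vs = C \<and>
     (\<forall>u\<in>C. \<forall>v\<in>C. u \<noteq> v \<longrightarrow>
        ((u, v) \<in> cycle_edges vs \<or> (v, u) \<in> cycle_edges vs) = (sub_inverse C S $u$v \<noteq> 0))}"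

definition weight_linear ::
  "real^'n^'n \<Rightarrow> real^'n^'n^'n \<Rightarrow> 'n \<Rightarrow> 'n \<Rightarrow> 'n \<Rightarrow> real \<Rightarrow> bool" where
  "weight_linear S T u v w l \<longleftrightarrow>
     (let a1 = vector [S$u$u, T$u$u$u, T$u$u$v] :: real^3;
          a2 = vector [S$u$v, T$u$u$v, T$u$v$v] :: real^3;
          a4 = vector [S$u$w, T$u$u$w, T$u$v$w] :: real^3;
          a5 = vector [S$v$w, T$u$v$w, T$v$v$w] :: real^3
      in det (transpose (vector [a1, a4, a5]) :: real^3^3) * l
           = det (transpose (vector [a2, a4, a5]) :: real^3^3))"

definition weight_quadratic ::
  "real^'n^'n \<Rightarrow> real^'n^'n^'n \<Rightarrow> 'n \<Rightarrow> 'n \<Rightarrow> real \<Rightarrow> bool" where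
  "weight_quadratic S T u v l \<longleftrightarrow>
     (S$u$u * T$u$u$v - S$u$v * T$u$u$u) * l\<^sup>2 + (S$v$v * T$u$u$u - S$u$u * T$u$v$v) * l
       + S$u$v * T$u$v$v - S$v$v * T$u$u$v = 0"

text \<open>The possible weights along an oriented cycle, as a matrix supported on its edges. On a 2-cycle
  each of the two weights is a root of its own quadratic equation. If the roots for \<open>u \<rightarrow> v\<close> are
  \<open>a\<close> and \<open>1/b\<close>, then those for \<open>v \<rightarrow> u\<close> are \<open>b\<close> and \<open>1/a\<close>; the roots must be paired such
  that \<open>I - L\<close> is invertible, as required of every coefficient matrix, which leaves the two
  solutions \<open>(a, b)\<close> and \<open>(1/b, 1/a)\<close>.\<close>

definition cycle_weights ::
  "real^'n^'n \<Rightarrow> real^'n^'n^'n \<Rightarrow> 'n::finite set \<Rightarrow> 'n digraph \<Rightarrow> (real^'n^'n) set" where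
  "cycle_weights S T C F = {L. (\<forall>i j. (i, j) \<notin> F \<longrightarrow> L$i$j = 0) \<and>
     (if card C = 2
      then (\<forall>(u, v) \<in> F. weight_quadratic S T u v (L$u$v)) \<and> invertible (mat 1 - L)
      else (\<forall>u v w. (u, v) \<in> F \<and> (v, w) \<in> F \<longrightarrow> weight_linear S T u v w (L$u$v)))}"

text \<open>The algorithm leaves the orientation of each cycle and the solution of the quadratic equation
  open. The rules \<open>ori\<close> and \<open>wt\<close> below make these choices by selecting an element from every
  nonempty set of possibilities.\<close>

definition choice_rule :: "('a set \<Rightarrow> 'a) \<Rightarrow> bool" where
  "choice_rule f \<longleftrightarrow> (\<forall>K. K \<noteq> {} \<longrightarrow> f K \<in> K)"

text \<open>The result consists of the sets of components recorded in the successive rounds, the edges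
  within the components, and their weights; \<^const>\<open>None\<close> signals that the algorithm is stuck.\<close>

function part1 ::
  "('n digraph set \<Rightarrow> 'n digraph) \<Rightarrow> ((real^'n^'n) set \<Rightarrow> real^'n^'n)
     \<Rightarrow> 'n::finite set \<Rightarrow> real^'n^'n \<Rightarrow> real^'n^'n^'n
     \<Rightarrow> ('n set set list \<times> 'n digraph \<times> (real^'n^'n)) option" where
  "part1 ori wt W S T =
     (if W = {} then Some ([], {}, 0)
      else let A = root_nodes W S T in
        if A \<noteq> {} then
          map_option (\<lambda>(Ls, F, L). ((\<lambda>r. {r}) ` A # Ls, F, L))
            (part1 ori wt (W - A) (residual_second A S) (residual_third A S T))
        else let \<C> = root_cycles W S T; orient = (\<lambda>C. ori (orientations S C)) in
          if \<C> = {} \<or> (\<exists>C\<in>\<C>. orientations S C = {} \<or> cycle_weights S T C (orient C) = {}) then None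
          else
            map_option (\<lambda>(Ls, F, L). (\<C> # Ls, (\<Union>C\<in>\<C>. orient C) \<union> F,
                (\<Sum>C\<in>\<C>. wt (cycle_weights S T C (orient C))) + L))
              (part1 ori wt (W - \<Union>\<C>) (residual_second (\<Union>\<C>) S) (residual_third (\<Union>\<C>) S T)))"
  by pat_completeness auto
termination
proof (relation "Wellfounded.measure (\<lambda>(_, _, W, _, _). card W)", goal_cases)
  case 1
  show ?case by simp
next
  case (2 ori wt W S T A)
  then have "W - A \<subset> W" by (auto simp: root_nodes_def)
  then show ?case by (simp add: psubset_card_mono)
next
  case (3 ori wt W S T A \<C> orient)
  then obtain C where C: "C \<in> \<C>" "orientations S C \<noteq> {}" by blast
  then have "C \<noteq> {}" by (auto simp: orientations_def)
  moreover have "C \<subseteq> W" using C 3 by (auto simp: root_cycles_def candidates_def)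
  ultimately have "W - \<Union>\<C> \<subset> W" using C by blast
  then show ?case by (simp add: psubset_card_mono)
qed

declare part1.simps [simp del]


section \<open>Part 2: edges between components, and the output\<close>

definition earlier :: "'n set set list \<Rightarrow> nat \<Rightarrow> 'n set" where
  "earlier Ls k = (\<Union>m<k. \<Union>(Ls ! m))"

text \<open>The blocks \<open>R\<^bsub>D,C\<^esub>\<^sup>T (I - \<Lambda>\<^bsub>D,D\<^esub>)\<close>, where \<open>C\<close> is the set of vertices recorded in earlier rounds
  than \<open>D\<close>; here \<open>S\<close> is again the original matrix.\<close>

definition part2 :: "'n set set list \<Rightarrow> real^'n^'n \<Rightarrow> real^'n^'n \<Rightarrow> real^'n^'n::finite" where
  "part2 Ls L S = (\<chi> c d. \<Sum>k<length Ls. \<Sum>D\<in>Ls ! k.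
     if c \<in> earlier Ls k \<and> d \<in> D
     then \<Sum>e\<in>D. regression S (earlier Ls k) e c * (mat 1 - L)$e$d
     else 0)"

definition causal_graph_discovery ::
  "('n digraph set \<Rightarrow> 'n digraph) \<Rightarrow> ((real^'n^'n) set \<Rightarrow> real^'n^'n)
     \<Rightarrow> real^'n^'n \<Rightarrow> real^'n^'n^'n::finite \<Rightarrow> ('n digraph \<times> (real^'n^'n)) option" where
  "causal_graph_discovery ori wt S T =
     map_option (\<lambda>(Ls, F, L). (F \<union> {(c, d). part2 Ls L S $c$d \<noteq> 0}, L + part2 Ls L S))
       (part1 ori wt UNIV S T)"

end

theory Submission
  imports Defs "HOL-Combinatorics.Cycles"
begin

text \<open>Write \<open>N = I - \<Lambda>\<close> and \<open>B = N\<^sup>-\<^sup>1\<close>. Regressing on a set of vertices that contains its own parents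
  leaves a model of the same kind, whose total effects are the entries of \<open>B\<close> between the remaining
  vertices. Everything the algorithm tests is a polynomial in the third moments of the noise, with
  coefficients that depend on \<open>\<Lambda>\<close> and the second moments; for generic noise it therefore vanishes only
  if it vanishes identically in the third moments. If the residual tests of a set \<open>C\<close> vanish
  identically, a rank argument shows that \<open>C\<close> contains its own parents, which singles out the root
  nodes and root cycles. The equations for the weights along a root cycle are solved by \<open>\<Lambda>\<close> and by
  the coefficients that result from shifting the noise terms along the cycle, which reverses it, and
  by nothing else. Altogether the noise has been permuted and rescaled: \<open>I - \<Lambda>'\<close> arises from \<open>I - \<Lambda>\<close>
  by permuting and rescaling columns.

  The description of the equivalence class does not need the Darmois--Skitovich theorem. If two models
  have the same law, their noise vectors are related by an invertible matrix, and as the third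
  moments of the given noise are nonzero on the diagonal and vanish off it, for both vectors this
  matrix has a single nonzero entry in each row and column.\<close>

section \<open>Zero sets of polynomials\<close>

text \<open>A test that vanishes identically in the third moments can be evaluated at third moments
  concentrated on one or two noise terms; this turns polynomial identities into linear relations
  that hold row by row in \<open>B\<close>, where the rank argument starts. The null set is fixed
  before the run and before the rules \<open>ori\<close> and \<open>wt\<close>, so genericity covers
  every test on every set of vertices, not only those met in a run. The entries of \<open>B\<close>
  are rational in \<Lambda>; they and the second moments are kept as parameters on which a test
  depends measurably, and polynomiality is used in the third moments alone. One condition does
  couple \<Lambda> with the second moments: on a 2-cycle the entry of the inverse covariance is a
  sum of two terms that could cancel and hide the adjacency. Choices are made separately on each
  cycle, and on a 2-cycle the edges do not reveal which permutation the weights belong to; hence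
  permutations, not graphs, are carried through the rounds and glued together.\<close>

definition line_poly :: "('a::real_vector \<Rightarrow> real) \<Rightarrow> bool" where
  "line_poly f \<longleftrightarrow> (\<forall>x y. \<exists>p. \<forall>t. f (x + t *\<^sub>R y) = poly p t)"

lemma line_polyD:
  assumes "line_poly f"
  obtains p where "\<And>t. f (x + t *\<^sub>R y) = poly p t"
  using assms unfolding line_poly_def by blast

lemma line_poly_const [intro]: "line_poly (\<lambda>_. c)"
  unfolding line_poly_def by (auto intro: exI[of _ "[:c:]"])

lemma line_poly_linear:
  assumes "linear f"
  shows "line_poly f"
  unfolding line_poly_def
proof (intro allI)
  fix x y
  have "\<forall>t. f (x + t *\<^sub>R y) = poly [:f x, f y:] t"
    using assms by (simp add: linear_add linear_scale)
  then show "\<exists>p. \<forall>t. f (x + t *\<^sub>R y) = poly p t" by blast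
qed

lemma line_poly_add [intro]:
  assumes "line_poly f" "line_poly g"
  shows "line_poly (\<lambda>x. f x + g x)"
  unfolding line_poly_def
proof (intro allI)
  fix x y
  obtain p q where "\<And>t. f (x + t *\<^sub>R y) = poly p t" "\<And>t. g (x + t *\<^sub>R y) = poly q t"
    using assms by (meson line_polyD)
  then have "\<forall>t. f (x + t *\<^sub>R y) + g (x + t *\<^sub>R y) = poly (p + q) t" by simp
  then show "\<exists>p. \<forall>t. f (x + t *\<^sub>R y) + g (x + t *\<^sub>R y) = poly p t" by blast
qed

lemma line_poly_mult [intro]:
  assumes "line_poly f" "line_poly g"
  shows "line_poly (\<lambda>x. f x * g x)"
  unfolding line_poly_def
proof (intro allI)
  fix x y
  obtain p q where "\<And>t. f (x + t *\<^sub>R y) = poly p t" "\<And>t. g (x + t *\<^sub>R y) = poly q t"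
    using assms by (meson line_polyD)
  then have "\<forall>t. f (x + t *\<^sub>R y) * g (x + t *\<^sub>R y) = poly (p * q) t" by simp
  then show "\<exists>p. \<forall>t. f (x + t *\<^sub>R y) * g (x + t *\<^sub>R y) = poly p t" by blast
qed

lemma line_poly_diff [intro]:
  assumes "line_poly f" "line_poly g"
  shows "line_poly (\<lambda>x. f x - g x)"
  using line_poly_add[OF assms(1) line_poly_mult[OF line_poly_const[of "-1"] assms(2)]] by simp

lemma line_poly_sum [intro]:
  assumes "\<And>i. i \<in> I \<Longrightarrow> line_poly (f i)"
  shows "line_poly (\<lambda>x. \<Sum>i\<in>I. f i x)"
  using assms by (induction I rule: infinite_finite_induct) auto

text \<open>A univariate polynomial that vanishes at some \<open>t\<close> but not at \<open>t + 1\<close> has finitely many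
  roots, so every line in direction \<open>v\<close> meets the set in a null set; averaging over translations
  by \<open>t v\<close>, \<open>0 \<le> t \<le> 1\<close>, then shows that it is null.\<close>

lemma null_sets_poly_direction:
  fixes f :: "'a::euclidean_space \<Rightarrow> real"
  assumes [measurable]: "f \<in> borel_measurable borel"
    and poly: "\<And>x. \<exists>p. \<forall>t. f (x + t *\<^sub>R v) = poly p t"
  shows "{x. f x = 0 \<and> f (x + v) \<noteq> 0} \<in> null_sets lborel"
proof -
  define Z where "Z = {x. f x = 0 \<and> f (x + v) \<noteq> 0}"
  have Z [measurable]: "Z \<in> sets borel" unfolding Z_def by measurable
  have fin: "finite {t. x + t *\<^sub>R v \<in> Z}" for x
  proof (cases "\<exists>t. x + t *\<^sub>R v \<in> Z")
    case True
    obtain p where p: "\<And>t. f (x + t *\<^sub>R v) = poly p t" using poly by meson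
    obtain t where "x + t *\<^sub>R v \<in> Z" using True by blast
    then have "poly p (t + 1) \<noteq> 0"
      using p[of "t + 1"] by (simp add: Z_def algebra_simps)
    then have "finite {t. poly p t = 0}" by (auto intro!: poly_roots_finite)
    then show ?thesis by (rule rev_finite_subset) (auto simp: Z_def p)
  qed auto
  have "emeasure lborel Z = (\<integral>\<^sup>+t. emeasure lborel Z * indicator {0..1} (t::real) \<partial>lborel)"
    by (simp add: nn_integral_cmult)
  also have "\<dots> = (\<integral>\<^sup>+t. (\<integral>\<^sup>+x. indicator Z (x + t *\<^sub>R v) * indicator {0..1} t \<partial>lborel) \<partial>lborel)"
  proof (rule nn_integral_cong)
    fix t :: real
    have "emeasure lborel Z = (\<integral>\<^sup>+x. indicator Z x \<partial>(distr lborel borel ((+) (t *\<^sub>R v))))"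
      by (simp add: lborel_distr_plus)
    also have "\<dots> = (\<integral>\<^sup>+x. indicator Z (x + t *\<^sub>R v) \<partial>lborel)"
      by (subst nn_integral_distr) (simp_all add: add.commute)
    finally show "emeasure lborel Z * indicator {0..1} t =
        (\<integral>\<^sup>+x. indicator Z (x + t *\<^sub>R v) * indicator {0..1} t \<partial>lborel)"
      by (subst nn_integral_multc) simp_all
  qed
  also have "\<dots> = (\<integral>\<^sup>+x. (\<integral>\<^sup>+t. indicator Z (x + t *\<^sub>R v) * indicator {0..1} t \<partial>lborel) \<partial>lborel)"
    by (rule lborel_pair.Fubini') measurable
  also have "\<dots> = (\<integral>\<^sup>+x. 0 \<partial>(lborel :: 'a measure))"
  proof (rule nn_integral_cong)
    fix x :: 'a
    have "(\<integral>\<^sup>+t. indicator Z (x + t *\<^sub>R v) * indicator {0..1} t \<partial>lborel)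
        \<le> (\<integral>\<^sup>+t. indicator {t. x + t *\<^sub>R v \<in> Z} t \<partial>lborel)"
      by (rule nn_integral_mono) (auto split: split_indicator)
    also have "\<dots> = 0"
      using finite_imp_null_set_lborel[OF fin[of x]] by (subst nn_integral_indicator) auto
    finally show "(\<integral>\<^sup>+t. indicator Z (x + t *\<^sub>R v) * indicator {0..1} t \<partial>lborel) = 0" by simp
  qed
  finally show ?thesis using Z by (auto simp: Z_def)
qed

text \<open>Polynomiality along lines is asked for only in the directions \<open>g c\<close>; on
  \<open>p\<close> the function may depend in any jointly measurable way. For fixed \<open>c\<close>
  the exceptional set is null for each \<open>p\<close>. A countable dense set of \<open>c\<close>
  gives one null set for all of these, and continuity passes to every \<open>c\<close>.\<close>

lemma AE_poly_zero_imp_zero: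
  fixes f :: "'p \<Rightarrow> 'a::euclidean_space \<Rightarrow> real" and g :: "'c::euclidean_space \<Rightarrow> 'a"
  assumes M: "sigma_finite_measure M"
    and meas: "(\<lambda>(p, x). f p x) \<in> borel_measurable (M \<Otimes>\<^sub>M borel)"
    and g: "linear g"
    and poly: "\<And>p x. line_poly (\<lambda>c. f p (x + g c))"
    and cont: "\<And>p x. continuous_on UNIV (\<lambda>c. f p (x + g c))"
  shows "AE (p, x) in M \<Otimes>\<^sub>M lborel. f p x = 0 \<longrightarrow> (\<forall>c. f p (x + g c) = 0)"
proof -
  interpret pair: pair_sigma_finite M "lborel :: 'a measure"
    using M by (simp add: pair_sigma_finite_def lborel.sigma_finite_measure_axioms)
  obtain D :: "'c set" where D: "countable D" "\<And>X. open X \<Longrightarrow> X \<noteq> {} \<Longrightarrow> \<exists>d\<in>D. d \<in> X"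
    using countable_dense_setE by blast
  have meas' [measurable]: "(\<lambda>y. f (fst y) (snd y)) \<in> borel_measurable (M \<Otimes>\<^sub>M borel)"
    using meas by (simp add: case_prod_beta')
  have "AE y in M \<Otimes>\<^sub>M lborel. f (fst y) (snd y) = 0 \<longrightarrow> f (fst y) (snd y + g c) = 0" for c
  proof (rule pair.AE_pair_measure)
    have "(\<lambda>y. f (fst y) (snd y + g c)) \<in> borel_measurable (M \<Otimes>\<^sub>M borel)"
      using measurable_compose[OF _ meas', of "\<lambda>y. (fst y, snd y + g c)"] by simp
    then show "{y \<in> space (M \<Otimes>\<^sub>M lborel). f (fst y) (snd y) = 0 \<longrightarrow> f (fst y) (snd y + g c) = 0}
        \<in> sets (M \<Otimes>\<^sub>M lborel)"
      by measurable
    show "AE p in M. AE x in lborel. f (fst (p, x)) (snd (p, x)) = 0 \<longrightarrow>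
        f (fst (p, x)) (snd (p, x) + g c) = 0"
    proof (rule AE_I2)
      fix p assume p: "p \<in> space M"
      have "f p \<in> borel_measurable borel"
        using measurable_compose[OF _ meas', of "\<lambda>x. (p, x)"] p by simp
      moreover have "\<exists>q. \<forall>t. f p (x + t *\<^sub>R g c) = poly q t" for x
        using line_polyD[OF poly[of p x], of 0 c] g by (metis add_0 linear_scale)
      ultimately have "{x. f p x = 0 \<and> f p (x + g c) \<noteq> 0} \<in> null_sets lborel"
        by (rule null_sets_poly_direction)
      then have "AE x in lborel. x \<notin> {x. f p x = 0 \<and> f p (x + g c) \<noteq> 0}" by (rule AE_not_in)
      then show "AE x in lborel. f (fst (p, x)) (snd (p, x)) = 0 \<longrightarrow>
          f (fst (p, x)) (snd (p, x) + g c) = 0"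
        by eventually_elim simp
    qed
  qed
  then have "AE y in M \<Otimes>\<^sub>M lborel. \<forall>c\<in>D. f (fst y) (snd y) = 0 \<longrightarrow> f (fst y) (snd y + g c) = 0"
    by (intro AE_ball_countable[OF D(1), THEN iffD2] ballI)
  then show ?thesis
  proof eventually_elim
    case (elim y)
    obtain p x where y: "y = (p, x)" by fastforce
    have "f p (x + g c) = 0" if "f p x = 0" for c
    proof (rule ccontr)
      assume ne: "f p (x + g c) \<noteq> 0"
      have "open {c. f p (x + g c) \<noteq> 0}"
        using cont[of p x] by (intro open_Collect_neq) auto
      with D(2) ne obtain d where "d \<in> D" "f p (x + g d) \<noteq> 0" by blast
      then show False using elim that y by auto
    qed
    then show ?case using y by auto
  qed
qed

section \<open>Moments of noise vectors\<close>

lemma measurable_vec_nth [measurable]: "(\<lambda>x::real^'n::finite. x $ i) \<in> borel_measurable borel"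
  by (intro borel_measurable_continuous_onI continuous_intros)

lemma measurable_vec_lambda:
  assumes "\<And>i. (\<lambda>x. f x i) \<in> borel_measurable M"
  shows "(\<lambda>x. (\<chi> i. f x i) :: real^'n::finite) \<in> borel_measurable M"
  by (rule borel_measurable_euclidean_space[THEN iffD2])
    (auto simp: Basis_vec_def inner_axis assms)

lemma measurable_matrix_vector_mult [measurable]:
  "(\<lambda>x. M *v x) \<in> borel_measurable (borel :: (real^'n::finite) measure)"
  by (intro borel_measurable_continuous_onI linear_continuous_on linear_linear[THEN iffD2]
      matrix_vector_mul_linear)

lemma (in prob_space) indep_vars_distr:
  fixes X :: "'i \<Rightarrow> 'b \<Rightarrow> real"
  assumes [measurable]: "f \<in> measurable M N" "\<And>i. X i \<in> borel_measurable N"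
    and ind: "indep_vars (\<lambda>_. borel) (\<lambda>i x. X i (f x)) UNIV"
  shows "prob_space.indep_vars (distr M N f) (\<lambda>_. borel) X UNIV"
proof -
  interpret D: prob_space "distr M N f" by (rule prob_space_distr) simp
  have "distr (distr M N f) (\<Pi>\<^sub>M i\<in>UNIV. borel) (\<lambda>x. \<lambda>i\<in>UNIV. X i x) =
      distr M (\<Pi>\<^sub>M i\<in>UNIV. borel) (\<lambda>x. \<lambda>i\<in>UNIV. X i (f x))"
    by (subst distr_distr) (auto simp: comp_def)
  also have "\<dots> = (\<Pi>\<^sub>M i\<in>UNIV. distr M borel (\<lambda>x. X i (f x)))"
    using ind by (subst (asm) indep_vars_iff_distr_eq_PiM) auto
  also have "\<dots> = (\<Pi>\<^sub>M i\<in>UNIV. distr (distr M N f) borel (X i))"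
    by (intro PiM_cong refl) (subst distr_distr, auto simp: comp_def)
  finally show ?thesis by (subst D.indep_vars_iff_distr_eq_PiM) auto
qed

text \<open>Reindexing along an injection is a grouping into disjoint singleton blocks.\<close>

lemma (in prob_space) indep_vars_inj:
  assumes "indep_vars M' X UNIV" and "inj \<pi>"
  shows "indep_vars (\<lambda>j. M' (\<pi> j)) (\<lambda>j. X (\<pi> j)) UNIV"
proof -
  have "indep_vars (\<lambda>j. PiM {\<pi> j} M') (\<lambda>j \<omega>. restrict (\<lambda>i. X i \<omega>) {\<pi> j}) UNIV"
    using assms by (intro indep_vars_restrict) (auto simp: disjoint_family_on_def inj_def)
  then have "indep_vars (\<lambda>j. M' (\<pi> j)) (\<lambda>j \<omega>. (restrict (\<lambda>i. X i \<omega>) {\<pi> j}) (\<pi> j)) UNIV"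
    by (rule indep_vars_compose2) simp
  then show ?thesis by simp
qed

lemma noise_lawD:
  assumes "noise_law \<nu>"
  shows "prob_space \<nu>" "sets \<nu> = sets borel" "space \<nu> = UNIV"
    "\<And>i. integrable \<nu> (\<lambda>x. \<bar>x$i\<bar> ^ 3)" "\<And>i. (\<integral>x. x$i \<partial>\<nu>) = 0"
    "prob_space.indep_vars \<nu> (\<lambda>_. borel) (\<lambda>i x. x$i) UNIV"
  using assms sets_eq_imp_space_eq[of \<nu> borel] by (auto simp: noise_law_def)

lemma noise_power_integrable:
  assumes \<nu>: "noise_law \<nu>" and m: "m \<le> 3"
  shows "integrable \<nu> (\<lambda>x. x$i ^ m)"
proof -
  note D = noise_lawD[OF \<nu>]
  interpret prob_space \<nu> by (rule D)
  have [measurable_cong]: "sets \<nu> = sets borel" by (rule D)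
  show ?thesis
  proof (rule Bochner_Integration.integrable_bound)
    show "integrable \<nu> (\<lambda>x. 1 + \<bar>x$i\<bar> ^ 3)" using D(4) by simp
    have "\<bar>t\<bar> ^ m \<le> 1 + \<bar>t\<bar> ^ 3" for t :: real
    proof (cases "\<bar>t\<bar> \<le> 1")
      case True
      then show ?thesis by (simp add: power_le_one add_increasing2)
    next
      case False
      then have "\<bar>t\<bar> ^ m \<le> \<bar>t\<bar> ^ 3" using m by (intro power_increasing) auto
      then show ?thesis by simp
    qed
    then show "AE x in \<nu>. norm (x$i ^ m) \<le> norm (1 + \<bar>x$i\<bar> ^ 3)"
      by (auto simp: power_abs)
  qed measurable
qed

text \<open>Mixed moments are treated as monomials: independence splits the integral into
  one-dimensional factors, and a factor with exponent 1 vanishes because the noise is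
  centered.\<close>

lemma
  assumes \<nu>: "noise_law \<nu>" and m: "\<And>i. m i \<le> 3"
  shows noise_monomial_integrable: "integrable \<nu> (\<lambda>x. \<Prod>i\<in>UNIV. x$i ^ m i)"
    and noise_monomial_integral: "(\<integral>x. (\<Prod>i\<in>UNIV. x$i ^ m i) \<partial>\<nu>) = (\<Prod>i\<in>UNIV. \<integral>x. x$i ^ m i \<partial>\<nu>)"
proof -
  note D = noise_lawD[OF \<nu>]
  interpret prob_space \<nu> by (rule D)
  have "indep_vars (\<lambda>_. borel) (\<lambda>i x. x$i ^ m i) UNIV"
    by (rule indep_vars_compose2[OF D(6)]) measurable
  then show "integrable \<nu> (\<lambda>x. \<Prod>i\<in>UNIV. x$i ^ m i)"
    "(\<integral>x. (\<Prod>i\<in>UNIV. x$i ^ m i) \<partial>\<nu>) = (\<Prod>i\<in>UNIV. \<integral>x. x$i ^ m i \<partial>\<nu>)"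
    using noise_power_integrable[OF \<nu> m]
    by (auto intro!: indep_vars_integrable indep_vars_lebesgue_integral)
qed

lemma prod_power_of_bool: "(\<Prod>l\<in>UNIV. (x::real^'n::finite)$l ^ of_bool (l = i)) = x$i"
proof -
  have "(\<Prod>l\<in>UNIV. x$l ^ of_bool (l = i)) = (\<Prod>l\<in>UNIV. if l = i then x$l else 1)"
    by (rule prod.cong) auto
  then show ?thesis by simp
qed

lemma
  fixes \<nu> :: "(real^'n::finite) measure"
  assumes \<nu>: "noise_law \<nu>"
  shows noise_integrable2: "integrable \<nu> (\<lambda>x. x$i * x$j)"
    and second_moments_diag: "i \<noteq> j \<Longrightarrow> second_moments \<nu> $i$j = 0"
proof -
  define m where "m l = (of_bool (l = i) + of_bool (l = j) :: nat)" for l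
  have m: "m l \<le> 3" for l by (auto simp: m_def)
  have eq: "(\<lambda>x::real^'n. \<Prod>l\<in>UNIV. x$l ^ m l) = (\<lambda>x. x$i * x$j)"
    by (simp add: m_def power_add prod.distrib prod_power_of_bool)
  show "integrable \<nu> (\<lambda>x. x$i * x$j)"
    using noise_monomial_integrable[of \<nu> m] \<nu> m eq by simp
  assume "i \<noteq> j"
  then have "(\<integral>x. x$i ^ m i \<partial>\<nu>) = 0"
    using noise_lawD(5)[OF \<nu>] by (simp add: m_def)
  then show "second_moments \<nu> $i$j = 0"
    using noise_monomial_integral[of \<nu> m] \<nu> m eq by (auto simp: second_moments_def)
qed

lemma
  fixes \<nu> :: "(real^'n::finite) measure"
  assumes \<nu>: "noise_law \<nu>"
  shows noise_integrable3: "integrable \<nu> (\<lambda>x. x$i * x$j * x$k)"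
    and third_moments_diag: "\<not> (i = j \<and> j = k) \<Longrightarrow> third_moments \<nu> $i$j$k = 0"
proof -
  define m where "m l = (of_bool (l = i) + of_bool (l = j) + of_bool (l = k) :: nat)" for l
  have m: "m l \<le> 3" for l by (auto simp: m_def)
  have eq: "(\<lambda>x::real^'n. \<Prod>l\<in>UNIV. x$l ^ m l) = (\<lambda>x. x$i * x$j * x$k)"
    by (simp add: m_def power_add prod.distrib prod_power_of_bool)
  show "integrable \<nu> (\<lambda>x. x$i * x$j * x$k)"
    using noise_monomial_integrable[of \<nu> m] \<nu> m eq by simp
  assume "\<not> (i = j \<and> j = k)"
  \<comment> \<open>Among three indices that are not all equal, one occurs exactly once.\<close>
  then have "m k = 1 \<or> m i = 1 \<or> m j = 1" by (auto simp: m_def)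
  then obtain l where "m l = 1" by blast
  then have "(\<integral>x. x$l ^ m l \<partial>\<nu>) = 0"
    using noise_lawD(5)[OF \<nu>] by simp
  then show "third_moments \<nu> $i$j$k = 0"
    using noise_monomial_integral[of \<nu> m] \<nu> m eq by (auto simp: third_moments_def)
qed

lemma second_moments_linear_image:
  fixes M :: "real^'n^'m::finite"
  assumes \<nu>: "noise_law \<nu>"
  shows "second_moments (distr \<nu> borel (\<lambda>x. M *v x)) $i$j =
    (\<Sum>a\<in>UNIV. M$i$a * M$j$a * second_moments \<nu> $a$a)"
proof -
  have [measurable_cong]: "sets \<nu> = sets borel" by (rule noise_lawD[OF \<nu>])
  have "second_moments (distr \<nu> borel (\<lambda>x. M *v x)) $i$j =
      (\<integral>x. (M *v x)$i * (M *v x)$j \<partial>\<nu>)"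
    by (simp add: second_moments_def integral_distr)
  also have "\<dots> = (\<integral>x. (\<Sum>a\<in>UNIV. \<Sum>b\<in>UNIV. M$i$a * M$j$b * (x$a * x$b)) \<partial>\<nu>)"
    by (simp add: matrix_vector_mult_def sum_product algebra_simps)
  also have "\<dots> = (\<Sum>a\<in>UNIV. \<Sum>b\<in>UNIV. M$i$a * M$j$b * second_moments \<nu> $a$b)"
    using noise_integrable2[OF \<nu>] by (simp add: second_moments_def)
  also have "\<dots> = (\<Sum>a\<in>UNIV. \<Sum>b\<in>UNIV. if b = a then M$i$a * M$j$a * second_moments \<nu> $a$a else 0)"
    using second_moments_diag[OF \<nu>] by (intro sum.cong refl) auto
  finally show ?thesis by simp
qed

lemma sum_triple_product:
  fixes f g h :: "_ \<Rightarrow> 'a::semiring_0"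
  shows "(\<Sum>a\<in>A. f a) * (\<Sum>b\<in>B. g b) * (\<Sum>c\<in>C. h c) = (\<Sum>a\<in>A. \<Sum>b\<in>B. \<Sum>c\<in>C. f a * g b * h c)"
proof -
  have "(\<Sum>a\<in>A. f a) * (\<Sum>b\<in>B. g b) * (\<Sum>c\<in>C. h c) = (\<Sum>a\<in>A. \<Sum>b\<in>B. f a * g b * (\<Sum>c\<in>C. h c))"
    by (subst sum_product) (simp only: sum_distrib_right)
  then show ?thesis by (simp only: sum_distrib_left)
qed

lemma third_moments_linear_image:
  fixes M :: "real^'n^'m::finite"
  assumes \<nu>: "noise_law \<nu>"
  shows "third_moments (distr \<nu> borel (\<lambda>x. M *v x)) $i$j$k =
    (\<Sum>a\<in>UNIV. M$i$a * M$j$a * M$k$a * third_moments \<nu> $a$a$a)"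
proof -
  have [measurable_cong]: "sets \<nu> = sets borel" by (rule noise_lawD[OF \<nu>])
  have "third_moments (distr \<nu> borel (\<lambda>x. M *v x)) $i$j$k =
      (\<integral>x. (M *v x)$i * (M *v x)$j * (M *v x)$k \<partial>\<nu>)"
    by (simp add: third_moments_def integral_distr)
  also have "\<dots> = (\<integral>x. (\<Sum>a\<in>UNIV. \<Sum>b\<in>UNIV. \<Sum>c\<in>UNIV.
      M$i$a * M$j$b * M$k$c * (x$a * x$b * x$c)) \<partial>\<nu>)"
    unfolding matrix_vector_mult_def vec_lambda_beta sum_triple_product by (simp add: mult_ac)
  also have "\<dots> = (\<Sum>a\<in>UNIV. \<Sum>b\<in>UNIV. \<Sum>c\<in>UNIV. M$i$a * M$j$b * M$k$c * third_moments \<nu> $a$b$c)"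
    using noise_integrable3[OF \<nu>] by (simp add: third_moments_def)
  also have "\<dots> = (\<Sum>a\<in>UNIV. \<Sum>b\<in>UNIV. \<Sum>c\<in>UNIV. if c = b then
      (if b = a then M$i$a * M$j$a * M$k$a * third_moments \<nu> $a$a$a else 0) else 0)"
    using third_moments_diag[OF \<nu>] by (intro sum.cong refl) auto
  finally show ?thesis by simp
qed

lemma gaussian_third_moment:
  assumes "gaussian \<mu>" and "(\<integral>x. x \<partial>\<mu>) = 0"
  shows "(\<integral>x. x ^ 3 \<partial>\<mu>) = 0"
  using assms(1) unfolding gaussian_def
proof (elim disjE exE conjE)
  fix m assume "\<mu> = return borel m"
  with assms(2) show ?thesis by (simp add: integral_return)
next
  fix m \<sigma> :: real assume \<sigma>: "0 < \<sigma>" and \<mu>: "\<mu> = density lborel (\<lambda>x. ennreal (normal_density m \<sigma> x))"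
  have "m = 0"
    using assms(2) integral_normal_moment_nz_1[OF \<sigma>, of m] by (simp add: \<mu> integral_density)
  then show ?thesis
    using integral_normal_moment_odd[OF \<sigma>, of 0 1] by (simp add: \<mu> integral_density)
qed

text \<open>Non-Gaussian components have to survive the rescaling of the noise. The affine rule for
  normal densities speaks of \<open>distributed\<close> variables, hence the detour through the
  identity as a random variable.\<close>

lemma gaussian_scale:
  assumes "gaussian \<mu>" and c: "c \<noteq> 0"
  shows "gaussian (distr \<mu> borel (\<lambda>x. c * x))"
  using assms(1) unfolding gaussian_def[of \<mu>]
proof (elim disjE exE conjE)
  fix m assume "\<mu> = return borel m"
  then have "distr \<mu> borel (\<lambda>x. c * x) = return borel (c * m)" by (simp add: distr_return)
  then show ?thesis by (auto simp: gaussian_def)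
next
  fix m \<sigma> :: real assume \<sigma>: "0 < \<sigma>" and \<mu>: "\<mu> = density lborel (\<lambda>x. ennreal (normal_density m \<sigma> x))"
  interpret prob_space \<mu> unfolding \<mu> using \<sigma> by (rule prob_space_normal_density)
  have "distr \<mu> lborel (\<lambda>x. x) = \<mu>"
    unfolding \<mu> by (rule distr_id2) simp
  then have "distributed \<mu> lborel (\<lambda>x. x) (normal_density m \<sigma>)"
    by (simp add: distributed_def \<mu>)
  from normal_density_affine[OF this \<sigma> c, of 0]
  have "distr \<mu> lborel (\<lambda>x. c * x) = density lborel (normal_density (c * m) (\<bar>c\<bar> * \<sigma>))"
    by (simp add: distributed_def)
  moreover have "distr \<mu> lborel (\<lambda>x. c * x) = distr \<mu> borel (\<lambda>x. c * x)"
    by (rule distr_cong) auto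
  ultimately show ?thesis
    using \<sigma> c unfolding gaussian_def by (intro disjI2 exI[of _ "c * m"] exI[of _ "\<bar>c\<bar> * \<sigma>"]) auto
qed

text \<open>Makes generic noise admissible for \<open>model_laws\<close>, which asks for
  non-Gaussian components.\<close>

lemma third_moment_nonzero_imp_not_gaussian:
  assumes \<nu>: "noise_law \<nu>" and "third_moments \<nu> $i$i$i \<noteq> 0"
  shows "\<not> gaussian (distr \<nu> borel (\<lambda>x. x$i))"
proof
  have [measurable_cong]: "sets \<nu> = sets borel" by (rule noise_lawD[OF \<nu>])
  assume "gaussian (distr \<nu> borel (\<lambda>x. x$i))"
  then have "(\<integral>x. x ^ 3 \<partial>distr \<nu> borel (\<lambda>x. x$i)) = 0"
    using noise_lawD(5)[OF \<nu>] by (intro gaussian_third_moment) (simp_all add: integral_distr)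
  then show False using assms(2) by (simp add: integral_distr third_moments_def power3_eq_cube)
qed

section \<open>Permuting the noise\<close>

lemma
  fixes A :: "real^'n::finite^'n"
  assumes "invertible A"
  shows matrix_inv_right: "A ** matrix_inv A = mat 1"
    and matrix_inv_left: "matrix_inv A ** A = mat 1"
  using assms unfolding invertible_def matrix_inv_def by (metis (mono_tags, lifting) someI_ex)+

lemma matrix_mult_nth: "(A ** B)$i$j = (\<Sum>k\<in>UNIV. A$i$k * B$k$j)"
  by (simp add: matrix_matrix_mult_def)

lemma mat_1_nth: "(mat 1 :: real^'n^'n)$i$j = of_bool (i = j)"
  by (simp add: mat_def)

lemma sum_of_bool_eq: "(\<Sum>k\<in>UNIV. of_bool (k = a) * f k) = (f a :: real)" for a :: "'a::finite"
proof -
  have "(\<Sum>k\<in>UNIV. of_bool (k = a) * f k) = (\<Sum>k\<in>UNIV. if k = a then f a else 0)"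
    by (rule sum.cong) auto
  then show ?thesis by simp
qed

lemma cycle_edges_conv:
  "(i, j) \<in> cycle_edges vs \<longleftrightarrow> (\<exists>k<length vs. i = vs ! k \<and> j = vs ! (Suc k mod length vs))"
  unfolding cycle_edges_def in_set_zip by (auto simp: nth_rotate1)

lemma cycle_edges_irrefl:
  assumes "distinct vs" "2 \<le> length vs" "(i, j) \<in> cycle_edges vs"
  shows "i \<noteq> j"
proof
  assume "i = j"
  then obtain k where k: "k < length vs" "vs ! k = vs ! (Suc k mod length vs)"
    using assms(3) by (auto simp: cycle_edges_conv)
  moreover have "Suc k mod length vs < length vs" using k(1) by (intro mod_less_divisor) auto
  ultimately have "k = Suc k mod length vs" using assms(1) by (simp add: nth_eq_iff_index_eq)
  then show False using k(1) assms(2) by (cases "Suc k = length vs") auto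
qed

text \<open>With these coefficients the noise vector consists of the old noise terms permuted by \<open>\<pi>\<close> and
  rescaled; the division restores the unit diagonal of \<open>I - \<Lambda>\<close>.\<close>

definition reparam :: "real^'n^'n \<Rightarrow> ('n \<Rightarrow> 'n) \<Rightarrow> real^'n^'n::finite" where
  "reparam \<Lambda> \<pi> = (\<chi> i j. of_bool (i = j) - (mat 1 - \<Lambda>)$i$\<pi> j / (mat 1 - \<Lambda>)$j$\<pi> j)"

lemma one_minus_reparam:
  "(mat 1 - reparam \<Lambda> \<pi>)$i$j = (mat 1 - \<Lambda>)$i$\<pi> j / (mat 1 - \<Lambda>)$j$\<pi> j"
  by (simp add: reparam_def mat_1_nth)

text \<open>Permuting and rescaling the columns of I - \<Lambda> is right multiplication by the
  monomial matrix \<open>P\<close>, with inverse \<open>Q\<close>.\<close>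

lemma invertible_reparam:
  fixes \<Lambda> :: "real^'n::finite^'n"
  assumes inv: "invertible (mat 1 - \<Lambda>)" and \<pi>: "bij \<pi>"
    and nz: "\<And>j. (mat 1 - \<Lambda>)$j$\<pi> j \<noteq> 0"
  shows "invertible (mat 1 - reparam \<Lambda> \<pi>)"
proof -
  define N where "N = mat 1 - \<Lambda>"
  define P :: "real^'n^'n" where "P = (\<chi> k j. of_bool (k = \<pi> j) * inverse (N$j$\<pi> j))"
  define Q :: "real^'n^'n" where "Q = (\<chi> j k. of_bool (k = \<pi> j) * N$j$\<pi> j)"
  have eq: "\<pi> i = \<pi> j \<longleftrightarrow> i = j" for i j using \<pi> by (simp add: bij_def inj_eq)
  have "(Q ** P)$i$j = (mat 1 :: real^'n^'n)$i$j" for i j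
    using nz[of j] by (simp add: matrix_mult_nth mat_1_nth P_def Q_def N_def mult.assoc sum_of_bool_eq eq)
  then have "Q ** P = mat 1" by (simp add: vec_eq_iff)
  then have "invertible P" by (auto simp: invertible_left_inverse)
  moreover have "(mat 1 - reparam \<Lambda> \<pi>)$i$j = (N ** P)$i$j" for i j
    unfolding one_minus_reparam N_def[symmetric]
    by (simp add: matrix_mult_nth P_def mult.left_commute[of _ "of_bool _"] sum_of_bool_eq divide_inverse)
  then have "mat 1 - reparam \<Lambda> \<pi> = N ** P" by (simp add: vec_eq_iff)
  ultimately show ?thesis using inv by (simp add: N_def invertible_mult)
qed

lemma noise_law_permute_scale:
  fixes \<nu> :: "(real^'n::finite) measure" and \<pi> :: "'n \<Rightarrow> 'n"
  assumes \<nu>: "noise_law \<nu>" and \<pi>: "inj \<pi>"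
  shows "noise_law (distr \<nu> borel (\<lambda>x. \<chi> j. c j * x$\<pi> j))"
proof -
  note D = noise_lawD[OF \<nu>]
  interpret prob_space \<nu> by (rule D)
  have [measurable_cong]: "sets \<nu> = sets borel" by (rule D)
  have g [measurable]: "(\<lambda>x. (\<chi> j. c j * x$\<pi> j) :: real^'n) \<in> borel_measurable \<nu>"
    by (rule measurable_vec_lambda) measurable
  have "indep_vars (\<lambda>_. borel) (\<lambda>j x. c j * x$\<pi> j) UNIV"
    by (rule indep_vars_compose2[OF indep_vars_inj[OF D(6) \<pi>], of "\<lambda>j x. c j * x"]) measurable
  then have "prob_space.indep_vars (distr \<nu> borel (\<lambda>x. \<chi> j. c j * x$\<pi> j)) (\<lambda>_. borel) (\<lambda>i x. x$i) UNIV"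
    by (intro indep_vars_distr) simp_all
  then show ?thesis
    unfolding noise_law_def
    using D(4,5) by (simp add: prob_space_distr integrable_distr_eq integral_distr abs_mult power_mult_distrib)
qed

text \<open>The observed vector X solves \<open>transpose N *v X = x\<close>. Permuting these
  equations by \<pi> and dividing equation \<open>j\<close> by \<open>N$j$\<pi> j\<close> gives the
  equations of the new model for the same X, with noise \<open>g x\<close>.\<close>

lemma lsem_law_reparam:
  fixes \<Lambda> :: "real^'n::finite^'n"
  assumes \<nu>: "noise_law \<nu>" and inv: "invertible (mat 1 - \<Lambda>)" and \<pi>: "bij \<pi>"
    and nz: "\<And>j. (mat 1 - \<Lambda>)$j$\<pi> j \<noteq> 0"
  obtains \<nu>' where "noise_law \<nu>'" "lsem_law (reparam \<Lambda> \<pi>) \<nu>' = lsem_law \<Lambda> \<nu>"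
    "\<And>i. third_moments \<nu> $\<pi> i$\<pi> i$\<pi> i \<noteq> 0 \<Longrightarrow> third_moments \<nu>' $i$i$i \<noteq> 0"
    "\<And>i. gaussian (distr \<nu>' borel (\<lambda>x. x$i)) \<Longrightarrow> gaussian (distr \<nu> borel (\<lambda>x. x$\<pi> i))"
proof -
  define N where "N = mat 1 - \<Lambda>"
  define N' where "N' = mat 1 - reparam \<Lambda> \<pi>"
  define c where "c j = 1 / N$j$\<pi> j" for j
  have c: "c j \<noteq> 0" for j using nz by (simp add: c_def N_def)
  define g where "g x = (\<chi> j. c j * x$\<pi> j)" for x :: "real^'n"
  define \<nu>' where "\<nu>' = distr \<nu> borel g"
  have sets [measurable_cong]: "sets \<nu> = sets borel" by (rule noise_lawD[OF \<nu>])
  have [measurable]: "g \<in> borel_measurable \<nu>"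
    unfolding g_def by (rule measurable_vec_lambda) measurable
  have inv': "invertible N'" unfolding N'_def by (rule invertible_reparam) fact+
  have N'_nth: "N'$i$j = c j * N$i$\<pi> j" for i j
    unfolding N'_def one_minus_reparam N_def[symmetric] c_def by simp
  have solve: "transpose (matrix_inv N') *v g x = transpose (matrix_inv N) *v x" for x
  proof -
    define X where "X = transpose (matrix_inv N) *v x"
    have "transpose N *v X = transpose (matrix_inv N ** N) *v x"
      by (simp only: X_def matrix_vector_mul_assoc matrix_transpose_mul)
    then have "transpose N *v X = x" using inv by (simp add: N_def matrix_inv_left)
    moreover have "(transpose N' *v X)$j = c j * (transpose N *v X)$\<pi> j" for j
      unfolding matrix_vector_mult_def transpose_def by (simp add: N'_nth sum_distrib_left mult.assoc)
    ultimately have "(transpose N' *v X)$j = g x$j" for j by (simp only: g_def vec_lambda_beta)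
    then have "transpose N' *v X = g x" by (subst vec_eq_iff) blast
    then have "transpose (matrix_inv N') *v g x = transpose (N' ** matrix_inv N') *v X"
      by (metis matrix_transpose_mul matrix_vector_mul_assoc)
    then show ?thesis using inv' by (simp add: matrix_inv_right X_def)
  qed
  have coord: "distr \<nu>' borel (\<lambda>x. x$i) = distr (distr \<nu> borel (\<lambda>x. x$\<pi> i)) borel (\<lambda>x. c i * x)" for i
    unfolding \<nu>'_def by (subst (1 2) distr_distr) (auto simp: comp_def g_def)
  show ?thesis
  proof
    show noise': "noise_law \<nu>'"
      unfolding \<nu>'_def g_def using \<nu> \<pi> by (intro noise_law_permute_scale) (auto simp: bij_def)
    show "lsem_law (reparam \<Lambda> \<pi>) \<nu>' = lsem_law \<Lambda> \<nu>"
      unfolding lsem_law_def \<nu>'_def N_def[symmetric] N'_def[symmetric]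
      by (subst distr_distr) (auto simp: comp_def solve simp del: transpose_matrix_vector)
    have "third_moments \<nu>' $i$i$i = c i ^ 3 * third_moments \<nu> $\<pi> i$\<pi> i$\<pi> i" for i
    proof -
      have "third_moments \<nu>' $i$i$i = (\<integral>x. (c i * x$\<pi> i) * (c i * x$\<pi> i) * (c i * x$\<pi> i) \<partial>\<nu>)"
        by (simp add: third_moments_def \<nu>'_def integral_distr g_def)
      also have "\<dots> = (\<integral>x. c i ^ 3 * (x$\<pi> i * x$\<pi> i * x$\<pi> i) \<partial>\<nu>)"
        by (rule Bochner_Integration.integral_cong) (simp_all add: power3_eq_cube)
      finally show ?thesis by (simp add: third_moments_def)
    qed
    then show "third_moments \<nu> $\<pi> i$\<pi> i$\<pi> i \<noteq> 0 \<Longrightarrow> third_moments \<nu>' $i$i$i \<noteq> 0" for i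
      using c by simp
    show "gaussian (distr \<nu> borel (\<lambda>x. x$\<pi> i))" if "gaussian (distr \<nu>' borel (\<lambda>x. x$i))" for i
    proof -
      have "gaussian (distr (distr \<nu>' borel (\<lambda>x. x$i)) borel (\<lambda>x. inverse (c i) * x))"
        using c by (intro gaussian_scale that) auto
      also have "distr (distr \<nu>' borel (\<lambda>x. x$i)) borel (\<lambda>x. inverse (c i) * x) =
          distr \<nu> borel (\<lambda>x. x$\<pi> i)"
        unfolding coord using c by (subst (1 2) distr_distr) (auto simp: comp_def field_simps)
      finally show ?thesis .
    qed
  qed
qed

section \<open>Distribution equivalence\<close>

text \<open>In I - \<Lambda> the diagonal is nonzero as well, so a graph is recorded by its
  reflexive closure, on which permutations of columns act without exceptions.\<close>

lemma edge_coeffs_star_iff: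
  fixes E :: "'n::finite digraph"
  assumes "irrefl E"
  shows "\<Lambda> \<in> edge_coeffs_star E \<longleftrightarrow> invertible (mat 1 - \<Lambda>) \<and> (\<forall>j. (mat 1 - \<Lambda>)$j$j = 1) \<and>
    (\<forall>i j. (mat 1 - \<Lambda>)$i$j \<noteq> 0 \<longleftrightarrow> (i, j) \<in> E\<^sup>=)"
  using assms unfolding edge_coeffs_star_def edge_coeffs_def irrefl_def
  by (auto simp: mat_1_nth)

lemma reparam_edge_coeffs_star:
  fixes E H :: "'n::finite digraph"
  assumes "irrefl E" "irrefl H" "bij \<pi>"
    and E: "\<And>i j. (i, j) \<in> H\<^sup>= \<longleftrightarrow> (i, \<pi> j) \<in> E\<^sup>=" and \<Lambda>: "\<Lambda> \<in> edge_coeffs_star E"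
  shows "reparam \<Lambda> \<pi> \<in> edge_coeffs_star H"
proof -
  have N: "invertible (mat 1 - \<Lambda>)" "\<And>i j. (mat 1 - \<Lambda>)$i$j \<noteq> 0 \<longleftrightarrow> (i, j) \<in> E\<^sup>="
    using \<Lambda> edge_coeffs_star_iff[OF assms(1)] by auto
  have nz: "(mat 1 - \<Lambda>)$j$\<pi> j \<noteq> 0" for j using N(2) E[of j j] by auto
  show ?thesis
    unfolding edge_coeffs_star_iff[OF assms(2)] one_minus_reparam
  proof (intro conjI allI)
    show "invertible (mat 1 - reparam \<Lambda> \<pi>)" by (rule invertible_reparam[OF N(1) assms(3) nz])
    show "(mat 1 - \<Lambda>)$j$\<pi> j / (mat 1 - \<Lambda>)$j$\<pi> j = 1" for j by (rule divide_self[OF nz])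
    show "(mat 1 - \<Lambda>)$i$\<pi> j / (mat 1 - \<Lambda>)$j$\<pi> j \<noteq> 0 \<longleftrightarrow> (i, j) \<in> H\<^sup>=" for i j
      using nz N(2) E by (metis divide_eq_0_iff)
  qed
qed

lemma model_laws_subset:
  fixes E H :: "'n::finite digraph"
  assumes "irrefl E" "irrefl H" "bij \<pi>"
    and E: "\<And>i j. (i, j) \<in> H\<^sup>= \<longleftrightarrow> (i, \<pi> j) \<in> E\<^sup>="
  shows "model_laws E \<subseteq> model_laws H"
proof
  fix \<mu> assume "\<mu> \<in> model_laws E"
  then obtain \<Lambda> \<nu> where \<mu>: "\<mu> = lsem_law \<Lambda> \<nu>" and \<Lambda>: "\<Lambda> \<in> edge_coeffs_star E" and \<nu>: "noise_law \<nu>"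
    and ng: "\<And>i. \<not> gaussian (distr \<nu> borel (\<lambda>x. x$i))"
    by (auto simp: model_laws_def)
  have N: "invertible (mat 1 - \<Lambda>)" "\<And>i j. (mat 1 - \<Lambda>)$i$j \<noteq> 0 \<longleftrightarrow> (i, j) \<in> E\<^sup>="
    using \<Lambda> edge_coeffs_star_iff[OF assms(1)] by auto
  have nz: "(mat 1 - \<Lambda>)$j$\<pi> j \<noteq> 0" for j using N(2) E[of j j] by auto
  obtain \<nu>' where \<nu>': "noise_law \<nu>'" "lsem_law (reparam \<Lambda> \<pi>) \<nu>' = lsem_law \<Lambda> \<nu>"
    "\<And>i. gaussian (distr \<nu>' borel (\<lambda>x. x$i)) \<Longrightarrow> gaussian (distr \<nu> borel (\<lambda>x. x$\<pi> i))"
    using lsem_law_reparam[OF \<nu> N(1) assms(3) nz] by metis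
  show "\<mu> \<in> model_laws H"
    unfolding model_laws_def \<mu> \<nu>'(2)[symmetric]
    using reparam_edge_coeffs_star[OF assms \<Lambda>] \<nu>' ng by blast
qed

lemma irrefl_permute_graph: "irrefl (permute_graph \<pi> E)"
  by (auto simp: irrefl_def permute_graph_def)

lemma permute_graph_reflcl:
  assumes "\<And>j. (j, \<pi> j) \<in> E\<^sup>="
  shows "(i, j) \<in> (permute_graph \<pi> E)\<^sup>= \<longleftrightarrow> (i, \<pi> j) \<in> E\<^sup>="
  using assms[of j] by (auto simp: permute_graph_def)

lemma dist_equivalent_permute_graph:
  fixes E :: "'n::finite digraph"
  assumes E: "irrefl E" and \<pi>: "bij \<pi>" and edge: "\<And>j. (j, \<pi> j) \<in> E\<^sup>="
  shows "dist_equivalent E (permute_graph \<pi> E)"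
proof -
  have "model_laws (permute_graph \<pi> E) \<subseteq> model_laws E"
  proof (rule model_laws_subset[OF irrefl_permute_graph E])
    \<comment> \<open>The reverse inclusion uses the inverse permutation, which leads from
      \<open>permute_graph \<pi> E\<close> back to \<open>E\<close>.\<close>
    show "bij (inv \<pi>)" using \<pi> by (rule bij_imp_bij_inv)
    show "(i, j) \<in> E\<^sup>= \<longleftrightarrow> (i, inv \<pi> j) \<in> (permute_graph \<pi> E)\<^sup>=" for i j
      using permute_graph_reflcl[OF edge, of i "inv \<pi> j"] \<pi> by (simp add: bij_is_surj surj_f_inv_f)
  qed
  moreover have "model_laws E \<subseteq> model_laws (permute_graph \<pi> E)"
    using model_laws_subset[OF E irrefl_permute_graph \<pi> permute_graph_reflcl[OF edge]] .
  ultimately show ?thesis by (simp add: dist_equivalent_def)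
qed

text \<open>The orbit of a moved point lists the cycle of \<pi> through it. For coefficients in
  \<open>edge_coeffs_star E\<close>, the right-hand condition says that the entries by which
  \<open>reparam\<close> divides are nonzero.\<close>

lemma factors_through_cycles_iff:
  fixes E :: "'n::finite digraph"
  shows "factors_through_cycles \<pi> E \<longleftrightarrow> bij \<pi> \<and> (\<forall>j. (j, \<pi> j) \<in> E\<^sup>=)"
proof (intro iffI conjI allI)
  assume *: "factors_through_cycles \<pi> E"
  then have perm: "\<pi> permutes UNIV" by (simp add: factors_through_cycles_def)
  then show "bij \<pi>" by (simp add: permutes_bij)
  fix j
  show "(j, \<pi> j) \<in> E\<^sup>="
  proof (cases "\<pi> j = j")
    case False
    have p: "permutation \<pi>" using perm by (auto simp: permutation_permutes)
    define s where "s = least_power \<pi> j"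
    define vs where "vs = support \<pi> j"
    have s: "1 < s" using least_power_gt_one[OF p False] by (simp add: s_def)
    have len: "length vs = s" by (simp add: vs_def s_def)
    have nth: "vs ! k = (\<pi> ^^ k) j" if "k < s" for k using that by (simp add: vs_def s_def)
    \<comment> \<open>The orbit has length \<open>s\<close>, so the last entry is followed by the
      first.\<close>
    have next_nth: "vs ! (Suc k mod s) = (\<pi> ^^ Suc k) j" if "k < s" for k
    proof (cases "Suc k = s")
      case True
      have "(\<pi> ^^ s) j = j" using least_power_of_permutation(1)[OF p] by (simp add: s_def)
      then show ?thesis using True s nth[of 0] by (metis funpow_0 less_trans mod_self zero_less_one)
    next
      case False
      then show ?thesis using that nth[of "Suc k"] by simp
    qed
    have "distinct vs" unfolding vs_def using cycle_of_permutation[OF p] by simp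
    moreover have "\<forall>(a, b) \<in> cycle_edges vs. \<pi> a = b"
      using nth next_nth by (auto simp: cycle_edges_conv len)
    ultimately have "perm_cycle \<pi> vs" using s by (simp add: perm_cycle_def len)
    then have "cycle_edges vs \<subseteq> E" using * by (auto simp: factors_through_cycles_def dicycle_def)
    moreover have "(j, \<pi> j) \<in> cycle_edges vs"
      unfolding cycle_edges_conv len using s nth[of 0] next_nth[of 0] by (intro exI[of _ 0]) auto
    ultimately show ?thesis by blast
  qed simp
next
  assume *: "bij \<pi> \<and> (\<forall>j. (j, \<pi> j) \<in> E\<^sup>=)"
  show "factors_through_cycles \<pi> E"
    unfolding factors_through_cycles_def
  proof (intro conjI allI impI)
    show "\<pi> permutes UNIV" using * by (intro bij_imp_permutes) auto
    fix vs assume vs: "perm_cycle \<pi> vs"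
    then have "cycle_edges vs \<subseteq> E"
      using * cycle_edges_irrefl[of vs] unfolding perm_cycle_def by (fastforce)
    then show "dicycle E vs" using vs by (simp add: perm_cycle_def dicycle_def)
  qed
qed

text \<open>The off-diagonal third moments of the noise \<open>M \<epsilon>\<close> vanish. Since \<open>M\<close> is invertible and the
  third moments of \<open>\<epsilon>\<close> are nonzero, this forces any two rows of \<open>M\<close> to have disjoint supports.\<close>

lemma lsem_law_eq_imp_permutation:
  fixes \<Lambda> \<Lambda>' :: "real^'n::finite^'n" and \<nu> \<nu>' :: "(real^'n) measure"
  assumes \<nu>: "noise_law \<nu>" and \<nu>': "noise_law \<nu>'"
    and w: "\<And>a. third_moments \<nu> $a$a$a \<noteq> 0"
    and inv: "invertible (mat 1 - \<Lambda>)" and inv': "invertible (mat 1 - \<Lambda>')"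
    and eq: "lsem_law \<Lambda> \<nu> = lsem_law \<Lambda>' \<nu>'"
  obtains \<sigma> where "bij \<sigma>" "\<And>i j. (mat 1 - \<Lambda>')$i$j \<noteq> 0 \<longleftrightarrow> (mat 1 - \<Lambda>)$i$\<sigma> j \<noteq> 0"
proof -
  define N where "N = mat 1 - \<Lambda>"
  define N' where "N' = mat 1 - \<Lambda>'"
  \<comment> \<open>\<open>M\<close> carries the noise of \<Lambda> to the noise of \<Lambda>', as
    both yield the same observed law; \<open>MI\<close> is its inverse.\<close>
  define M where "M = transpose N' ** transpose (matrix_inv N)"
  define MI where "MI = transpose N ** transpose (matrix_inv N')"
  have NB: "N ** matrix_inv N = mat 1" "matrix_inv N ** N = mat 1"
    "N' ** matrix_inv N' = mat 1" "matrix_inv N' ** N' = mat 1"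
    using inv inv' by (simp_all add: N_def N'_def matrix_inv_left matrix_inv_right)
  have "MI ** M = transpose (matrix_inv N ** (N' ** matrix_inv N') ** N)"
    by (simp add: MI_def M_def matrix_transpose_mul matrix_mul_assoc)
  then have MIM: "MI ** M = mat 1" by (simp add: NB)
  then have MMI: "M ** MI = mat 1" by (simp add: matrix_left_right_inverse)
  have N'_eq: "N' = N ** transpose M"
    by (simp add: M_def matrix_transpose_mul matrix_mul_assoc NB)
  have [measurable_cong]: "sets \<nu> = sets borel" "sets \<nu>' = sets borel"
    using noise_lawD[OF \<nu>] noise_lawD[OF \<nu>'] by auto
  have "distr (lsem_law \<Lambda>' \<nu>') borel (\<lambda>x. transpose N' *v x) =
      distr \<nu>' borel (\<lambda>x. transpose N' *v (transpose (matrix_inv N') *v x))"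
    unfolding lsem_law_def N'_def[symmetric] by (subst distr_distr) (auto simp: comp_def)
  also have "\<dots> = distr \<nu>' borel (\<lambda>x. x)"
    by (simp only: matrix_vector_mul_assoc matrix_transpose_mul[symmetric] NB transpose_mat matrix_vector_mul_lid)
  also have "\<dots> = \<nu>'"
    using noise_lawD(2)[OF \<nu>'] by (intro distr_id2) simp
  finally have "\<nu>' = distr (lsem_law \<Lambda> \<nu>) borel (\<lambda>x. transpose N' *v x)"
    using eq by simp
  also have "\<dots> = distr \<nu> borel (\<lambda>x. M *v x)"
    unfolding lsem_law_def N_def[symmetric]
    by (subst distr_distr) (auto simp: comp_def M_def matrix_vector_mul_assoc simp del: transpose_matrix_vector)
  finally have \<nu>'_eq: "\<nu>' = distr \<nu> borel (\<lambda>x. M *v x)" .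
  have disj: "M$i$a = 0 \<or> M$j$a = 0" if "i \<noteq> j" for i j a
  proof -
    \<comment> \<open>The entries of \<open>M *v z\<close> are third moments of \<nu>' whose first
      two indices are \<open>i\<close> and \<open>j\<close>; they vanish, and \<open>M\<close> is
      injective.\<close>
    define z where "z = (\<chi> a. M$i$a * M$j$a * third_moments \<nu> $a$a$a)"
    have "(M *v z)$k = third_moments \<nu>' $i$j$k" for k
      unfolding \<nu>'_eq third_moments_linear_image[OF \<nu>] z_def matrix_vector_mult_def
      by (auto intro!: sum.cong)
    then have "M *v z = 0"
      using third_moments_diag[OF \<nu>'] that by (auto simp: vec_eq_iff)
    then have "z = 0"
      by (metis MIM matrix_vector_mul_assoc matrix_vector_mul_lid matrix_vector_mult_0_right)
    then have "z$a = 0" by simp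
    then show ?thesis using w[of a] by (simp add: z_def)
  qed
  have col: "\<exists>i. M$i$a \<noteq> 0" for a
  proof (rule ccontr)
    assume "\<not> ?thesis"
    then have "(MI ** M)$a$a = 0" by (simp add: matrix_mult_nth)
    then show False by (simp add: MIM mat_1_nth)
  qed
  have row: "\<exists>a. M$i$a \<noteq> 0" for i
  proof (rule ccontr)
    assume "\<not> ?thesis"
    then have "(M ** MI)$i$i = 0" by (simp add: matrix_mult_nth)
    then show False by (simp add: MMI mat_1_nth)
  qed
  \<comment> \<open>No column of \<open>M\<close> vanishes and distinct rows have disjoint supports,
    so each column has exactly one nonzero entry; \<rho> names its row.\<close>
  define \<rho> where "\<rho> a = (SOME i. M$i$a \<noteq> 0)" for a
  have \<rho>: "M$i$a \<noteq> 0 \<longleftrightarrow> i = \<rho> a" for i a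
    unfolding \<rho>_def using col[of a] disj by (metis (mono_tags, lifting) someI_ex)
  have "surj \<rho>" using row \<rho> by (metis surjI)
  then have bij: "bij \<rho>" using finite_UNIV_surj_inj[of \<rho>] by (simp add: bij_def)
  have \<rho>': "M$i$a \<noteq> 0 \<longleftrightarrow> a = inv \<rho> i" for i a
    using \<rho> bij by (metis bij_inv_eq_iff)
  show ?thesis
  proof
    show "bij (inv \<rho>)" using bij by (rule bij_imp_bij_inv)
    fix i j
    have "N'$i$j = (\<Sum>a\<in>UNIV. N$i$a * M$j$a)"
      by (subst N'_eq) (simp add: matrix_mult_nth transpose_def)
    also have "\<dots> = (\<Sum>a\<in>UNIV. if a = inv \<rho> j then N$i$inv \<rho> j * M$j$inv \<rho> j else 0)"
      using \<rho>' by (intro sum.cong) auto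
    finally have "N'$i$j = N$i$inv \<rho> j * M$j$inv \<rho> j" by simp
    then show "(mat 1 - \<Lambda>')$i$j \<noteq> 0 \<longleftrightarrow> (mat 1 - \<Lambda>)$i$inv \<rho> j \<noteq> 0"
      using \<rho>' by (simp add: N_def N'_def)
  qed
qed

text \<open>A single law suffices: that of \<Lambda> and \<nu> must also arise from coefficients on
  \<open>H\<close>, and the permutation relating the two noise vectors relates the graphs.\<close>

lemma dist_equivalent_imp_permute_graph:
  fixes E H :: "'n::finite digraph" and \<nu> :: "(real^'n) measure"
  assumes "irrefl E" "irrefl H" and equiv: "dist_equivalent E H"
    and \<Lambda>: "\<Lambda> \<in> edge_coeffs_star E" and \<nu>: "noise_law \<nu>"
    and w: "\<And>a. third_moments \<nu> $a$a$a \<noteq> 0"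
  obtains \<pi> where "H = permute_graph \<pi> E" "factors_through_cycles \<pi> E"
proof -
  have "lsem_law \<Lambda> \<nu> \<in> model_laws E"
    unfolding model_laws_def using \<Lambda> \<nu> third_moment_nonzero_imp_not_gaussian[OF \<nu> w] by blast
  then have "lsem_law \<Lambda> \<nu> \<in> model_laws H" using equiv by (simp add: dist_equivalent_def)
  then obtain \<Lambda>' \<nu>' where \<Lambda>': "\<Lambda>' \<in> edge_coeffs_star H" "noise_law \<nu>'" "lsem_law \<Lambda> \<nu> = lsem_law \<Lambda>' \<nu>'"
    by (auto simp: model_laws_def)
  have N: "invertible (mat 1 - \<Lambda>)" "\<And>i j. (mat 1 - \<Lambda>)$i$j \<noteq> 0 \<longleftrightarrow> (i, j) \<in> E\<^sup>="
    using \<Lambda> edge_coeffs_star_iff[OF assms(1)] by auto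
  have N': "invertible (mat 1 - \<Lambda>')" "\<And>i j. (mat 1 - \<Lambda>')$i$j \<noteq> 0 \<longleftrightarrow> (i, j) \<in> H\<^sup>="
    using \<Lambda>'(1) edge_coeffs_star_iff[OF assms(2)] by auto
  obtain \<sigma> where \<sigma>: "bij \<sigma>" "\<And>i j. (mat 1 - \<Lambda>')$i$j \<noteq> 0 \<longleftrightarrow> (mat 1 - \<Lambda>)$i$\<sigma> j \<noteq> 0"
    using lsem_law_eq_imp_permutation[OF \<nu> \<Lambda>'(2) w N(1) N'(1) \<Lambda>'(3)] by blast
  have H: "(i, j) \<in> H\<^sup>= \<longleftrightarrow> (i, \<sigma> j) \<in> E\<^sup>=" for i j using \<sigma>(2) N(2) N'(2) by blast
  show ?thesis
  proof
    show "factors_through_cycles \<sigma> E" unfolding factors_through_cycles_iff using \<sigma>(1) H by blast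
    have "(i, j) \<in> H \<longleftrightarrow> i \<noteq> j \<and> (i, j) \<in> H\<^sup>=" for i j
      using assms(2) by (auto simp: irrefl_def)
    then show "H = permute_graph \<sigma> E" unfolding permute_graph_def using H by auto
  qed
qed

section \<open>Cycles\<close>

lemma cycle_edges_set:
  assumes "(i, j) \<in> cycle_edges vs"
  shows "i \<in> set vs" "j \<in> set vs"
  using assms unfolding cycle_edges_def by (auto dest: set_zip_leftD set_zip_rightD)

lemma cycle_edges_rotate1: "cycle_edges (rotate1 vs) = cycle_edges vs"
proof -
  have "zip (rotate1 xs) (rotate1 ys) = rotate1 (zip xs ys)" if "length xs = length ys" for xs ys :: "'a list"
    using that by (cases xs; cases ys) auto
  from this[of vs "rotate1 vs"] show ?thesis by (simp add: cycle_edges_def)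
qed

lemma cycle_edges_rotate: "cycle_edges (rotate k vs) = cycle_edges vs"
  by (induction k) (simp_all add: cycle_edges_rotate1)

lemma rotate_to_head:
  assumes "u \<in> set vs"
  obtains k where "rotate k vs ! 0 = u"
proof -
  obtain k where k: "k < length vs" "vs ! k = u" using assms by (auto simp: in_set_conv_nth)
  then have "rotate k vs ! 0 = u" by (subst nth_rotate) auto
  then show ?thesis by (rule that)
qed

lemma cycle_edges_Suc:
  assumes "Suc k < length vs"
  shows "(vs ! k, vs ! Suc k) \<in> cycle_edges vs"
  unfolding cycle_edges_conv using assms by (intro exI[of _ k]) auto

lemma cycle_edges_last:
  assumes "vs \<noteq> []"
  shows "(last vs, hd vs) \<in> cycle_edges vs"
  unfolding cycle_edges_conv using assms
  by (intro exI[of _ "length vs - 1"]) (auto simp: last_conv_nth hd_conv_nth)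

lemma cycle_edges_right_unique:
  assumes "distinct vs" "(i, j) \<in> cycle_edges vs" "(i, k) \<in> cycle_edges vs"
  shows "j = k"
  using assms by (auto simp: cycle_edges_conv nth_eq_iff_index_eq)

lemma cycle_edges_left_unique:
  assumes "distinct vs" "(i, k) \<in> cycle_edges vs" "(j, k) \<in> cycle_edges vs"
  shows "i = j"
proof -
  obtain m n where mn: "m < length vs" "n < length vs" "i = vs ! m" "j = vs ! n"
    and eq: "vs ! (Suc m mod length vs) = vs ! (Suc n mod length vs)"
    using assms(2,3) by (auto simp: cycle_edges_conv)
  have "Suc m mod length vs < length vs" "Suc n mod length vs < length vs"
    using mn by (auto intro!: mod_less_divisor)
  with eq have "Suc m mod length vs = Suc n mod length vs"
    using assms(1) by (simp add: nth_eq_iff_index_eq)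
  then have "m = n" using mn by (auto simp: mod_Suc split: if_splits)
  then show ?thesis using mn by simp
qed

lemma cycle_edges_out:
  assumes "i \<in> set vs"
  obtains j where "(i, j) \<in> cycle_edges vs"
  using assms by (auto simp: cycle_edges_conv in_set_conv_nth)

lemma cycle_edges_in:
  assumes "j \<in> set vs"
  obtains i where "(i, j) \<in> cycle_edges vs"
proof -
  obtain k where k: "rotate k vs ! 0 = j" using assms by (rule rotate_to_head)
  have "rotate k vs \<noteq> []" using assms by auto
  then have "(last (rotate k vs), j) \<in> cycle_edges (rotate k vs)"
    using cycle_edges_last[of "rotate k vs"] k by (simp add: hd_conv_nth)
  then show ?thesis using that by (simp add: cycle_edges_rotate)
qed

lemma cycle_edges_connected:
  assumes "i \<in> set vs" "j \<in> set vs"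
  shows "(i, j) \<in> (cycle_edges vs)\<^sup>*"
proof -
  obtain k where k: "rotate k vs ! 0 = i" using assms(1) by (rule rotate_to_head)
  define us where "us = rotate k vs"
  have "(us ! 0, us ! m) \<in> (cycle_edges us)\<^sup>*" if "m < length us" for m
    using that
  proof (induction m)
    case (Suc m)
    then show ?case using cycle_edges_Suc[of m us] by (auto intro: rtrancl_into_rtrancl)
  qed simp
  moreover obtain m where "m < length us" "us ! m = j"
    using assms(2) by (metis in_set_conv_nth set_rotate us_def)
  ultimately show ?thesis using k by (auto simp: us_def cycle_edges_rotate)
qed

lemma cycle_edges_no_2_cycle:
  assumes "distinct vs" "3 \<le> length vs" "(i, j) \<in> cycle_edges vs"
  shows "(j, i) \<notin> cycle_edges vs"
proof
  assume "(j, i) \<in> cycle_edges vs"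
  obtain m where m: "rotate m vs ! 0 = i" using assms(3) cycle_edges_set rotate_to_head by metis
  define us where "us = rotate m vs"
  have us: "distinct us" "3 \<le> length us" "(i, j) \<in> cycle_edges us" "(j, i) \<in> cycle_edges us" "us ! 0 = i"
    using assms m \<open>(j, i) \<in> cycle_edges vs\<close> by (auto simp: us_def cycle_edges_rotate)
  have "j = us ! 1"
    using cycle_edges_right_unique[OF us(1,3)] cycle_edges_Suc[of 0 us] us by auto
  then have "i = us ! 2"
    using cycle_edges_right_unique[OF us(1,4)] cycle_edges_Suc[of 1 us] us by (simp add: numeral_2_eq_2)
  then have "us ! 0 = us ! 2" using us(5) by simp
  moreover have "0 < length us" "2 < length us" using us(2) by auto
  ultimately show False using us(1) by (simp add: nth_eq_iff_index_eq)
qed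

text \<open>If the cycles share a directed edge, the agreement spreads along \<open>us\<close>: were
  the next edge reversed in \<open>vs\<close>, uniqueness of predecessors there would make it lead
  straight back, a 2-cycle in \<open>us\<close>. If they share none, every edge is reversed.\<close>

lemma cycle_edges_same_adjacency:
  assumes vs: "distinct vs" and us: "distinct us" "3 \<le> length us" and set: "set us = set vs"
    and adj: "cycle_edges us \<subseteq> cycle_edges vs \<union> (cycle_edges vs)\<inverse>"
  shows "cycle_edges us = cycle_edges vs \<or> cycle_edges us = (cycle_edges vs)\<inverse>"
proof (cases "\<exists>u v. (u, v) \<in> cycle_edges us \<inter> cycle_edges vs")
  case True
  then obtain u v where uv: "(u, v) \<in> cycle_edges us" "(u, v) \<in> cycle_edges vs" by blast
  have ex: "\<exists>p. (p, a) \<in> cycle_edges us \<inter> cycle_edges vs" if "(v, a) \<in> (cycle_edges us)\<^sup>*" for a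
    using that
  proof induction
    case (step a b)
    then obtain p where p: "(p, a) \<in> cycle_edges us" "(p, a) \<in> cycle_edges vs" by blast
    have "(b, a) \<notin> cycle_edges vs"
      using cycle_edges_left_unique[OF vs p(2)] cycle_edges_no_2_cycle[OF us p(1)] step.hyps by blast
    then show ?case using step.hyps adj by blast
  qed (use uv in blast)
  have sub: "(a, b) \<in> cycle_edges vs" if ab: "(a, b) \<in> cycle_edges us" for a b
  proof -
    have "(v, b) \<in> (cycle_edges us)\<^sup>*"
      using ab uv by (meson cycle_edges_connected cycle_edges_set)
    then obtain p where "(p, b) \<in> cycle_edges us" "(p, b) \<in> cycle_edges vs" using ex by blast
    then show ?thesis using cycle_edges_left_unique[OF us(1) ab] by auto
  qed
  have "(a, b) \<in> cycle_edges us" if ab: "(a, b) \<in> cycle_edges vs" for a b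
  proof -
    obtain c where "(a, c) \<in> cycle_edges us"
      using ab set cycle_edges_set(1) cycle_edges_out by metis
    then show ?thesis using cycle_edges_right_unique[OF vs ab] sub by blast
  qed
  then show ?thesis using sub by auto
next
  case False
  then have sub: "(b, a) \<in> cycle_edges vs" if "(a, b) \<in> cycle_edges us" for a b
    using adj that by blast
  have "(b, a) \<in> cycle_edges us" if ab: "(a, b) \<in> cycle_edges vs" for a b
  proof -
    obtain c where "(b, c) \<in> cycle_edges us"
      using ab set cycle_edges_set(2) cycle_edges_out by metis
    then show ?thesis using cycle_edges_left_unique[OF vs ab] sub by blast
  qed
  then show ?thesis using sub by auto
qed

lemma rtrancl_distinct_path:
  assumes "(a, b) \<in> r\<^sup>*"
  shows "\<exists>xs. xs \<noteq> [] \<and> hd xs = a \<and> last xs = b \<and> distinct xs \<and> successively (\<lambda>x y. (x, y) \<in> r) xs"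
  using assms
proof (induction rule: converse_rtrancl_induct)
  case base
  then show ?case by (intro exI[of _ "[b]"]) simp
next
  case (step a c)
  then obtain xs where xs: "xs \<noteq> []" "hd xs = c" "last xs = b" "distinct xs"
    "successively (\<lambda>x y. (x, y) \<in> r) xs" by blast
  show ?case
  proof (cases "a \<in> set xs")
    case True
    \<comment> \<open>If \<open>a\<close> already lies on the path, the part before it is cut
      off.\<close>
    then obtain ys zs where "xs = ys @ a # zs" by (auto simp: in_set_conv_decomp)
    then show ?thesis using xs by (intro exI[of _ "a # zs"]) (auto simp: successively_append_iff)
  next
    case False
    then show ?thesis using xs step.hyps by (intro exI[of _ "a # xs"]) (auto simp: successively_Cons)
  qed
qed

lemma edge_on_dicycle:
  assumes ab: "(a, b) \<in> E" "a \<noteq> b" "a \<in> W" and path: "(b, a) \<in> (Restr E W)\<^sup>*"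
  obtains us where "dicycle E us" "set us \<subseteq> W" "(a, b) \<in> cycle_edges us"
proof -
  obtain us where us: "us \<noteq> []" "hd us = b" "last us = a" "distinct us"
    "successively (\<lambda>x y. (x, y) \<in> Restr E W) us"
    using rtrancl_distinct_path[OF path] by blast
  have step: "(us ! k, us ! Suc k) \<in> Restr E W" if "Suc k < length us" for k
    using us(5) that by (auto simp: successively_conv_nth)
  have len: "2 \<le> length us"
    using us ab(2) by (cases us) (auto simp: Suc_le_eq)
  have ends: "us ! (length us - 1) = a" "us ! 0 = b"
    using us by (simp_all add: last_conv_nth hd_conv_nth)
  show ?thesis
  proof
    have "(x, y) \<in> E" if "(x, y) \<in> cycle_edges us" for x y
    proof -
      obtain k where k: "k < length us" "x = us ! k" "y = us ! (Suc k mod length us)"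
        using \<open>(x, y) \<in> cycle_edges us\<close> by (auto simp: cycle_edges_conv)
      show ?thesis
      proof (cases "Suc k = length us")
        case True
        then have "k = length us - 1" by simp
        then show ?thesis using k True ends ab(1) by simp
      next
        case False
        then show ?thesis using k step[of k] by simp
      qed
    qed
    then show "dicycle E us" using us(4) len by (auto simp: dicycle_def)
    show "set us \<subseteq> W"
    proof
      fix x assume "x \<in> set us"
      then obtain k where k: "k < length us" "us ! k = x" by (auto simp: in_set_conv_nth)
      then have "k = length us - 1 \<or> Suc k < length us" by auto
      then show "x \<in> W" using k step[of k] ends ab(3) by auto
    qed
    show "(a, b) \<in> cycle_edges us" using cycle_edges_last[OF us(1)] us by simp
  qed
qed

text \<open>A chord and the arc of \<open>vs\<close> leading back from its end close up to a cycle
  through \<open>a\<close>; cycle-disjointness identifies it with \<open>vs\<close>.\<close>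

lemma dicycle_chordless:
  assumes "irrefl E" "cycle_disjoint E" and vs: "dicycle E vs"
    and ab: "(a, b) \<in> E" "a \<in> set vs" "b \<in> set vs"
  shows "(a, b) \<in> cycle_edges vs"
proof -
  have "cycle_edges vs \<subseteq> Restr E (set vs)"
    using vs cycle_edges_set by (fastforce simp: dicycle_def)
  then have "(b, a) \<in> (Restr E (set vs))\<^sup>*"
    using cycle_edges_connected[OF ab(3,2)] rtrancl_mono by blast
  moreover have "a \<noteq> b" using assms(1) ab(1) by (auto simp: irrefl_def)
  ultimately obtain us where us: "dicycle E us" "(a, b) \<in> cycle_edges us"
    using ab edge_on_dicycle[of a b E "set vs"] by metis
  then have "a \<in> set us" by (auto dest: cycle_edges_set)
  then show ?thesis using assms(2) vs us ab unfolding cycle_disjoint_def by metis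
qed

section \<open>Root cycles\<close>

definition parent_closed :: "'n digraph \<Rightarrow> 'n set \<Rightarrow> 'n set \<Rightarrow> bool" where
  "parent_closed E W C \<longleftrightarrow> (\<forall>(p, c) \<in> E. p \<in> W \<and> c \<in> C \<longrightarrow> p \<in> C)"

definition root_cycle :: "'n digraph \<Rightarrow> 'n set \<Rightarrow> 'n list \<Rightarrow> bool" where
  "root_cycle E W vs \<longleftrightarrow> dicycle E vs \<and> set vs \<subseteq> W \<and> parent_closed E W (set vs)"

lemma parent_closedD: "parent_closed E W C \<Longrightarrow> (p, c) \<in> E \<Longrightarrow> p \<in> W \<Longrightarrow> c \<in> C \<Longrightarrow> p \<in> C"
  by (auto simp: parent_closed_def)

text \<open>A minimal nonempty parent-closed \<open>D\<close> inside \<open>C\<close> is strongly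
  connected, so every edge into \<open>D\<close> lies on a cycle within \<open>D\<close>. An edge
  ending on a given cycle thus lies on a cycle meeting it, hence on that cycle, which is therefore
  parent-closed.\<close>

lemma root_cycle_exists:
  fixes E :: "'n::finite digraph"
  assumes E: "irrefl E" "cycle_disjoint E"
    and C: "C \<subseteq> W" "C \<noteq> {}" "parent_closed E W C"
    and parent: "\<And>c. c \<in> C \<Longrightarrow> \<exists>p\<in>W. (p, c) \<in> E"
  obtains vs where "root_cycle E W vs" "set vs \<subseteq> C"
proof -
  define P where "P D \<longleftrightarrow> D \<subseteq> C \<and> D \<noteq> {} \<and> parent_closed E W D" for D
  have "P C" using C by (simp add: P_def)
  then obtain D where D: "P D" and min: "\<And>D'. P D' \<Longrightarrow> card D \<le> card D'"
    using ex_has_least_nat[of P C card] by blast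
  have path: "(x, a) \<in> (Restr E D)\<^sup>*" if "a \<in> D" "x \<in> D" for x a
  proof -
    \<comment> \<open>The ancestors of \<open>a\<close> inside \<open>D\<close> are parent-closed,
      so by minimality they exhaust \<open>D\<close>.\<close>
    define A where "A = {x \<in> D. (x, a) \<in> (Restr E D)\<^sup>*}"
    have "parent_closed E W A"
      unfolding parent_closed_def
    proof clarify
      fix p c assume pc: "(p, c) \<in> E" "p \<in> W" "c \<in> A"
      then have "p \<in> D" using D by (auto simp: A_def P_def dest: parent_closedD)
      then show "p \<in> A" using pc by (auto simp: A_def intro: converse_rtrancl_into_rtrancl)
    qed
    moreover have "a \<in> A" "A \<subseteq> D" using that by (auto simp: A_def)
    ultimately have "P A" using D by (auto simp: P_def)
    then have "A = D" using min \<open>A \<subseteq> D\<close> by (simp add: card_seteq)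
    then show ?thesis using that by (auto simp: A_def)
  qed
  have cyc: "\<exists>us. dicycle E us \<and> set us \<subseteq> D \<and> (p, c) \<in> cycle_edges us"
    if "(p, c) \<in> E" "p \<in> W" "c \<in> D" for p c
  proof -
    have "p \<in> D" using that D by (auto simp: P_def dest: parent_closedD)
    moreover have "p \<noteq> c" using E(1) that by (auto simp: irrefl_def)
    ultimately show ?thesis using that path edge_on_dicycle[of p c E D] by metis
  qed
  obtain c where c: "c \<in> D" using D by (auto simp: P_def)
  then obtain p where "p \<in> W" "(p, c) \<in> E" using parent D by (auto simp: P_def)
  with c cyc obtain us where us: "dicycle E us" "set us \<subseteq> D" by blast
  have "parent_closed E W (set us)"
    unfolding parent_closed_def
  proof clarify
    fix q d assume qd: "(q, d) \<in> E" "q \<in> W" "d \<in> set us"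
    then obtain us' where us': "dicycle E us'" "(q, d) \<in> cycle_edges us'" using cyc us by blast
    then have "d \<in> set us'" by (auto dest: cycle_edges_set)
    then have "cycle_edges us' = cycle_edges us"
      using E(2) us us' qd unfolding cycle_disjoint_def by blast
    then show "q \<in> set us" using us' by (auto dest: cycle_edges_set)
  qed
  then show ?thesis using us D C that[of us] by (auto simp: root_cycle_def P_def)
qed

lemma root_cycles_disjoint:
  assumes "cycle_disjoint E" "root_cycle E W us" "root_cycle E W vs" "set us \<inter> set vs \<noteq> {}"
  shows "set us = set vs"
proof -
  have eq: "cycle_edges us = cycle_edges vs"
    using assms unfolding cycle_disjoint_def root_cycle_def by blast
  show ?thesis
    by (metis eq cycle_edges_out cycle_edges_set(1) set_eqI)
qed

lemma root_cycle_rotate: "root_cycle E W vs \<Longrightarrow> root_cycle E W (rotate k vs)"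
  by (simp add: root_cycle_def dicycle_def cycle_edges_rotate)

section \<open>Moments of the residuals\<close>

text \<open>Here \<open>B\<close> is the inverse of the full matrix \<open>I - \<Lambda>\<close>: a path between remaining vertices never leaves
  \<open>W\<close>, so no new inverse is needed after a regression.\<close>

definition second_of :: "'n set \<Rightarrow> real^'n^'n \<Rightarrow> real^'n \<Rightarrow> real^'n^'n::finite" where
  "second_of W B w = (\<chi> i j. \<Sum>a\<in>W. B$a$i * B$a$j * w$a)"

definition third_of :: "'n set \<Rightarrow> real^'n^'n \<Rightarrow> real^'n \<Rightarrow> real^'n^'n^'n::finite" where
  "third_of W B w = (\<chi> i j k. \<Sum>a\<in>W. B$a$i * B$a$j * B$a$k * w$a)"

text \<open>The residual at \<open>b\<close> as a linear functional on vectors indexed by vertices.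
  Residual moments of any order arise by applying it to one index after another.\<close>

definition resid :: "'n set \<Rightarrow> real^'n^'n \<Rightarrow> 'n::finite \<Rightarrow> ('n \<Rightarrow> real) \<Rightarrow> real" where
  "resid A S b x = x b - (\<Sum>a\<in>A. regression S A b a * x a)"

text \<open>Unit vectors stand for third moments concentrated on one noise term; these are the
  points at which identically vanishing tests are evaluated.\<close>

lemma third_of_axis:
  assumes "b \<in> W"
  shows "third_of W B (axis b 1)$i$j$k = B$b$i * B$b$j * B$b$k"
proof -
  have "third_of W B (axis b 1)$i$j$k = (\<Sum>a\<in>W. B$a$i * B$a$j * B$a$k * axis b 1$a)"
    by (simp add: third_of_def)
  also have "\<dots> = (\<Sum>a\<in>W. if a = b then B$b$i * B$b$j * B$b$k else 0)"
    by (intro sum.cong) (auto simp: axis_def)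
  finally show ?thesis using assms by simp
qed

lemma third_of_add:
  "third_of W B (x + y)$i$j$k = third_of W B x$i$j$k + third_of W B y$i$j$k"
  by (simp add: third_of_def distrib_left sum.distrib)

lemma residual_map_sum:
  "(\<Sum>i\<in>UNIV. residual_map A S$b$i * x i) = resid A S b x"
proof -
  have "(\<Sum>i\<in>UNIV. residual_map A S$b$i * x i) =
      (\<Sum>i\<in>UNIV. (if i = b then x b else 0) - (if i \<in> A then regression S A b i * x i else 0))"
    unfolding residual_map_def by (intro sum.cong) (auto simp: algebra_simps)
  also have "\<dots> = resid A S b x"
    by (simp add: sum_subtractf sum.If_cases resid_def)
  finally show ?thesis .
qed

lemma residual_second_eq:
  "residual_second A S$i$j = resid A S i (\<lambda>a. resid A S j (\<lambda>b. S$a$b))"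
proof -
  have "residual_second A S$i$j =
      (\<Sum>b\<in>UNIV. (\<Sum>a\<in>UNIV. residual_map A S$i$a * S$a$b) * residual_map A S$j$b)"
    by (simp add: residual_second_def matrix_mult_nth transpose_def)
  also have "\<dots> = (\<Sum>a\<in>UNIV. \<Sum>b\<in>UNIV. residual_map A S$i$a * (residual_map A S$j$b * S$a$b))"
    unfolding sum_distrib_right by (subst sum.swap) (simp add: mult_ac)
  also have "\<dots> = (\<Sum>a\<in>UNIV. residual_map A S$i$a * (\<Sum>b\<in>UNIV. residual_map A S$j$b * S$a$b))"
    by (simp add: sum_distrib_left)
  finally show ?thesis unfolding residual_map_sum .
qed

lemma residual_third_eq:
  "residual_third A S T$i$j$k = resid A S i (\<lambda>a. resid A S j (\<lambda>b. resid A S k (\<lambda>c. T$a$b$c)))"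
proof -
  have "residual_third A S T$i$j$k = (\<Sum>a\<in>UNIV. residual_map A S$i$a *
      (\<Sum>b\<in>UNIV. residual_map A S$j$b * (\<Sum>c\<in>UNIV. residual_map A S$k$c * T$a$b$c)))"
    by (simp add: residual_third_def Let_def sum_distrib_left mult.assoc)
  then show ?thesis unfolding residual_map_sum .
qed

lemma resid_cong:
  assumes "x b = y b" "\<And>a. a \<in> A \<Longrightarrow> x a = y a"
  shows "resid A S b x = resid A S b y"
  using assms by (simp add: resid_def)

lemma resid_sum: "resid A S b (\<lambda>i. \<Sum>k\<in>W. c k * f k i) = (\<Sum>k\<in>W. c k * resid A S b (f k))"
proof -
  have "(\<Sum>a\<in>A. regression S A b a * (\<Sum>k\<in>W. c k * f k a)) =
      (\<Sum>k\<in>W. \<Sum>a\<in>A. regression S A b a * (c k * f k a))"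
    unfolding sum_distrib_left by (rule sum.swap)
  then show ?thesis
    by (simp add: resid_def sum_subtractf right_diff_distrib sum_distrib_left mult.left_commute)
qed

lemma resid_mult: "resid A S b (\<lambda>i. c * f i) = c * resid A S b f"
  using resid_sum[where W = "{()}" and c = "\<lambda>_. c" and f = "\<lambda>_. f"] by simp

lemma matrix_inv_unique:
  fixes A X :: "real^'n::finite^'n"
  assumes "A ** X = mat 1"
  shows "matrix_inv A = X"
proof -
  have "invertible A" using assms by (auto simp: invertible_right_inverse)
  then have "matrix_inv A ** (A ** X) = X" by (simp add: matrix_mul_assoc matrix_inv_left)
  then show ?thesis by (simp add: assms)
qed

section \<open>The matrix I - \<Lambda> and its inverse on sets of remaining vertices\<close>

locale lsem_coeffs =
  fixes E :: "'n::finite digraph" and \<Lambda> :: "real^'n^'n"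
  assumes irrefl: "irrefl E" and acyc: "cycle_disjoint E" and star: "\<Lambda> \<in> edge_coeffs_star E"
begin

definition N :: "real^'n^'n" where "N = mat 1 - \<Lambda>"

definition B :: "real^'n^'n" where "B = matrix_inv N"

lemma inv_N: "invertible N"
  and N_diag [simp]: "N$j$j = 1"
  and N_nz: "N$i$j \<noteq> 0 \<longleftrightarrow> (i, j) \<in> E\<^sup>="
  using star edge_coeffs_star_iff[OF irrefl] unfolding N_def by auto

lemma N_zero: "i \<noteq> j \<Longrightarrow> (i, j) \<notin> E \<Longrightarrow> N$i$j = 0"
  using N_nz[of i j] by auto

lemma N_offdiag: "i \<noteq> j \<Longrightarrow> N$i$j = - \<Lambda>$i$j"
  by (simp add: N_def mat_1_nth)

lemma N_B: "(\<Sum>k\<in>UNIV. N$i$k * B$k$j) = of_bool (i = j)"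
  using matrix_inv_right[OF inv_N] by (simp add: B_def flip: matrix_mult_nth mat_1_nth)

lemma B_N: "(\<Sum>k\<in>UNIV. B$i$k * N$k$j) = of_bool (i = j)"
  using matrix_inv_left[OF inv_N] by (simp add: B_def flip: matrix_mult_nth mat_1_nth)

text \<open>Closure under children. The remaining vertices always form such a set, because each
  round removes a parent-closed set of them.\<close>

definition terminal :: "'n set \<Rightarrow> bool" where
  "terminal W \<longleftrightarrow> (\<forall>(p, c) \<in> E. p \<in> W \<longrightarrow> c \<in> W)"

lemma terminal_UNIV: "terminal UNIV" by (simp add: terminal_def)

lemma terminal_diff: "terminal W \<Longrightarrow> parent_closed E W A \<Longrightarrow> terminal (W - A)"
  unfolding terminal_def parent_closed_def by blast

lemma N_leaving:
  assumes "terminal W" "i \<in> W" "j \<notin> W"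
  shows "N$i$j = 0"
  using assms by (intro N_zero) (auto simp: terminal_def)

lemma N_entering:
  assumes "parent_closed E W A" "i \<in> W" "i \<notin> A" "j \<in> A"
  shows "N$i$j = 0"
  using assms by (intro N_zero) (auto simp: parent_closed_def)

text \<open>Replacing the columns outside \<open>W\<close> by those of the identity does not change the rows of the
  inverse that belong to \<open>W\<close>.\<close>

lemma B_leaving:
  assumes W: "terminal W" and a: "a \<in> W" and i: "i \<notin> W"
  shows "B$a$i = 0"
proof -
  define P :: "real^'n^'n" where
    "P = (\<chi> i j. if i \<in> W \<and> j \<in> W then N$i$j else of_bool (i = j))"
  \<comment> \<open>On row vectors supported in \<open>W\<close>, \<open>N\<close> and
    \<open>P\<close> act alike, since \<open>N\<close> has no entries leading out of
    \<open>W\<close>.\<close>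
  have vN: "(v v* N)$j = (v v* P)$j" if "\<And>i. i \<notin> W \<Longrightarrow> v$i = 0" for v j
  proof -
    have "v$i * N$i$j = v$i * P$i$j" for i
      using that[of i] N_leaving[OF W, of i j] by (auto simp: P_def)
    then show ?thesis by (simp only: vector_matrix_mult_def vec_lambda_beta)
  qed
  have vP: "(v v* P)$j = v$j" if "j \<notin> W" for v j
  proof -
    have "(v v* P)$j = (\<Sum>i\<in>UNIV. of_bool (i = j) * v$i)"
      using that unfolding vector_matrix_mult_def by (auto simp: P_def intro!: sum.cong)
    then show ?thesis by (simp add: sum_of_bool_eq)
  qed
  \<comment> \<open>Invertibility of \<open>P\<close>: outside \<open>W\<close> the product returns
    the entries of \<open>v\<close>, so a kernel vector is supported in \<open>W\<close>, where
    \<open>P\<close> may be replaced by the invertible \<open>N\<close>.\<close>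
  have "v = 0" if "v v* P = 0" for v
  proof -
    have "v$i = 0" if "i \<notin> W" for i
      using vP[OF that, of v] \<open>v v* P = 0\<close> by simp
    then have "v v* N = 0" using vN[of v] \<open>v v* P = 0\<close> by (simp add: vec_eq_iff)
    then have "v v* (N ** matrix_inv N) = 0"
      by (metis vector_matrix_mul_assoc vector_matrix_mult_0)
    then show ?thesis using inv_N by (simp add: matrix_inv_right)
  qed
  then have "\<exists>P'. P' ** transpose P = mat 1"
    by (subst matrix_left_invertible_ker) simp
  then have "invertible (transpose P)" by (simp add: invertible_left_inverse)
  then have "invertible P" using transpose_invertible by fastforce
  then have P: "matrix_inv P ** P = mat 1" by (rule matrix_inv_left)
  \<comment> \<open>Row \<open>a\<close> of the inverse of \<open>P\<close> vanishes outside
    \<open>W\<close>, so it also solves \<open>v v* N = axis a 1\<close> and must be row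
    \<open>a\<close> of \<open>B\<close>.\<close>
  define v where "v = (axis a 1 :: real^'n) v* matrix_inv P"
  have vPa: "v v* P = axis a 1" by (simp add: v_def vector_matrix_mul_assoc P)
  have v0: "v$i = 0" if "i \<notin> W" for i
  proof -
    have "i \<noteq> a" using that a by auto
    then show ?thesis using vP[OF that, of v] unfolding vPa by (simp add: axis_def)
  qed
  then have "v v* N = axis a 1" using vN[OF v0] vPa by (simp add: vec_eq_iff)
  then have "v v* (N ** B) = axis a 1 v* B" by (metis vector_matrix_mul_assoc)
  then have "v = axis a 1 v* B" using inv_N by (simp add: B_def matrix_inv_right)
  then have "v$i = (\<Sum>k\<in>UNIV. axis a 1$k * B$k$i)"
    by (simp add: vector_matrix_mult_def)
  also have "\<dots> = (\<Sum>k\<in>UNIV. of_bool (k = a) * B$k$i)"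
    by (intro sum.cong) (auto simp: axis_def)
  finally have "v$i = B$a$i" by (simp add: sum_of_bool_eq)
  then show ?thesis using v0 i by simp
qed

lemma N_B_on:
  assumes "terminal W" "i \<in> W"
  shows "(\<Sum>k\<in>W. N$i$k * B$k$j) = of_bool (i = j)"
  unfolding N_B[symmetric] using N_leaving[OF assms(1,2)]
  by (intro sum.mono_neutral_left) auto

lemma B_N_on:
  assumes "terminal W" "i \<in> W"
  shows "(\<Sum>k\<in>W. B$i$k * N$k$j) = of_bool (i = j)"
  unfolding B_N[symmetric] using B_leaving[OF assms(1,2)]
  by (intro sum.mono_neutral_left) auto

lemma B_entering:
  assumes "terminal W" "parent_closed E W A" "i \<in> W" "i \<notin> A" "j \<in> A"
  shows "B$i$j = 0"
  using B_leaving[OF terminal_diff[OF assms(1,2)]] assms by auto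

text \<open>With no edges from \<open>W - A\<close> into \<open>A\<close>, both matrices are block
  triangular on \<open>W\<close>, and their blocks on \<open>A\<close> are inverse to each
  other.\<close>

lemma N_B_closed:
  assumes "terminal W" "parent_closed E W A" "A \<subseteq> W" "i \<in> A" "j \<in> A"
  shows "(\<Sum>k\<in>A. N$i$k * B$k$j) = of_bool (i = j)"
  unfolding N_B_on[OF assms(1) subsetD[OF assms(3,4)], symmetric]
  using B_entering[OF assms(1,2)] assms(3,5) by (intro sum.mono_neutral_left) auto

lemma B_N_closed:
  assumes "terminal W" "parent_closed E W A" "A \<subseteq> W" "i \<in> A" "j \<in> A"
  shows "(\<Sum>k\<in>A. B$i$k * N$k$j) = of_bool (i = j)"
  unfolding B_N_on[OF assms(1) subsetD[OF assms(3,4)], symmetric]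
  using N_entering[OF assms(2)] assms(3,5) by (intro sum.mono_neutral_left) auto

text \<open>If \<open>X\<^sub>C\<close> determines every residual up to noise terms that do not enter \<open>X\<^sub>C\<close>, then \<open>C\<close> contains
  its own parents: a rank argument shows that exactly the noise terms of \<open>C\<close> itself enter \<open>X\<^sub>C\<close>.\<close>

lemma parent_closed_of_linear_relations:
  assumes W: "terminal W" and C: "C \<subseteq> W"
    and rel: "\<And>b c d. \<lbrakk>b \<in> W; c \<in> C; d \<in> W - C; B$b$c \<noteq> 0\<rbrakk> \<Longrightarrow> B$b$d = (\<Sum>a\<in>C. R d a * B$b$a)"
  shows "parent_closed E W C"
proof -
  \<comment> \<open>The noise terms that enter \<open>X\<^sub>C\<close>.\<close>
  define Z where "Z = {b \<in> W. \<exists>c\<in>C. B$b$c \<noteq> 0}"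
  define R' where "R' d a = (if d \<in> C then of_bool (a = d) else R d a)" for d a
  \<comment> \<open>On the rows in \<open>Z\<close>, \<open>B\<close> is the product of its columns
    in \<open>C\<close> with \<open>R'\<close>. Multiplying by \<open>N\<close> from the right shows
    that the columns in \<open>C\<close>, combined by \<open>G\<close>, give unit vectors.\<close>
  define G where "G a j = (\<Sum>d\<in>W. R' d a * N$d$j)" for a j
  have finC: "finite C" by simp
  have rel': "B$b$d = (\<Sum>a\<in>C. R' d a * B$b$a)" if "b \<in> Z" "d \<in> W" for b d
  proof (cases "d \<in> C")
    case True
    then have "(\<Sum>a\<in>C. R' d a * B$b$a) = (\<Sum>a\<in>C. if a = d then B$b$d else 0)"
      by (intro sum.cong) (auto simp: R'_def)
    then show ?thesis using True by simp
  next
    case False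
    then show ?thesis using that rel by (auto simp: R'_def Z_def)
  qed
  have BZ: "B$b$a = 0" if "b \<in> W" "b \<notin> Z" "a \<in> C" for a b
    using that by (auto simp: Z_def)
  have BG: "(\<Sum>a\<in>C. B$b$a * G a j) = of_bool (b = j)" if "b \<in> W" "j \<in> Z" for b j
  proof (cases "b \<in> Z")
    case True
    have "(\<Sum>a\<in>C. B$b$a * G a j) = (\<Sum>d\<in>W. (\<Sum>a\<in>C. R' d a * B$b$a) * N$d$j)"
      unfolding G_def sum_distrib_left sum_distrib_right by (subst sum.swap) (simp add: mult_ac)
    also have "\<dots> = (\<Sum>d\<in>W. B$b$d * N$d$j)" using rel'[OF True] by (intro sum.cong) auto
    finally show ?thesis using B_N_on[OF W that(1)] by simp
  next
    case False
    then show ?thesis using BZ that by auto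
  qed
  \<comment> \<open>Applying row \<open>i\<close> of \<open>N\<close> to \<open>BG\<close> from the
    left would leave only the term \<open>a = i\<close>, but \<open>i\<close> is not in
    \<open>C\<close>. So the columns of \<open>N\<close> in \<open>Z\<close> are supported in
    \<open>C\<close>, and the unit diagonal puts \<open>Z\<close> inside \<open>C\<close>.\<close>
  have GN: "N$i$j = 0" if "i \<in> W" "i \<notin> C" "j \<in> Z" for i j
  proof -
    have jW: "j \<in> W" using that by (simp add: Z_def)
    have "N$i$j = (\<Sum>b\<in>W. if b = j then N$i$j else 0)" using jW by simp
    also have "\<dots> = (\<Sum>b\<in>W. N$i$b * (\<Sum>a\<in>C. B$b$a * G a j))"
      using BG that by (intro sum.cong) auto
    also have "\<dots> = (\<Sum>a\<in>C. (\<Sum>b\<in>W. N$i$b * B$b$a) * G a j)"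
      unfolding sum_distrib_left sum_distrib_right by (subst sum.swap) (simp add: mult_ac)
    also have "\<dots> = 0" using N_B_on[OF W that(1)] that(2) by (intro sum.neutral) auto
    finally show ?thesis .
  qed
  have ZC: "Z \<subseteq> C"
    using GN N_diag by (metis (no_types, lifting) Z_def mem_Collect_eq subsetI zero_neq_one)
  have "C \<subseteq> Z"
  proof (rule ccontr)
    assume "\<not> C \<subseteq> Z"
    then obtain c where c: "c \<in> C" "c \<notin> Z" by blast
    \<comment> \<open>The blocks of \<open>N\<close> on \<open>C\<close>, \<open>Z\<close> and of
      \<open>B\<close> on \<open>Z\<close>, \<open>C\<close>, padded by zeros on \<open>C\<close>
      and by the identity outside. Their product is the identity although row \<open>c\<close> of
      \<open>Q\<close> vanishes: a product through fewer than \<open>card C\<close> dimensions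
      cannot have full rank.\<close>
    define P :: "real^'n^'n" where
      "P = (\<chi> i j. if i \<in> C then (if j \<in> Z then N$i$j else 0) else of_bool (i = j))"
    define Q :: "real^'n^'n" where
      "Q = (\<chi> i j. if j \<in> C then (if i \<in> Z then B$i$j else 0) else of_bool (i = j))"
    have "(P ** Q)$i$j = (mat 1 :: real^'n^'n)$i$j" for i j
    proof -
      consider "i \<in> C" "j \<in> C" | "i \<in> C" "j \<notin> C" | "i \<notin> C" "j \<in> C" | "i \<notin> C" "j \<notin> C" by blast
      then show ?thesis
      proof cases
        case 1
        have "(P ** Q)$i$j = (\<Sum>k\<in>UNIV. if k \<in> Z then N$i$k * B$k$j else 0)"
          using 1 unfolding matrix_mult_nth by (intro sum.cong) (auto simp: P_def Q_def)
        also have "\<dots> = (\<Sum>k\<in>W. N$i$k * B$k$j)"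
          using BZ[OF _ _ 1(2)] by (intro sum.mono_neutral_cong_right) (auto simp: Z_def)
        finally show ?thesis using N_B_on[OF W, of i j] 1 C by (auto simp: mat_1_nth)
      next
        case 2
        then have "(P ** Q)$i$j = 0"
          using ZC unfolding matrix_mult_nth by (intro sum.neutral) (auto simp: P_def Q_def)
        then show ?thesis using 2 by (auto simp: mat_1_nth)
      next
        case 3
        then have "(P ** Q)$i$j = 0"
          using ZC unfolding matrix_mult_nth by (intro sum.neutral) (auto simp: P_def Q_def)
        then show ?thesis using 3 by (auto simp: mat_1_nth)
      next
        case 4
        then have "(P ** Q)$i$j = (\<Sum>k\<in>UNIV. if k = i then of_bool (i = j) else 0)"
          unfolding matrix_mult_nth by (intro sum.cong) (auto simp: P_def Q_def)
        then show ?thesis by (simp add: mat_1_nth)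
      qed
    qed
    then have "P ** Q = mat 1" by (simp add: vec_eq_iff)
    then have "Q ** P = mat 1" by (simp add: matrix_left_right_inverse)
    moreover have "(Q ** P)$c$c = 0"
      using c unfolding matrix_mult_nth by (intro sum.neutral) (auto simp: P_def Q_def)
    ultimately show False by (simp add: mat_1_nth)
  qed
  then show ?thesis
    unfolding parent_closed_def using GN N_nz by (fastforce)
qed

end

section \<open>The tests of the algorithm and the moments left after a regression\<close>

definition residual_test ::
  "real^'n^'n \<Rightarrow> real^'n^'n^'n \<Rightarrow> 'n::finite set \<Rightarrow> 'n \<Rightarrow> 'n \<Rightarrow> real" where
  "residual_test S T C c d = resid C S d (\<lambda>a. T$c$c$a)"

text \<open>The coefficient of the unknown in \<open>weight_linear\<close>; the equation determines
  the weight only where it is nonzero.\<close>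

definition orient_det :: "real^'n^'n \<Rightarrow> real^'n^'n^'n \<Rightarrow> 'n \<Rightarrow> 'n \<Rightarrow> 'n \<Rightarrow> real" where
  "orient_det S T u v w = det (transpose (vector [
     vector [S$u$u, T$u$u$u, T$u$u$v],
     vector [S$u$w, T$u$u$w, T$u$v$w],
     vector [S$v$w, T$u$v$w, T$v$v$w]]) :: real^3^3)"

text \<open>The quantities involving third moments whose vanishing or nonvanishing matters in a run.
  Each is polynomial in \<open>T\<close>, whereas \<open>S\<close> also enters through an inverse
  matrix.\<close>

definition moment_tests :: "(real^'n^'n \<Rightarrow> real^'n^'n^'n::finite \<Rightarrow> real) set" where
  "moment_tests = {\<lambda>S T. d22 S T u v |u v. True} \<union> {\<lambda>S T. d33 S T u v |u v. True} \<union>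
     {\<lambda>S T. residual_test S T C c d |C c d. True} \<union> {\<lambda>S T. orient_det S T u v w |u v w. True}"

lemma moment_testsI:
  "(\<lambda>S T. d22 S T u v) \<in> moment_tests" "(\<lambda>S T. d33 S T u v) \<in> moment_tests"
  "(\<lambda>S T. residual_test S T C c d) \<in> moment_tests" "(\<lambda>S T. orient_det S T u v w) \<in> moment_tests"
  unfolding moment_tests_def by blast+

text \<open>Assumption \<open>generic\<close> is the only form in which genericity of the third moments is used. Of \<open>\<Lambda>\<close>
  nothing is required beyond nonzero coefficients on the edges.\<close>

locale lsem_generic = lsem_coeffs E \<Lambda> for E :: "'n::finite digraph" and \<Lambda> +
  fixes w2 w3 :: "real^'n"
  assumes w2_pos: "0 < w2$a"
    and two_cycle: "(u, v) \<in> E \<Longrightarrow> (v, u) \<in> E \<Longrightarrow> \<Lambda>$u$v * w2$u + \<Lambda>$v$u * w2$v \<noteq> 0"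
    and generic: "f \<in> moment_tests \<Longrightarrow> f (second_of W B w2) (third_of W B w3) = 0 \<Longrightarrow>
      f (second_of W B w2) (third_of W B z) = 0"
begin

abbreviation S0 :: "'n set \<Rightarrow> real^'n^'n" where "S0 W \<equiv> second_of W B w2"

abbreviation T0 :: "'n set \<Rightarrow> real^'n^'n^'n" where "T0 W \<equiv> third_of W B w3"

lemma S0_nth: "S0 W$i$j = (\<Sum>a\<in>W. B$a$i * B$a$j * w2$a)"
  by (simp add: second_of_def)

lemma T0_nth: "T0 W$i$j$k = (\<Sum>a\<in>W. B$a$i * B$a$j * B$a$k * w3$a)"
  by (simp add: third_of_def)

lemma S0_pos:
  assumes "terminal W" "r \<in> W"
  shows "0 < S0 W$r$r"
proof -
  have "\<exists>a\<in>W. B$a$r \<noteq> 0"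
  proof (rule ccontr)
    assume "\<not> ?thesis"
    then have "(\<Sum>k\<in>W. N$r$k * B$k$r) = 0" by simp
    then show False using N_B_on[OF assms, of r] by simp
  qed
  then obtain a where a: "a \<in> W" "B$a$r \<noteq> 0" by blast
  have "0 < B$a$r * B$a$r * w2$a" using a w2_pos[of a] by (auto simp: zero_less_mult_iff not_less)
  moreover have "0 \<le> B$a$r * B$a$r * w2$a" for a
    using less_imp_le[OF w2_pos[of a]] by (intro mult_nonneg_nonneg zero_le_square)
  ultimately show ?thesis
    unfolding S0_nth using a(1) by (intro sum_pos2[of _ a]) auto
qed

text \<open>On a parent-closed \<open>A\<close> the covariance block is built from the block of
  \<open>B\<close> and the noise variances, so its inverse is built from \<open>N\<close> and the
  inverse variances; the inner sum is an entry of this inverse. Letting \<open>b\<close> range over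
  \<open>W\<close> covers both the inverse itself and the regression coefficients.\<close>

lemma regression_closed_aux:
  assumes W: "terminal W" and A: "parent_closed E W A" "A \<subseteq> W" and ab: "a \<in> A" "b \<in> W"
  shows "(\<Sum>c\<in>A. S0 W$b$c * (\<Sum>l\<in>A. N$c$l * N$a$l / w2$l)) = (\<Sum>k\<in>A. N$a$k * B$k$b)"
proof -
  have S: "S0 W$b$c = (\<Sum>k\<in>A. B$k$b * B$k$c * w2$k)" if "c \<in> A" for c
    unfolding S0_nth using B_entering[OF W A(1) _ _ that] A(2)
    by (intro sum.mono_neutral_right) auto
  have "(\<Sum>c\<in>A. S0 W$b$c * (\<Sum>l\<in>A. N$c$l * N$a$l / w2$l)) =
      (\<Sum>c\<in>A. \<Sum>k\<in>A. \<Sum>l\<in>A. B$k$b * w2$k * N$a$l / w2$l * (B$k$c * N$c$l))"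
    by (intro sum.cong) (auto simp: S sum_product mult_ac)
  also have "\<dots> = (\<Sum>k\<in>A. \<Sum>c\<in>A. \<Sum>l\<in>A. B$k$b * w2$k * N$a$l / w2$l * (B$k$c * N$c$l))"
    by (rule sum.swap)
  also have "\<dots> = (\<Sum>k\<in>A. \<Sum>l\<in>A. \<Sum>c\<in>A. B$k$b * w2$k * N$a$l / w2$l * (B$k$c * N$c$l))"
    by (intro sum.cong sum.swap refl)
  also have "\<dots> = (\<Sum>k\<in>A. \<Sum>l\<in>A. B$k$b * w2$k * N$a$l / w2$l * of_bool (k = l))"
    by (intro sum.cong refl) (simp only: sum_distrib_left[symmetric] B_N_closed[OF W A])
  also have "\<dots> = (\<Sum>k\<in>A. \<Sum>l\<in>A. if k = l then B$k$b * N$a$k else 0)"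
    using w2_pos by (intro sum.cong refl) (auto simp: less_imp_neq[symmetric])
  also have "\<dots> = (\<Sum>k\<in>A. N$a$k * B$k$b)" by (simp add: mult.commute)
  finally show ?thesis .
qed

lemma sub_inverse_closed:
  assumes W: "terminal W" and A: "parent_closed E W A" "A \<subseteq> W" and uv: "u \<in> A" "v \<in> A"
  shows "sub_inverse A (S0 W)$u$v = (\<Sum>k\<in>A. N$u$k * N$v$k / w2$k)"
proof -
  define X :: "real^'n^'n" where
    "X = (\<chi> i j. if i \<in> A \<and> j \<in> A then S0 W$i$j else if i = j then 1 else 0)"
  define Y :: "real^'n^'n" where
    "Y = (\<chi> i j. if i \<in> A \<and> j \<in> A then \<Sum>k\<in>A. N$i$k * N$j$k / w2$k else if i = j then 1 else 0)"
  have "(X ** Y)$i$j = (mat 1 :: real^'n^'n)$i$j" for i j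
  proof -
    consider "i \<in> A" "j \<in> A" | "i \<in> A" "j \<notin> A" | "i \<notin> A" by blast
    then show ?thesis
    proof cases
      case 1
      have "(X ** Y)$i$j = (\<Sum>c\<in>A. S0 W$i$c * (\<Sum>l\<in>A. N$c$l * N$j$l / w2$l))"
        unfolding matrix_mult_nth using 1
        by (intro sum.mono_neutral_cong_right) (auto simp: X_def Y_def)
      also have "\<dots> = (\<Sum>k\<in>A. N$j$k * B$k$i)"
        using 1 A by (intro regression_closed_aux[OF W A]) auto
      also have "\<dots> = of_bool (j = i)" using 1 by (intro N_B_closed[OF W A])
      finally show ?thesis by (auto simp: mat_1_nth)
    next
      case 2
      then have "(X ** Y)$i$j = 0"
        unfolding matrix_mult_nth by (intro sum.neutral) (auto simp: X_def Y_def)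
      then show ?thesis using 2 by (auto simp: mat_1_nth)
    next
      case 3
      then have "(X ** Y)$i$j = (\<Sum>k\<in>UNIV. if k = i then of_bool (i = j) else 0)"
        unfolding matrix_mult_nth by (intro sum.cong) (auto simp: X_def Y_def)
      then show ?thesis by (simp add: mat_1_nth)
    qed
  qed
  then have "X ** Y = mat 1" by (simp add: vec_eq_iff)
  then have "sub_inverse A (S0 W) = Y"
    unfolding sub_inverse_def X_def by (rule matrix_inv_unique)
  then show ?thesis using uv by (simp add: Y_def)
qed

lemma regression_closed:
  assumes W: "terminal W" and A: "parent_closed E W A" "A \<subseteq> W" and ab: "a \<in> A" "b \<in> W"
  shows "regression (S0 W) A b a = (\<Sum>k\<in>A. N$a$k * B$k$b)"
proof -
  have "regression (S0 W) A b a = (\<Sum>c\<in>A. S0 W$b$c * (\<Sum>l\<in>A. N$c$l * N$a$l / w2$l))"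
    unfolding regression_def using sub_inverse_closed[OF W A _ ab(1)] by (intro sum.cong) auto
  then show ?thesis using regression_closed_aux[OF assms] by simp
qed

text \<open>The coefficients from \<open>regression_closed\<close> are a product of \<open>N\<close>
  and \<open>B\<close>; on a noise term of \<open>A\<close> the factor \<open>N\<close> cancels
  against \<open>B\<close>, while the other noise terms do not enter \<open>A\<close> at
  all.\<close>

lemma resid_B:
  assumes W: "terminal W" and A: "parent_closed E W A" "A \<subseteq> W" and kb: "k \<in> W" "b \<in> W"
  shows "resid A (S0 W) b (\<lambda>i. B$k$i) = (if k \<in> A then 0 else B$k$b)"
proof (cases "k \<in> A")
  case True
  have "(\<Sum>a\<in>A. regression (S0 W) A b a * B$k$a) = (\<Sum>a\<in>A. \<Sum>l\<in>A. B$l$b * (B$k$a * N$a$l))"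
    using regression_closed[OF W A _ kb(2)] by (intro sum.cong) (auto simp: sum_distrib_left sum_distrib_right mult_ac)
  also have "\<dots> = (\<Sum>l\<in>A. \<Sum>a\<in>A. B$l$b * (B$k$a * N$a$l))" by (rule sum.swap)
  also have "\<dots> = (\<Sum>l\<in>A. if l = k then B$l$b else 0)"
    by (intro sum.cong refl) (simp add: sum_distrib_left[symmetric] B_N_closed[OF W A True]
        del: sum_distrib_left)
  also have "\<dots> = B$k$b" using True by simp
  finally show ?thesis using True by (simp add: resid_def)
next
  case False
  then show ?thesis using B_entering[OF W A(1) kb(1)] by (simp add: resid_def)
qed

lemma resid_S0:
  assumes W: "terminal W" and A: "parent_closed E W A" "A \<subseteq> W" and b: "b \<in> W"
  shows "resid A (S0 W) b (\<lambda>i. \<Sum>k\<in>W. c k * B$k$i) = (\<Sum>k\<in>W - A. c k * B$k$b)"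
proof -
  have "resid A (S0 W) b (\<lambda>i. \<Sum>k\<in>W. c k * B$k$i) = (\<Sum>k\<in>W. c k * resid A (S0 W) b (\<lambda>i. B$k$i))"
    by (rule resid_sum)
  also have "\<dots> = (\<Sum>k\<in>W. if k \<in> A then 0 else c k * B$k$b)"
    using resid_B[OF W A _ b] by (intro sum.cong) auto
  also have "\<dots> = (\<Sum>k\<in>W - A. c k * B$k$b)"
    by (intro sum.mono_neutral_cong_right) auto
  finally show ?thesis .
qed

text \<open>Restricted to \<open>W\<close>, because entries of the residual moments with an index
  outside carry no meaning.\<close>

definition agrees :: "'n set \<Rightarrow> real^'n^'n \<Rightarrow> real^'n^'n^'n \<Rightarrow> bool" where
  "agrees W S T \<longleftrightarrow> (\<forall>i\<in>W. \<forall>j\<in>W. S$i$j = S0 W$i$j) \<and>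
     (\<forall>i\<in>W. \<forall>j\<in>W. \<forall>k\<in>W. T$i$j$k = T0 W$i$j$k)"

lemma agreesD:
  assumes "agrees W S T"
  shows "i \<in> W \<Longrightarrow> j \<in> W \<Longrightarrow> S$i$j = S0 W$i$j"
    "i \<in> W \<Longrightarrow> j \<in> W \<Longrightarrow> k \<in> W \<Longrightarrow> T$i$j$k = T0 W$i$j$k"
  using assms by (auto simp: agrees_def)

lemma agrees_sub_inverse:
  assumes "agrees W S T" "C \<subseteq> W"
  shows "sub_inverse C S = sub_inverse C (S0 W)"
proof -
  have "(\<chi> i j. if i \<in> C \<and> j \<in> C then S$i$j else if i = j then 1 else 0) =
      (\<chi> i j. if i \<in> C \<and> j \<in> C then S0 W$i$j else if i = j then 1 else 0 :: real^'n^'n)"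
    using agreesD(1)[OF assms(1)] assms(2) by (auto simp: vec_eq_iff)
  then show ?thesis by (simp add: sub_inverse_def)
qed

lemma agrees_regression:
  assumes "agrees W S T" "C \<subseteq> W" "b \<in> W"
  shows "regression S C b a = regression (S0 W) C b a"
  unfolding regression_def agrees_sub_inverse[OF assms(1,2)]
  using agreesD(1)[OF assms(1)] assms(2,3) by (intro sum.cong) auto

lemma agrees_resid:
  assumes "agrees W S T" "C \<subseteq> W" "b \<in> W"
  shows "resid C S b x = resid C (S0 W) b x"
  by (simp add: resid_def agrees_regression[OF assms])

lemma agrees_residual:
  assumes W: "terminal W" and A: "parent_closed E W A" "A \<subseteq> W" and ST: "agrees W S T"
  shows "agrees (W - A) (residual_second A S) (residual_third A S T)"
  unfolding agrees_def
proof (intro conjI ballI)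
  note R = agrees_resid[OF ST A(2)]
  fix i j assume i: "i \<in> W - A" and j: "j \<in> W - A"
  have step: "resid A S b x = resid A (S0 W) b y"
    if "b \<in> W - A" "\<And>a. a \<in> W \<Longrightarrow> x a = y a" for b x y
    using that A(2) R[of b x] by (auto intro!: resid_cong)
  have "residual_second A S$i$j =
      resid A (S0 W) i (\<lambda>a. resid A (S0 W) j (\<lambda>b. \<Sum>k\<in>W. (B$k$a * w2$k) * B$k$b))"
    unfolding residual_second_eq using agreesD(1)[OF ST]
    by (intro step[OF i] step[OF j]) (auto simp: S0_nth mult_ac)
  also have "\<dots> = resid A (S0 W) i (\<lambda>a. \<Sum>k\<in>W - A. (B$k$j * w2$k) * B$k$a)"
    using j by (subst resid_S0[OF W A]) (auto simp: mult_ac)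
  \<comment> \<open>Zero coefficients extend the sum back to \<open>W\<close>, so that
    \<open>resid_S0\<close> applies to the next index.\<close>
  also have "\<dots> = resid A (S0 W) i (\<lambda>a. \<Sum>k\<in>W. (if k \<in> A then 0 else B$k$j * w2$k) * B$k$a)"
    by (intro arg_cong[where f = "resid A (S0 W) i"] ext sum.mono_neutral_cong_left) auto
  also have "\<dots> = (\<Sum>k\<in>W - A. (B$k$j * w2$k) * B$k$i)"
    using i by (subst resid_S0[OF W A]) auto
  finally show "residual_second A S$i$j = S0 (W - A)$i$j" by (simp add: S0_nth mult_ac)
  fix l assume l: "l \<in> W - A"
  have "residual_third A S T$i$j$l = resid A (S0 W) i (\<lambda>a. resid A (S0 W) j (\<lambda>b. resid A (S0 W) l
      (\<lambda>c. \<Sum>k\<in>W. (B$k$a * B$k$b * w3$k) * B$k$c)))"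
    unfolding residual_third_eq using agreesD(2)[OF ST]
    by (intro step[OF i] step[OF j] step[OF l]) (auto simp: T0_nth mult_ac)
  also have "\<dots> = resid A (S0 W) i (\<lambda>a. resid A (S0 W) j (\<lambda>b. \<Sum>k\<in>W - A. (B$k$a * B$k$l * w3$k) * B$k$b))"
    using l by (subst resid_S0[OF W A]) (auto simp: mult_ac)
  also have "\<dots> = resid A (S0 W) i (\<lambda>a. resid A (S0 W) j (\<lambda>b. \<Sum>k\<in>W.
      (if k \<in> A then 0 else B$k$a * B$k$l * w3$k) * B$k$b))"
    by (intro arg_cong[where f = "resid A (S0 W) i"] arg_cong[where f = "resid A (S0 W) j"]
        ext sum.mono_neutral_cong_left) auto
  also have "\<dots> = resid A (S0 W) i (\<lambda>a. \<Sum>k\<in>W - A. (B$k$l * B$k$j * w3$k) * B$k$a)"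
    using j by (subst resid_S0[OF W A]) (auto simp: mult_ac)
  also have "\<dots> = resid A (S0 W) i (\<lambda>a. \<Sum>k\<in>W. (if k \<in> A then 0 else B$k$l * B$k$j * w3$k) * B$k$a)"
    by (intro arg_cong[where f = "resid A (S0 W) i"] ext sum.mono_neutral_cong_left) auto
  also have "\<dots> = (\<Sum>k\<in>W - A. (B$k$l * B$k$j * w3$k) * B$k$i)"
    using i by (subst resid_S0[OF W A]) auto
  finally show "residual_third A S T$i$j$l = T0 (W - A)$i$j$l" by (simp add: T0_nth mult_ac)
qed

section \<open>Root nodes\<close>

lemma agrees_d22: "agrees W S T \<Longrightarrow> u \<in> W \<Longrightarrow> v \<in> W \<Longrightarrow> d22 S T u v = d22 (S0 W) (T0 W) u v"
  by (simp add: d22_def agreesD)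

lemma agrees_d33: "agrees W S T \<Longrightarrow> u \<in> W \<Longrightarrow> v \<in> W \<Longrightarrow> d33 S T u v = d33 (S0 W) (T0 W) u v"
  by (simp add: d33_def agreesD)

text \<open>At third moments concentrated on \<open>b\<close> the test is the square of
  \<open>B$b$u\<close> times \<open>S0 W$u$u * B$b$v - S0 W$u$v * B$b$u\<close>.\<close>

lemma d22_zero_imp_proportional:
  assumes W: "terminal W" and u: "u \<in> W" and d: "d22 (S0 W) (T0 W) u v = 0"
    and b: "b \<in> W" "B$b$u \<noteq> 0"
  shows "B$b$v = S0 W$u$v / S0 W$u$u * B$b$u"
proof -
  have "d22 (S0 W) (third_of W B (axis b 1)) u v = 0"
    using generic[OF moment_testsI(1)] d by blast
  then have "S0 W$u$u * B$b$v * (B$b$u)\<^sup>2 = S0 W$u$v * B$b$u * (B$b$u)\<^sup>2"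
    using third_of_axis[OF b(1)] by (simp add: d22_def power2_eq_square algebra_simps)
  then have "S0 W$u$u * B$b$v = S0 W$u$v * B$b$u" using b(2) by simp
  then show ?thesis using S0_pos[OF W u] by (simp add: field_simps)
qed

text \<open>If \<open>r\<close> passes, then in every noise term entering \<open>X\<^sub>r\<close>
  all variables are fixed multiples of \<open>X\<^sub>r\<close>, and such relations make
  \<open>{r}\<close> parent-closed. Conversely, a vertex without parents in \<open>W\<close> is
  driven by its own noise alone, so both moments in the test are \<open>B$r$u\<close> times a factor
  independent of \<open>u\<close>.\<close>

lemma root_nodes_eq:
  assumes W: "terminal W" and ST: "agrees W S T"
  shows "root_nodes W S T = {r \<in> W. \<forall>p\<in>W. (p, r) \<notin> E}"
proof (intro set_eqI iffI)
  fix r assume r: "r \<in> root_nodes W S T"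
  then have rW: "r \<in> W" by (simp add: root_nodes_def)
  have d: "d22 (S0 W) (T0 W) r u = 0" if "u \<in> W" for u
    using r agrees_d22[OF ST rW that] that by (auto simp: root_nodes_def)
  have "parent_closed E W {r}"
  proof (rule parent_closed_of_linear_relations[OF W, where R = "\<lambda>d a. S0 W$r$d / S0 W$r$r"])
    show "{r} \<subseteq> W" using rW by simp
    fix b c d' assume "b \<in> W" "c \<in> {r}" "d' \<in> W - {r}" "B$b$c \<noteq> 0"
    then show "B$b$d' = (\<Sum>a\<in>{r}. S0 W$r$d' / S0 W$r$r * B$b$a)"
      using d22_zero_imp_proportional[OF W rW d[of d'], of b] by simp
  qed
  then show "r \<in> {r \<in> W. \<forall>p\<in>W. (p, r) \<notin> E}"
    using rW irrefl by (auto simp: parent_closed_def irrefl_def)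
next
  fix r assume r: "r \<in> {r \<in> W. \<forall>p\<in>W. (p, r) \<notin> E}"
  then have "parent_closed E W {r}" by (auto simp: parent_closed_def)
  then have 0: "B$a$r = 0" if "a \<in> W" "a \<noteq> r" for a
    using B_entering[OF W] that by auto
  have "S0 W$r$u = B$r$r * B$r$u * w2$r" for u
    unfolding S0_nth using r 0 by (subst sum.remove[of _ r]) auto
  moreover have "T0 W$r$r$u = B$r$r * B$r$r * B$r$u * w3$r" for u
    unfolding T0_nth using r 0 by (subst sum.remove[of _ r]) auto
  ultimately have "d22 (S0 W) (T0 W) r u = 0" for u by (simp add: d22_def)
  then show "r \<in> root_nodes W S T" using r agrees_d22[OF ST] by (auto simp: root_nodes_def)
qed

end

section \<open>Recognizing root cycles\<close>

text \<open>The coefficients in (1 + p q) b = q a + p c never vanish together. For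
  \<open>q = 0\<close> the column b is a multiple of c; otherwise a is eliminated after multiplying
  by \<open>q\<close>.\<close>

lemma det3_dependent_columns:
  fixes a1 :: real
  assumes "(1 + p * q) * b1 = q * a1 + p * c1" "(1 + p * q) * b2 = q * a2 + p * c2"
    "(1 + p * q) * b3 = q * a3 + p * c3"
  shows "a1 * (b2 * c3 - b3 * c2) - b1 * (a2 * c3 - a3 * c2) + c1 * (a2 * b3 - a3 * b2) = 0"
proof (cases "q = 0")
  case True
  then have "b1 = p * c1" "b2 = p * c2" "b3 = p * c3" using assms by auto
  then show ?thesis by (simp only:) (simp add: algebra_simps)
next
  case False
  have "q * (a1 * (b2 * c3 - b3 * c2) - b1 * (a2 * c3 - a3 * c2) + c1 * (a2 * b3 - a3 * b2)) =
      (q * a1) * (b2 * c3 - b3 * c2) - b1 * ((q * a2) * c3 - (q * a3) * c2) + c1 * ((q * a2) * b3 - (q * a3) * b2)"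
    by (simp add: algebra_simps)
  also have "\<dots> = 0"
  proof -
    have "q * a1 = (1 + p * q) * b1 - p * c1" "q * a2 = (1 + p * q) * b2 - p * c2"
      "q * a3 = (1 + p * q) * b3 - p * c3" using assms by auto
    then show ?thesis by (simp only:) (simp add: algebra_simps)
  qed
  finally show ?thesis using False by simp
qed

lemma d33_eq:
  "d33 S T u v = S$u$u * (T$u$u$v * T$v$v$v - T$u$v$v * T$u$v$v)
     - S$u$v * (T$u$u$u * T$v$v$v - T$u$u$v * T$u$v$v)
     + S$v$v * (T$u$u$u * T$u$v$v - T$u$u$v * T$u$u$v)"
  unfolding d33_def det_3 by (simp add: vector_3 algebra_simps)

text \<open>If \<open>X\<^sub>u\<close> and \<open>X\<^sub>v\<close> combine only two noise terms in different ratios, every noise term is a zero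
  of the quadratic form \<open>(y - q x) (x - p y)\<close>, which gives a dependency of the columns.\<close>

lemma d33_zero_of_two_directions:
  assumes "\<And>a. a \<in> W \<Longrightarrow> B$a$v = q * B$a$u \<or> B$a$u = p * B$a$v"
  shows "d33 (second_of W B w) (third_of W B z) u v = 0"
proof -
  have row: "(1 + p * q) * (\<Sum>a\<in>W. B$a$u * B$a$v * c a) =
      q * (\<Sum>a\<in>W. B$a$u * B$a$u * c a) + p * (\<Sum>a\<in>W. B$a$v * B$a$v * c a)" for c :: "_ \<Rightarrow> real"
    unfolding sum_distrib_left sum.distrib[symmetric]
  proof (intro sum.cong refl)
    fix a assume "a \<in> W"
    then have "(B$a$v - q * B$a$u) * (B$a$u - p * B$a$v) = 0" using assms by fastforce
    then have "(1 + p * q) * (B$a$u * B$a$v) - q * (B$a$u * B$a$u) - p * (B$a$v * B$a$v) = 0"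
      by (simp add: algebra_simps)
    then have "(1 + p * q) * (B$a$u * B$a$v) * c a = (q * (B$a$u * B$a$u) + p * (B$a$v * B$a$v)) * c a"
      by (simp add: algebra_simps)
    then show "(1 + p * q) * (B$a$u * B$a$v * c a) = q * (B$a$u * B$a$u * c a) + p * (B$a$v * B$a$v * c a)"
      by (simp add: algebra_simps)
  qed
  show ?thesis
    unfolding d33_eq
    using row[of "\<lambda>a. w$a"] row[of "\<lambda>a. B$a$u * z$a"] row[of "\<lambda>a. B$a$v * z$a"]
    by (intro det3_dependent_columns[where p = p and q = q])
      (simp_all add: second_of_def third_of_def mult_ac)
qed

section \<open>How noise travels along a root cycle\<close>

context lsem_coeffs
begin

lemma root_cycleD:
  assumes "root_cycle E W vs"
  shows "distinct vs" "2 \<le> length vs" "set vs \<subseteq> W" "parent_closed E W (set vs)"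
    "\<And>u v. (u, v) \<in> cycle_edges vs \<Longrightarrow> (u, v) \<in> E" "vs \<noteq> []"
  using assms by (auto simp: root_cycle_def dicycle_def)

lemma root_cycle_edge_neq: "root_cycle E W vs \<Longrightarrow> (u, v) \<in> cycle_edges vs \<Longrightarrow> u \<noteq> v"
  using cycle_edges_irrefl root_cycleD by metis

lemma root_cycle_coeff_nz:
  assumes "root_cycle E W vs" "(u, v) \<in> cycle_edges vs"
  shows "\<Lambda>$u$v \<noteq> 0"
  using N_nz[of u v] N_offdiag[of u v] root_cycleD(5)[OF assms] root_cycle_edge_neq[OF assms] by auto

lemma root_cycle_N:
  assumes "root_cycle E W vs" "j \<in> set vs" "i \<in> W" "N$i$j \<noteq> 0"
  shows "i = j \<or> (i, j) \<in> cycle_edges vs"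
proof (cases "i = j")
  case False
  then have ij: "(i, j) \<in> E" using assms(4) N_nz by auto
  then have "i \<in> set vs" using assms root_cycleD(4)[OF assms(1)] parent_closedD by metis
  then show ?thesis
    using dicycle_chordless[OF irrefl acyc] ij assms(1,2) unfolding root_cycle_def by blast
qed simp

text \<open>The only parent of \<open>v\<close> within \<open>W\<close> is its predecessor, so
  column \<open>v\<close> of \<open>N\<close> has two entries in the rows of \<open>W\<close>; the
  claim is column \<open>v\<close> of \<open>B ** N = mat 1\<close>.\<close>

lemma root_cycle_recursion:
  assumes W: "terminal W" and rc: "root_cycle E W vs" and uv: "(u, v) \<in> cycle_edges vs" and a: "a \<in> W"
  shows "B$a$v = \<Lambda>$u$v * B$a$u + of_bool (a = v)"
proof -
  have mem: "u \<in> W" "v \<in> W" "v \<in> set vs"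
    using cycle_edges_set[OF uv] root_cycleD(3)[OF rc] by auto
  have ne: "u \<noteq> v" using root_cycle_edge_neq[OF rc uv] .
  have "of_bool (a = v) = (\<Sum>k\<in>W. B$a$k * N$k$v)" by (simp only: B_N_on[OF W a])
  also have "\<dots> = (\<Sum>k\<in>{u, v}. B$a$k * N$k$v)"
  proof (rule sum.mono_neutral_right)
    have "N$k$v = 0" if "k \<in> W" "k \<noteq> u" "k \<noteq> v" for k
    proof (rule ccontr)
      assume "N$k$v \<noteq> 0"
      then have "(k, v) \<in> cycle_edges vs" using root_cycle_N[OF rc mem(3)] that by blast
      then show False using cycle_edges_left_unique[OF root_cycleD(1)[OF rc]] uv that by blast
    qed
    then show "\<forall>i\<in>W - {u, v}. B$a$i * N$i$v = 0" by simp
  qed (use mem in auto)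
  also have "\<dots> = B$a$v - \<Lambda>$u$v * B$a$u" using ne by (simp add: N_offdiag)
  finally show ?thesis by simp
qed

text \<open>Iterating the recursion multiplies the weights of the edges passed; only the noise terms
  of the vertices passed after \<open>vs!i\<close> are added on the way.\<close>

lemma root_cycle_chain:
  assumes W: "terminal W" and rc: "root_cycle E W vs" and ij: "i \<le> j" "j < length vs"
  shows "\<exists>q. q \<noteq> 0 \<and> (\<forall>a\<in>W. a \<notin> (!) vs ` {i<..j} \<longrightarrow> B$a$(vs!j) = q * B$a$(vs!i))"
  using ij
proof (induction j rule: dec_induct)
  case base
  then show ?case by (intro exI[of _ 1]) simp
next
  case (step j)
  then obtain q where q: "q \<noteq> 0" "\<And>a. a \<in> W \<Longrightarrow> a \<notin> (!) vs ` {i<..j} \<Longrightarrow> B$a$(vs!j) = q * B$a$(vs!i)"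
    by auto
  have e: "(vs!j, vs!Suc j) \<in> cycle_edges vs" using step.prems by (rule cycle_edges_Suc)
  have "B$a$(vs!Suc j) = \<Lambda>$(vs!j)$(vs!Suc j) * q * B$a$(vs!i)"
    if "a \<in> W" "a \<notin> (!) vs ` {i<..Suc j}" for a
  proof -
    have "a \<notin> (!) vs ` {i<..j}" using that(2) by auto
    moreover have "a \<noteq> vs!Suc j" using that(2) step.hyps by auto
    ultimately show ?thesis
      using q(2)[OF that(1)] root_cycle_recursion[OF W rc e that(1)] by simp
  qed
  then show ?case
    using q(1) root_cycle_coeff_nz[OF rc e] by (intro exI[of _ "\<Lambda>$(vs!j)$(vs!Suc j) * q"]) auto
qed

text \<open>If \<open>B$a$a\<close> is nonzero, the chain starting at \<open>a\<close> carries this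
  around the cycle. If it were zero, the noise of \<open>a\<close> would be absent from the rest of
  the cycle too, and the closing edge would give \<open>B$a$a = 1\<close>.\<close>

lemma root_cycle_B_nz:
  assumes W: "terminal W" and rc: "root_cycle E W vs" and ab: "a \<in> set vs" "b \<in> set vs"
  shows "B$a$b \<noteq> 0"
proof -
  obtain k where k: "rotate k vs ! 0 = a" using ab(1) by (rule rotate_to_head)
  define us where "us = rotate k vs"
  have us: "root_cycle E W us" unfolding us_def by (rule root_cycle_rotate[OF rc])
  note D = root_cycleD[OF us]
  have len: "0 < length us" using D(2) by auto
  have a: "us ! 0 = a" "a \<in> W" using k ab root_cycleD(3)[OF rc] by (auto simp: us_def)
  have nz: "B$a$(us!j) \<noteq> 0" if j: "j < length us" and 0: "B$a$a \<noteq> 0" for j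
  proof -
    obtain q where q: "q \<noteq> 0" "\<And>x. x \<in> W \<Longrightarrow> x \<notin> (!) us ` {0<..j} \<Longrightarrow> B$x$(us!j) = q * B$x$(us!0)"
      using root_cycle_chain[OF W us _ j, of 0] by auto
    have "a \<notin> (!) us ` {0<..j}"
    proof
      assume "a \<in> (!) us ` {0<..j}"
      then obtain m where "0 < m" "m \<le> j" "us ! m = us ! 0" using a(1) by auto
      then show False using D(1) j len by (auto simp: nth_eq_iff_index_eq)
    qed
    then show ?thesis using q a 0 by simp
  qed
  have "B$a$a \<noteq> 0"
  proof
    assume 0: "B$a$a = 0"
    define l where "l = length us - 1"
    have l: "l < length us" using len by (simp add: l_def)
    obtain q where q: "\<And>x. x \<in> W \<Longrightarrow> x \<notin> (!) us ` {0<..l} \<Longrightarrow> B$x$(us!l) = q * B$x$(us!0)"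
      using root_cycle_chain[OF W us _ l, of 0] by auto
    have "a \<notin> (!) us ` {0<..l}"
    proof
      assume "a \<in> (!) us ` {0<..l}"
      then obtain m where "0 < m" "m \<le> l" "us ! m = us ! 0" using a(1) by auto
      then show False using D(1) l len by (auto simp: nth_eq_iff_index_eq)
    qed
    then have "B$a$(us!l) = 0" using q[of a] a 0 by simp
    moreover have "(us!l, a) \<in> cycle_edges us"
      using cycle_edges_last[OF D(6)] D(6) a by (simp add: last_conv_nth hd_conv_nth l_def)
    ultimately show False using root_cycle_recursion[OF W us _ a(2)] 0 by fastforce
  qed
  moreover obtain j where "j < length us" "us ! j = b"
    using ab(2) by (metis in_set_conv_nth set_rotate us_def)
  ultimately show ?thesis using nz by blast
qed

text \<open>Noise of the vertices after \<open>u\<close> up to \<open>v\<close> reaches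
  \<open>u\<close> only through \<open>v\<close>, with ratio \<open>p\<close>; all other noise
  reaches \<open>v\<close> only through \<open>u\<close>, with ratio \<open>q\<close>.\<close>

lemma root_cycle_two_directions:
  assumes W: "terminal W" and rc: "root_cycle E W vs" and uv: "u \<in> set vs" "v \<in> set vs"
  obtains p q where "\<And>a. a \<in> W \<Longrightarrow> B$a$v = q * B$a$u \<or> B$a$u = p * B$a$v"
proof -
  obtain k where k: "rotate k vs ! 0 = u" using uv(1) by (rule rotate_to_head)
  define us where "us = rotate k vs"
  have us: "root_cycle E W us" unfolding us_def by (rule root_cycle_rotate[OF rc])
  note D = root_cycleD[OF us]
  obtain j where j: "j < length us" "us ! j = v"
    using uv(2) by (metis in_set_conv_nth set_rotate us_def)
  define l where "l = length us - 1"
  have l: "l < length us" "j \<le> l" using j by (auto simp: l_def)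
  have u: "us ! 0 = u" using k by (simp add: us_def)
  have last: "(us!l, u) \<in> cycle_edges us"
    using cycle_edges_last[OF D(6)] D(6) u by (simp add: last_conv_nth hd_conv_nth l_def)
  obtain q where q: "\<And>a. a \<in> W \<Longrightarrow> a \<notin> (!) us ` {0<..j} \<Longrightarrow> B$a$v = q * B$a$u"
    using root_cycle_chain[OF W us _ j(1), of 0] j u by auto
  obtain p where p: "\<And>a. a \<in> W \<Longrightarrow> a \<notin> (!) us ` {j<..l} \<Longrightarrow> B$a$(us!l) = p * B$a$v"
    using root_cycle_chain[OF W us l(2,1)] j by auto
  have p': "B$a$u = (\<Lambda>$(us!l)$u * p) * B$a$v" if aW: "a \<in> W" and am: "a \<in> (!) us ` {0<..j}" for a
  proof -
    obtain m where m: "0 < m" "m \<le> j" "a = us ! m" using am by auto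
    have "a \<notin> (!) us ` {j<..l}"
    proof
      assume "a \<in> (!) us ` {j<..l}"
      then obtain m' where "j < m'" "m' \<le> l" "us ! m' = us ! m" using m(3) by auto
      then show False using D(1) l m by (auto simp: nth_eq_iff_index_eq)
    qed
    moreover have "m < length us" "0 < length us" using m j(1) by auto
    then have "a \<noteq> u" using m D(1) by (auto simp: nth_eq_iff_index_eq simp flip: u)
    ultimately show ?thesis
      using p[OF aW] root_cycle_recursion[OF W us last aW] by simp
  qed
  show ?thesis
    by (rule that[of q "\<Lambda>$(us!l)$u * p"]) (use q p' in blast)
qed

end

section \<open>Which vertex sets pass the tests for root cycles\<close>

context lsem_generic
begin

text \<open>Otherwise columns \<open>u\<close> and \<open>v\<close> of \<open>B\<close> would be
  proportional on all of \<open>W\<close>, and multiplying by row \<open>v\<close> of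
  \<open>N\<close> would give \<open>1 = 0\<close>.\<close>

lemma root_cycle_d22_nz:
  assumes W: "terminal W" and rc: "root_cycle E W vs" and uv: "u \<in> set vs" "v \<in> set vs" "u \<noteq> v"
  shows "d22 (S0 W) (T0 W) u v \<noteq> 0"
proof
  assume d: "d22 (S0 W) (T0 W) u v = 0"
  note D = root_cycleD[OF rc]
  have uW: "u \<in> W" "v \<in> W" using uv D(3) by auto
  define r where "r = S0 W$u$v / S0 W$u$u"
  have "B$b$v = r * B$b$u" if "b \<in> W" for b
  proof (cases "b \<in> set vs")
    case True
    then show ?thesis
      using d22_zero_imp_proportional[OF W uW(1) d that] root_cycle_B_nz[OF W rc _ uv(1)]
      by (simp add: r_def)
  next
    case False
    then show ?thesis using B_entering[OF W D(4) that] uv by simp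
  qed
  then have "(\<Sum>b\<in>W. N$v$b * B$b$v) = (\<Sum>b\<in>W. r * (N$v$b * B$b$u))"
    by (intro sum.cong) auto
  also have "\<dots> = r * (\<Sum>b\<in>W. N$v$b * B$b$u)" by (simp only: sum_distrib_left)
  finally show False unfolding N_B_on[OF W uW(2)] using uv(3) by simp
qed

lemma root_cycle_d33_zero:
  assumes "terminal W" "root_cycle E W vs" "u \<in> set vs" "v \<in> set vs"
  shows "d33 (S0 W) (T0 W) u v = 0"
  using root_cycle_two_directions[OF assms] d33_zero_of_two_directions by metis

text \<open>Third moments concentrated on two noise terms are used: \<open>b\<close> on the cycle,
  and \<open>c\<close> entering \<open>X\<^sub>w\<close> but not \<open>X\<^sub>u\<close>. There
  \<open>d33\<close> is, up to nonzero factors, \<open>S0 W$u$u * B$b$w - S0 W$u$w * B$b$u\<close>,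
  and its vanishing for all \<open>b\<close> forces \<open>d22\<close> to vanish. So no
  \<open>cycle_like\<close> set reaches beyond a root cycle that it contains.\<close>

lemma root_cycle_outside:
  assumes W: "terminal W" and rc: "root_cycle E W vs" and u: "u \<in> set vs" and w: "w \<in> W" "w \<notin> set vs"
    and d33: "d33 (S0 W) (T0 W) u w = 0"
  shows "d22 (S0 W) (T0 W) u w = 0"
proof -
  note D = root_cycleD[OF rc]
  have zero: "B$a$u = 0" if "a \<in> W" "a \<notin> set vs" for a
    using B_entering[OF W D(4) that u] .
  \<comment> \<open>If only noise of the cycle entered \<open>X\<^sub>w\<close>, row
    \<open>w\<close> of \<open>N\<close>, which has no entries on the cycle, would annihilate column
    \<open>w\<close> of \<open>B\<close>.\<close>
  have "\<exists>c\<in>W - set vs. B$c$w \<noteq> 0"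
  proof (rule ccontr)
    assume *: "\<not> ?thesis"
    have "N$w$k * B$k$w = 0" if "k \<in> W" for k
      using * that N_entering[OF D(4) w] by (cases "k \<in> set vs") auto
    then have "(\<Sum>k\<in>W. N$w$k * B$k$w) = 0" by (intro sum.neutral) blast
    then show False using N_B_on[OF W w(1), of w] by simp
  qed
  then obtain c where c: "c \<in> W" "c \<notin> set vs" "B$c$w \<noteq> 0" by blast
  have ratio: "S0 W$u$u * B$b$w = S0 W$u$w * B$b$u" if b: "b \<in> W" "b \<in> set vs" for b
  proof -
    have "d33 (S0 W) (third_of W B (axis b 1 + axis c 1)) u w = 0"
      using generic[OF moment_testsI(2)] d33 by blast
    then have "(B$c$w)^3 * (B$b$u)\<^sup>2 * (S0 W$u$u * B$b$w - S0 W$u$w * B$b$u) = 0"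
      unfolding d33_eq third_of_add third_of_axis[OF b(1)] third_of_axis[OF c(1)] zero[OF c(1,2)]
      by (simp add: power2_eq_square power3_eq_cube algebra_simps)
    then show ?thesis using c(3) root_cycle_B_nz[OF W rc b(2) u] by simp
  qed
  have "S0 W$u$u * T0 W$u$u$w = S0 W$u$w * T0 W$u$u$u"
    unfolding T0_nth sum_distrib_left
  proof (intro sum.cong refl)
    fix a assume a: "a \<in> W"
    show "S0 W$u$u * (B$a$u * B$a$u * B$a$w * w3$a) = S0 W$u$w * (B$a$u * B$a$u * B$a$u * w3$a)"
    proof (cases "a \<in> set vs")
      case True
      have "S0 W$u$u * (B$a$u * B$a$u * B$a$w * w3$a) = (S0 W$u$u * B$a$w) * (B$a$u * B$a$u * w3$a)"
        by (simp only: mult_ac)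
      then show ?thesis unfolding ratio[OF a True] by (simp only: mult_ac)
    qed (simp add: zero[OF a])
  qed
  then show ?thesis by (simp add: d22_def)
qed

lemma agrees_cycle_like:
  assumes "agrees W S T" "C \<subseteq> W"
  shows "cycle_like S T C \<longleftrightarrow> cycle_like (S0 W) (T0 W) C"
proof -
  have "d22 S T u v = d22 (S0 W) (T0 W) u v" "d33 S T u v = d33 (S0 W) (T0 W) u v"
    if "u \<in> C" "v \<in> C" for u v
    using agrees_d22[OF assms(1)] agrees_d33[OF assms(1)] assms(2) that by blast+
  then show ?thesis unfolding cycle_like_def by simp
qed

lemma cycle_like_root_cycle:
  assumes "terminal W" "root_cycle E W vs" "agrees W S T"
  shows "cycle_like S T (set vs)"
proof -
  have "cycle_like (S0 W) (T0 W) (set vs)"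
    unfolding cycle_like_def
  proof (intro ballI impI conjI)
    fix u v assume "u \<in> set vs" "v \<in> set vs" "u \<noteq> v"
    then show "d33 (S0 W) (T0 W) u v = 0" "d22 (S0 W) (T0 W) u v \<noteq> 0"
      using root_cycle_d22_nz[OF assms(1,2)] root_cycle_d33_zero[OF assms(1,2)] by simp_all
  qed
  then show ?thesis using agrees_cycle_like[OF assms(3) root_cycleD(3)[OF assms(2)]] by simp
qed

lemma cycle_like_superset:
  assumes "terminal W" "root_cycle E W vs" "agrees W S T" "cycle_like S T C" "C \<subseteq> W" "set vs \<subseteq> C"
  shows "C = set vs"
proof (rule ccontr)
  assume "C \<noteq> set vs"
  then obtain w where w: "w \<in> C" "w \<notin> set vs" using assms(6) by blast
  obtain u where u: "u \<in> set vs" using root_cycleD(6)[OF assms(2)] by (meson last_in_set)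
  have "cycle_like (S0 W) (T0 W) C" using agrees_cycle_like assms(3-5) by blast
  moreover have "u \<in> C" "u \<noteq> w" using u w assms(6) by auto
  ultimately have "d33 (S0 W) (T0 W) u w = 0" "d22 (S0 W) (T0 W) u w \<noteq> 0"
    using w(1) unfolding cycle_like_def by blast+
  then show False using root_cycle_outside[OF assms(1,2) u _ w(2)] w(1) assms(5) by blast
qed

text \<open>Singletons are \<open>cycle_like\<close> for lack of pairs, so every vertex lies in a
  maximal set. Comparing \<open>C\<close> with all other candidates thus tests every vertex outside
  \<open>C\<close>.\<close>

lemma candidate_containing:
  assumes "d \<in> W"
  obtains D where "D \<in> candidates W S T" "d \<in> D"
proof -
  define P where "P D \<longleftrightarrow> d \<in> D \<and> D \<subseteq> W \<and> cycle_like S T D" for D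
  have "P {d}" using assms by (simp add: P_def cycle_like_def)
  moreover have "card D < Suc (card W)" if "P D" for D
    using that by (simp add: P_def card_mono le_imp_less_Suc)
  ultimately obtain D where D: "P D" and max: "\<And>D'. P D' \<Longrightarrow> card D' \<le> card D"
    using ex_has_greatest_nat[of P "{d}" card "Suc (card W)"] by blast
  have "\<not> cycle_like S T D'" if "D \<subset> D'" "D' \<subseteq> W" for D'
    using that D max[of D'] psubset_card_mono[of D' D] by (auto simp: P_def)
  then show ?thesis using that[of D] D by (auto simp: P_def candidates_def)
qed

lemma agrees_residual_test:
  assumes "agrees W S T" "C \<subseteq> W" "c \<in> W" "d \<in> W"
  shows "residual_test S T C c d = residual_test (S0 W) (T0 W) C c d"
  unfolding residual_test_def agrees_resid[OF assms(1,2,4)]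
  using assms agreesD(2)[OF assms(1)] by (intro resid_cong) auto

text \<open>Residuals given a root cycle contain none of its noise, and only that noise enters the
  squared factor. Conversely, identical vanishing, evaluated at one noise term, yields the linear
  relations that make a candidate parent-closed; it then contains a root cycle and equals it by
  \<open>cycle_like_superset\<close>.\<close>

lemma root_cycles_eq:
  assumes W: "terminal W" and ST: "agrees W S T" and ne: "W \<noteq> {}"
    and parent: "\<And>r. r \<in> W \<Longrightarrow> \<exists>p\<in>W. (p, r) \<in> E"
  shows "root_cycles W S T = {set vs |vs. root_cycle E W vs}"
proof (intro set_eqI iffI)
  fix C assume "C \<in> {set vs |vs. root_cycle E W vs}"
  then obtain vs where C: "C = set vs" and rc: "root_cycle E W vs" by blast
  note D = root_cycleD[OF rc]
  have "C \<in> candidates W S T"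
    unfolding candidates_def C
    using cycle_like_root_cycle[OF W rc ST] cycle_like_superset[OF W rc ST] D(3) by auto
  moreover have "residual_test S T C c d = 0" if "c \<in> C" "d \<in> W" for c d
  proof -
    have cW: "c \<in> W" using that D(3) C by auto
    have "residual_test S T C c d = residual_test (S0 W) (T0 W) C c d"
      using agrees_residual_test[OF ST _ cW that(2)] D(3) C by blast
    also have "\<dots> = resid C (S0 W) d (\<lambda>a. \<Sum>k\<in>W. (B$k$c * B$k$c * w3$k) * B$k$a)"
      unfolding residual_test_def by (intro resid_cong) (simp_all add: T0_nth mult_ac)
    also have "\<dots> = (\<Sum>k\<in>W - C. (B$k$c * B$k$c * w3$k) * B$k$d)"
      using resid_S0[OF W D(4,3) that(2)] by (simp add: C)
    also have "\<dots> = 0"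
      using B_entering[OF W D(4)] that(1) by (intro sum.neutral) (auto simp: C)
    finally show ?thesis .
  qed
  ultimately show "C \<in> root_cycles W S T"
    unfolding root_cycles_def residual_test_def resid_def by (auto simp: candidates_def)
next
  fix C assume C: "C \<in> root_cycles W S T"
  then have cand: "C \<subseteq> W" "cycle_like S T C" "\<And>D. C \<subset> D \<Longrightarrow> D \<subseteq> W \<Longrightarrow> \<not> cycle_like S T D"
    by (auto simp: root_cycles_def candidates_def)
  have test: "residual_test (S0 W) (T0 W) C c d = 0" if "c \<in> C" "d \<in> W" "d \<notin> C" for c d
  proof -
    obtain D where D: "D \<in> candidates W S T" "d \<in> D" using candidate_containing[OF \<open>d \<in> W\<close>] by blast
    then have "D \<noteq> C" using \<open>d \<notin> C\<close> by auto
    then have "residual_test S T C c d = 0"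
      using C D that(1) unfolding root_cycles_def residual_test_def resid_def by blast
    then show ?thesis using agrees_residual_test[OF ST cand(1)] that cand(1) by (metis subsetD)
  qed
  have closed: "parent_closed E W C"
  proof (rule parent_closed_of_linear_relations[OF W cand(1), where R = "regression (S0 W) C"])
    fix b c d assume b: "b \<in> W" "c \<in> C" "d \<in> W - C" "B$b$c \<noteq> 0"
    then have "residual_test (S0 W) (third_of W B (axis b 1)) C c d = 0"
      using generic[OF moment_testsI(3) test] by blast
    then have "resid C (S0 W) d (\<lambda>a. (B$b$c * B$b$c) * B$b$a) = 0"
      by (simp add: residual_test_def third_of_axis[OF b(1)])
    then have "resid C (S0 W) d (\<lambda>a. B$b$a) = 0"
      unfolding resid_mult using b(4) by simp
    then show "B$b$d = (\<Sum>a\<in>C. regression (S0 W) C d a * B$b$a)" by (simp add: resid_def)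
  qed
  have "C \<noteq> {}"
  proof
    assume "C = {}"
    moreover obtain d where "d \<in> W" using ne by blast
    ultimately show False using cand(3)[of "{d}"] by (auto simp: cycle_like_def)
  qed
  then obtain vs where rc: "root_cycle E W vs" "set vs \<subseteq> C"
    using root_cycle_exists[OF irrefl acyc cand(1) _ closed] parent cand(1) by blast
  then show "C \<in> {set vs |vs. root_cycle E W vs}"
    using cycle_like_superset[OF W rc(1) ST cand(2,1) rc(2)] by blast
qed

end

section \<open>Orientations and weights of a root cycle\<close>

lemma sum_shift:
  fixes f g h :: "'n \<Rightarrow> real"
  assumes "\<And>a. a \<in> W \<Longrightarrow> g a = l * h a + \<kappa> * of_bool (a = b)" and "b \<in> W" "finite W"
  shows "(\<Sum>a\<in>W. g a * f a) = l * (\<Sum>a\<in>W. h a * f a) + \<kappa> * f b"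
proof -
  have "(\<Sum>a\<in>W. g a * f a) = (\<Sum>a\<in>W. l * (h a * f a) + (if a = b then \<kappa> * f b else 0))"
    using assms(1) by (intro sum.cong) (auto simp: algebra_simps)
  then show ?thesis using assms(2,3) by (simp add: sum.distrib flip: sum_distrib_left)
qed

text \<open>The hypothesis says \<open>X\<^sub>v = l X\<^sub>u + \<kappa> \<epsilon>\<^sub>b\<close>
  for the noise terms of \<open>W\<close>; substituting this in the last index adds the contribution
  of the noise term \<open>b\<close> alone.\<close>

lemma moments_shift:
  fixes B :: "real^'n::finite^'n"
  assumes "\<And>a. a \<in> W \<Longrightarrow> B$a$v = l * B$a$u + \<kappa> * of_bool (a = b)" and "b \<in> W"
  shows "second_of W B w$j$v = l * second_of W B w$j$u + \<kappa> * (B$b$j * w$b)"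
    and "third_of W B w$i$j$v = l * third_of W B w$i$j$u + \<kappa> * (B$b$i * B$b$j * w$b)"
  using sum_shift[OF assms(1,2), of "\<lambda>a. B$a$j * w$a"] sum_shift[OF assms(1,2), of "\<lambda>a. B$a$i * B$a$j * w$a"]
  by (simp_all add: second_of_def third_of_def mult_ac)

lemma second_of_commute: "second_of W B w$i$j = second_of W B w$j$i"
  by (simp add: second_of_def mult.commute)

lemma third_of_commute:
  "third_of W B w$i$j$k = third_of W B w$j$i$k" "third_of W B w$i$j$k = third_of W B w$i$k$j"
  by (simp_all add: third_of_def mult_ac)

lemma orient_det_eq:
  "orient_det S T u v w =
     S$u$u * (T$u$u$w * T$v$v$w - T$u$v$w * T$u$v$w) - S$u$w * (T$u$u$u * T$v$v$w - T$u$u$v * T$u$v$w)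
     + S$v$w * (T$u$u$u * T$u$v$w - T$u$u$v * T$u$u$w)"
  unfolding orient_det_def det_transpose unfolding det_3 by (simp add: vector_3 algebra_simps)

lemma weight_linear_eq:
  "weight_linear S T u v w l \<longleftrightarrow> orient_det S T u v w * l =
     S$u$v * (T$u$u$w * T$v$v$w - T$u$v$w * T$u$v$w) - S$u$w * (T$u$u$v * T$v$v$w - T$u$v$v * T$u$v$w)
     + S$v$w * (T$u$u$v * T$u$v$w - T$u$v$v * T$u$u$w)"
  unfolding weight_linear_def orient_det_def Let_def det_transpose unfolding det_3
  by (simp add: vector_3 algebra_simps)

text \<open>With \<open>X\<^sub>v = l X\<^sub>u + \<kappa> \<epsilon>\<^sub>b\<close>, both \<open>a\<^sub>2 - l a\<^sub>1\<close> and \<open>a\<^sub>5 - l a\<^sub>4\<close> are multiples of the moments of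
  \<open>\<epsilon>\<^sub>b\<close> against \<open>(1, X\<^sub>u, X\<^sub>v)\<close>.\<close>

lemma weight_linear_solution:
  fixes B :: "real^'n::finite^'n"
  assumes "\<And>a. a \<in> W \<Longrightarrow> B$a$v = l * B$a$u + \<kappa> * of_bool (a = b)" and "b \<in> W"
  shows "weight_linear (second_of W B w2) (third_of W B w3) u v w l"
proof -
  define S where "S = second_of W B w2"
  define T where "T = third_of W B w3"
  have s: "S$j$v = l * S$j$u + \<kappa> * (B$b$j * w2$b)" for j
    unfolding S_def by (rule moments_shift(1)[OF assms])
  have t: "T$i$j$v = l * T$i$j$u + \<kappa> * (B$b$i * B$b$j * w3$b)" for i j
    unfolding T_def by (rule moments_shift(2)[OF assms])
  have comm: "S$i$j = S$j$i" "T$i$j$k = T$j$i$k" "T$i$j$k = T$i$k$j" for i j k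
    unfolding S_def T_def using second_of_commute third_of_commute by metis+
  have "S$u$v = l * S$u$u + \<kappa> * (B$b$u * w2$b)" "S$v$w = l * S$u$w + \<kappa> * (B$b$w * w2$b)"
    "T$u$v$v = l * T$u$u$v + \<kappa> * (B$b$u * B$b$v * w3$b)"
    "T$v$v$w = l * T$u$v$w + \<kappa> * (B$b$v * B$b$w * w3$b)"
    using s t comm by metis+
  moreover have "T$u$u$v = l * T$u$u$u + \<kappa> * (B$b$u * B$b$u * w3$b)"
    "T$u$v$w = l * T$u$u$w + \<kappa> * (B$b$u * B$b$w * w3$b)"
    using t comm by metis+
  ultimately show ?thesis
    unfolding weight_linear_eq orient_det_eq S_def[symmetric] T_def[symmetric]
    by (simp only:) (simp add: algebra_simps)
qed

text \<open>The determinant for third moments concentrated on the noise terms \<open>b\<close> and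
  \<open>d\<close> of \<open>orient_det_nonzero\<close>: \<open>x\<close>, \<open>y\<close>,
  \<open>r\<close>, \<open>e\<close> are \<open>B$b$u\<close>, \<open>B$b$v\<close>,
  \<open>B$d$u\<close>, \<open>B$c$u\<close>; \<open>w\<close> and \<open>z\<close> are the
  variances of \<open>b\<close> and \<open>c\<close>; \<open>l\<close> and \<open>m\<close> are the
  weights of the two edges. Everything cancels except one monomial.\<close>

lemma orient_det_special:
  fixes s x r l m k k' e w z y :: real
  assumes "y = l * x + k"
    and "suv = l * s + k * x * w" "svv = l * suv + k * y * w"
    and "suw = m * suv + k' * e * z" "svw = m * svv + k' * (l * e) * z"
  shows "s * ((x * x * (m * y) + r * r * (m * (l * r))) * (y * y * (m * y) + (l * r) * (l * r) * (m * (l * r)))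
        - (x * y * (m * y) + r * (l * r) * (m * (l * r))) * (x * y * (m * y) + r * (l * r) * (m * (l * r))))
      - suw * ((x * x * x + r * r * r) * (y * y * (m * y) + (l * r) * (l * r) * (m * (l * r)))
        - (x * x * y + r * r * (l * r)) * (x * y * (m * y) + r * (l * r) * (m * (l * r))))
      + svw * ((x * x * x + r * r * r) * (x * y * (m * y) + r * (l * r) * (m * (l * r)))
        - (x * x * y + r * r * (l * r)) * (x * x * (m * y) + r * r * (m * (l * r))))
    = - (k * k * k' * e * m * y * r * r * r * z)"
  unfolding assms by (simp add: algebra_simps)

text \<open>Three noise terms act together: \<open>b\<close> and \<open>d\<close> come in through
  the third moments, \<open>c\<close> through the covariances with \<open>w\<close>.\<close>

lemma orient_det_nonzero:
  fixes B :: "real^'n::finite^'n"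
  assumes y: "\<And>a. a \<in> W \<Longrightarrow> B$a$v = l * B$a$u + k * of_bool (a = b)"
    and z: "\<And>a. a \<in> W \<Longrightarrow> B$a$w = m * B$a$v + k' * of_bool (a = c)"
    and mem: "b \<in> W" "c \<in> W" "d \<in> W" "b \<noteq> c" "b \<noteq> d" "c \<noteq> d"
    and nz: "k \<noteq> 0" "k' \<noteq> 0" "m \<noteq> 0" "B$c$u \<noteq> 0" "B$b$v \<noteq> 0" "B$d$u \<noteq> 0" "w2$c \<noteq> 0"
  shows "orient_det (second_of W B w2) (third_of W B (axis b 1 + axis d 1)) u v w \<noteq> 0"
proof -
  define S where "S = second_of W B w2"
  have v: "B$b$v = l * B$b$u + k" "B$d$v = l * B$d$u" "B$c$v = l * B$c$u"
    using y mem by auto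
  have w: "B$b$w = m * B$b$v" "B$d$w = m * B$d$v" using z mem by auto
  have s: "S$u$v = l * S$u$u + k * B$b$u * w2$b" "S$v$v = l * S$u$v + k * B$b$v * w2$b"
    "S$u$w = m * S$u$v + k' * B$c$u * w2$c" "S$v$w = m * S$v$v + k' * (l * B$c$u) * w2$c"
    using moments_shift(1)[OF y mem(1), of w2] moments_shift(1)[OF z mem(2), of w2] v(3)
      second_of_commute[of W B w2 u v]
    by (simp_all add: S_def mult.assoc)
  have "orient_det S (third_of W B (axis b 1 + axis d 1)) u v w =
      - (k * k * k' * B$c$u * m * B$b$v * B$d$u * B$d$u * B$d$u * w2$c)"
    unfolding orient_det_eq third_of_add third_of_axis[OF mem(1)] third_of_axis[OF mem(3)] w v(2)
    by (rule orient_det_special[OF v(1) s])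
  then show ?thesis using nz by (simp add: S_def)
qed

text \<open>Multiplied by \<open>B$v$u\<close>, the quadratic factors as
  \<open>(l - t) * (B$v$v - t * B$v$u) * d22 S T u v\<close>. On a 2-cycle the second root is the
  inverse of the weight of the opposite edge.\<close>

lemma weight_quadratic_roots:
  fixes B :: "real^'n::finite^'n"
  assumes y: "\<And>a. a \<in> W \<Longrightarrow> B$a$v = l * B$a$u + of_bool (a = v)" and v: "v \<in> W"
    and x: "B$v$u \<noteq> 0" and d: "d22 (second_of W B w2) (third_of W B w3) u v \<noteq> 0"
  shows "weight_quadratic (second_of W B w2) (third_of W B w3) u v t \<longleftrightarrow> t = l \<or> t * B$v$u = B$v$v"
proof -
  define S where "S = second_of W B w2"
  define T where "T = third_of W B w3"
  note shift = moments_shift[where \<kappa> = 1 and b = v, simplified, OF y v]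
  have "S$u$v = l * S$u$u + B$v$u * w2$v" "S$v$v = l * S$u$v + B$v$v * w2$v"
    "T$u$u$v = l * T$u$u$u + B$v$u * B$v$u * w3$v" "T$u$v$v = l * T$u$u$v + B$v$u * B$v$v * w3$v"
    using shift(1)[of w2 u] shift(1)[of w2 v] shift(2)[of w3 u u] shift(2)[of w3 u v]
      second_of_commute[of W B w2 u v] third_of_commute(2)[of W B w3 u v u]
    by (simp_all add: S_def T_def mult.assoc)
  then have "B$v$u * ((S$u$u * T$u$u$v - S$u$v * T$u$u$u) * t\<^sup>2 + (S$v$v * T$u$u$u - S$u$u * T$u$v$v) * t
       + S$u$v * T$u$v$v - S$v$v * T$u$u$v) = (l - t) * (B$v$v - t * B$v$u) * d22 S T u v"
    unfolding d22_def by (simp only:) (simp add: algebra_simps power2_eq_square)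
  then show ?thesis
    using x d unfolding weight_quadratic_def S_def[symmetric] T_def[symmetric]
    by (metis (no_types, lifting) eq_iff_diff_eq_0 mult_eq_0_iff)
qed

lemma invertible_one_minus_2_cycle:
  fixes L :: "real^'n::finite^'n"
  assumes ab: "a \<noteq> b" and L: "\<And>i j. (i, j) \<noteq> (a, b) \<Longrightarrow> (i, j) \<noteq> (b, a) \<Longrightarrow> L$i$j = 0"
  shows "invertible (mat 1 - L) \<longleftrightarrow> L$a$b * L$b$a \<noteq> 1"
proof -
  have Lx: "(L *v x)$i = (if i = a then L$a$b * x$b else if i = b then L$b$a * x$a else 0)" for x i
  proof -
    have "(L *v x)$i = (\<Sum>j\<in>{a, b}. L$i$j * x$j)"
      unfolding matrix_vector_mult_def vec_lambda_beta
      using L[of i] by (intro sum.mono_neutral_right) auto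
    then show ?thesis using ab L[of i a] L[of i b] by auto
  qed
  have "invertible (mat 1 - L) \<longleftrightarrow> (\<forall>x. (mat 1 - L) *v x = 0 \<longrightarrow> x = 0)"
    unfolding invertible_left_inverse matrix_left_invertible_ker ..
  also have "\<dots> \<longleftrightarrow> (\<forall>x. x = L *v x \<longrightarrow> x = 0)"
    by (simp add: matrix_vector_mult_diff_rdistrib)
  also have "\<dots> \<longleftrightarrow> L$a$b * L$b$a \<noteq> 1"
  proof (intro iffI allI impI notI)
    assume *: "\<forall>x. x = L *v x \<longrightarrow> x = 0" and 1: "L$a$b * L$b$a = 1"
    define x :: "real^'n" where "x = (\<chi> i. if i = a then L$a$b else if i = b then 1 else 0)"
    have "x = L *v x" using ab 1 by (simp add: vec_eq_iff Lx) (simp add: x_def mult.commute)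
    then have "x = 0" using * by blast
    then have "x$b = 0" by simp
    then show False using ab by (simp add: x_def)
  next
    fix x assume ne: "L$a$b * L$b$a \<noteq> 1" and x: "x = L *v x"
    have a: "x$a = L$a$b * x$b" and b: "x$b = L$b$a * x$a" and 0: "\<And>i. i \<noteq> a \<Longrightarrow> i \<noteq> b \<Longrightarrow> x$i = 0"
      using x Lx[of x] ab by metis+
    have "(1 - L$a$b * L$b$a) * x$a = 0" using a b by (simp add: algebra_simps)
    then have "x$a = 0" using ne by simp
    then have "x$i = 0" for i using b 0 by (cases "i = a"; cases "i = b") auto
    then show "x = 0" by (simp add: vec_eq_iff)
  qed
  finally show ?thesis .
qed

text \<open>Shifting the noise terms along a cycle reverses its orientation.\<close>

definition orient_perm :: "'n list \<Rightarrow> ('n \<Rightarrow> 'n) \<Rightarrow> bool" where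
  "orient_perm vs \<pi> \<longleftrightarrow> \<pi> = id \<or> \<pi> permutes set vs \<and> (\<forall>j\<in>set vs. (j, \<pi> j) \<in> cycle_edges vs)"

text \<open>On a 2-cycle both cases give the same edges, so there the permutation shows in the
  weights only.\<close>

definition perm_edges :: "'n list \<Rightarrow> ('n \<Rightarrow> 'n) \<Rightarrow> 'n digraph" where
  "perm_edges vs \<pi> = (if \<pi> = id then cycle_edges vs else (cycle_edges vs)\<inverse>)"

lemma orient_perm_permutes: "orient_perm vs \<pi> \<Longrightarrow> \<pi> permutes set vs"
  by (auto simp: orient_perm_def permutes_id)

lemma successor_permutation:
  assumes "distinct vs"
  obtains \<pi> where "\<pi> permutes set vs" "\<And>j. j \<in> set vs \<Longrightarrow> (j, \<pi> j) \<in> cycle_edges vs"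
proof -
  define \<pi> where "\<pi> j = (if j \<in> set vs then SOME k. (j, k) \<in> cycle_edges vs else j)" for j
  have e: "(j, \<pi> j) \<in> cycle_edges vs" if j: "j \<in> set vs" for j
  proof -
    obtain k where "(j, k) \<in> cycle_edges vs" using cycle_edges_out[OF j] by blast
    then have "(j, SOME k. (j, k) \<in> cycle_edges vs) \<in> cycle_edges vs" by (rule someI)
    then show ?thesis using j by (simp add: \<pi>_def)
  qed
  have "inj_on \<pi> (set vs)"
  proof (rule inj_onI)
    fix i j assume ij: "i \<in> set vs" "j \<in> set vs" "\<pi> i = \<pi> j"
    then have "(i, \<pi> j) \<in> cycle_edges vs" using e[of i] by simp
    then show "i = j" using cycle_edges_left_unique[OF assms] e[OF ij(2)] by blast
  qed
  moreover have "\<pi> ` set vs \<subseteq> set vs" using cycle_edges_set(2)[OF e] by blast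
  ultimately have "bij_betw \<pi> (set vs) (set vs)"
    by (simp add: bij_betw_def endo_inj_surj)
  then have "\<pi> permutes set vs" by (rule bij_imp_permutes) (simp add: \<pi>_def)
  then show ?thesis using e that by blast
qed

lemma perm_edges_set: "(u, v) \<in> perm_edges vs \<pi> \<Longrightarrow> u \<in> set vs \<and> v \<in> set vs"
  by (auto simp: perm_edges_def dest: cycle_edges_set split: if_splits)

lemma perm_edges_out:
  assumes "u \<in> set vs"
  obtains v where "(u, v) \<in> perm_edges vs \<pi>"
  using cycle_edges_in[OF assms] cycle_edges_out[OF assms] by (metis converse_iff perm_edges_def)

lemma perm_edges_neq:
  assumes "distinct vs" "2 \<le> length vs" "(u, v) \<in> perm_edges vs \<pi>"
  shows "u \<noteq> v"
  using assms cycle_edges_irrefl unfolding perm_edges_def by (metis converse_iff)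

context lsem_coeffs
begin

lemma reparam_nth: "reparam \<Lambda> \<pi>$i$j = of_bool (i = j) - N$i$\<pi> j / N$j$\<pi> j"
  by (simp add: reparam_def N_def)

lemma reparam_id: "reparam \<Lambda> id = \<Lambda>"
proof -
  have "reparam \<Lambda> id$i$j = \<Lambda>$i$j" for i j
    using N_diag by (simp add: reparam_nth del: N_diag) (simp add: N_def mat_1_nth)
  then show ?thesis by (simp add: vec_eq_iff)
qed

text \<open>Within the cycle, column \<open>\<pi> j\<close> of \<open>N\<close> has entries only in
  rows \<open>j\<close> and \<open>\<pi> j\<close>. For the successor permutation the former becomes
  the unit diagonal and the latter an edge from \<open>\<pi> j\<close> to \<open>j\<close>.\<close>

lemma reparam_support:
  assumes rc: "root_cycle E W vs" and \<pi>: "orient_perm vs \<pi>" and ij: "i \<in> set vs" "j \<in> set vs"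
  shows "reparam \<Lambda> \<pi>$i$j \<noteq> 0 \<longleftrightarrow> (i, j) \<in> perm_edges vs \<pi>"
proof (cases "\<pi> = id")
  case True
  have "\<Lambda>$i$j \<noteq> 0 \<longleftrightarrow> (i, j) \<in> cycle_edges vs"
  proof (cases "i = j")
    case True
    then show ?thesis using N_diag[of i] root_cycle_edge_neq[OF rc] by (auto simp: N_def mat_1_nth)
  next
    case False
    have "i \<in> W" using ij root_cycleD(3)[OF rc] by auto
    then show ?thesis
      using root_cycle_coeff_nz[OF rc] root_cycle_N[OF rc ij(2)] False N_offdiag[OF False] by fastforce
  qed
  then show ?thesis using True by (simp add: reparam_id perm_edges_def)
next
  case False
  then have \<pi>: "\<pi> permutes set vs" "\<And>j. j \<in> set vs \<Longrightarrow> (j, \<pi> j) \<in> cycle_edges vs"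
    using \<pi> by (auto simp: orient_perm_def)
  have e: "(j, \<pi> j) \<in> cycle_edges vs" using \<pi> ij by blast
  have nz: "N$j$\<pi> j \<noteq> 0" using root_cycleD(5)[OF rc e] N_nz by auto
  have F: "(i, j) \<in> perm_edges vs \<pi> \<longleftrightarrow> i = \<pi> j"
  proof
    assume "(i, j) \<in> perm_edges vs \<pi>"
    then have "(j, i) \<in> cycle_edges vs" using False by (simp add: perm_edges_def)
    then show "i = \<pi> j" using cycle_edges_right_unique[OF root_cycleD(1)[OF rc] _ e] by blast
  qed (use False e in \<open>simp add: perm_edges_def\<close>)
  show ?thesis
  proof (cases "i = j")
    case True
    then show ?thesis
      using nz F root_cycle_edge_neq[OF rc e] by (simp add: reparam_nth)
  next
    case ne: False
    have "N$i$\<pi> j \<noteq> 0 \<longleftrightarrow> i = \<pi> j"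
    proof
      assume "N$i$\<pi> j \<noteq> 0"
      moreover have "i \<in> W" using ij root_cycleD(3)[OF rc] by auto
      ultimately have "i = \<pi> j \<or> (i, \<pi> j) \<in> cycle_edges vs"
        using root_cycle_N[OF rc] cycle_edges_set(2)[OF e] by blast
      then show "i = \<pi> j" using cycle_edges_left_unique[OF root_cycleD(1)[OF rc] e] ne by blast
    qed (metis N_diag zero_neq_one)
    then show ?thesis using nz ne F by (simp add: reparam_nth)
  qed
qed

text \<open>For the reversed cycle the recursion along the edge from \<open>v\<close> to
  \<open>u\<close> is solved for \<open>B$a$v\<close>; the noise entering at \<open>v\<close> is
  then that of \<open>u = \<pi> v\<close>. Both orientations thus have the same form, and
  \<open>weight_linear\<close> is treated once for both.\<close>

lemma reparam_recursion:
  assumes W: "terminal W" and rc: "root_cycle E W vs" and \<pi>: "orient_perm vs \<pi>"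
    and uv: "(u, v) \<in> perm_edges vs \<pi>"
  obtains \<kappa> where "\<kappa> \<noteq> 0"
    "\<And>a. a \<in> W \<Longrightarrow> B$a$v = reparam \<Lambda> \<pi>$u$v * B$a$u + \<kappa> * of_bool (a = \<pi> v)"
proof (cases "\<pi> = id")
  case True
  then have "(u, v) \<in> cycle_edges vs" using uv by (simp add: perm_edges_def)
  then show ?thesis
    using that[of 1] root_cycle_recursion[OF W rc] True by (simp add: reparam_id)
next
  case False
  then have e: "(v, u) \<in> cycle_edges vs" using uv by (simp add: perm_edges_def)
  have ne: "v \<noteq> u" using root_cycle_edge_neq[OF rc e] .
  have "(v, \<pi> v) \<in> cycle_edges vs"
    using False \<pi> cycle_edges_set(1)[OF e] by (auto simp: orient_perm_def)
  then have \<pi>v: "\<pi> v = u" using cycle_edges_right_unique[OF root_cycleD(1)[OF rc] _ e] by blast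
  have nz: "\<Lambda>$v$u \<noteq> 0" by (rule root_cycle_coeff_nz[OF rc e])
  have "reparam \<Lambda> \<pi>$u$v = 1 / \<Lambda>$v$u"
    using ne by (simp add: reparam_nth \<pi>v N_offdiag)
  then show ?thesis
    using that[of "- 1 / \<Lambda>$v$u"] root_cycle_recursion[OF W rc e] nz \<pi>v by (simp add: field_simps)
qed

end

context lsem_generic
begin

text \<open>Two vertices of the cycle have no common child on it, so only \<open>k = u\<close> and
  \<open>k = v\<close> contribute to the inverse covariance. On a 2-cycle both terms are present,
  and \<open>two_cycle\<close> says that they do not cancel.\<close>

lemma adjacency_sub_inverse:
  assumes W: "terminal W" and rc: "root_cycle E W vs" and ST: "agrees W S T"
    and uv: "u \<in> set vs" "v \<in> set vs" "u \<noteq> v"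
  shows "sub_inverse (set vs) S$u$v \<noteq> 0 \<longleftrightarrow> (u, v) \<in> cycle_edges vs \<or> (v, u) \<in> cycle_edges vs"
proof -
  note D = root_cycleD[OF rc]
  have N: "N$i$j \<noteq> 0 \<longleftrightarrow> (i, j) \<in> cycle_edges vs" if "i \<in> set vs" "j \<in> set vs" "i \<noteq> j" for i j
    using root_cycle_N[OF rc that(2)] that D(3) root_cycle_coeff_nz[OF rc] N_offdiag[OF that(3)] by fastforce
  have "sub_inverse (set vs) S$u$v = (\<Sum>k\<in>set vs. N$u$k * N$v$k / w2$k)"
    unfolding agrees_sub_inverse[OF ST D(3)] by (rule sub_inverse_closed[OF W D(4,3) uv(1,2)])
  also have "\<dots> = (\<Sum>k\<in>{u, v}. N$u$k * N$v$k / w2$k)"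
  proof (rule sum.mono_neutral_right)
    have "N$u$k = 0 \<or> N$v$k = 0" if "k \<in> set vs" "k \<noteq> u" "k \<noteq> v" for k
      using N[OF uv(1) that(1)] N[OF uv(2) that(1)] that uv(3) cycle_edges_left_unique[OF D(1)] by metis
    then show "\<forall>k\<in>set vs - {u, v}. N$u$k * N$v$k / w2$k = 0" by auto
  qed (use uv in auto)
  also have "\<dots> = N$v$u / w2$u + N$u$v / w2$v" using uv(3) by simp
  finally have eq: "sub_inverse (set vs) S$u$v = N$v$u / w2$u + N$u$v / w2$v" .
  have pos: "w2$u \<noteq> 0" "w2$v \<noteq> 0" using w2_pos by (metis less_irrefl)+
  show ?thesis
  proof (cases "(u, v) \<in> cycle_edges vs \<and> (v, u) \<in> cycle_edges vs")
    case True
    then have "\<Lambda>$u$v * w2$u + \<Lambda>$v$u * w2$v \<noteq> 0" using two_cycle D(5) by blast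
    moreover have "N$v$u / w2$u + N$u$v / w2$v = - (\<Lambda>$u$v * w2$u + \<Lambda>$v$u * w2$v) / (w2$u * w2$v)"
      using uv(3) pos by (simp add: N_offdiag field_simps)
    ultimately show ?thesis using True eq pos by simp
  next
    case False
    then have "N$v$u = 0 \<or> N$u$v = 0" using N uv by metis
    then show ?thesis
      using eq pos N[OF uv] N[OF uv(2,1)] uv(3) by (elim disjE) auto
  qed
qed

lemma orientations_root_cycle:
  assumes W: "terminal W" and rc: "root_cycle E W vs" and ST: "agrees W S T"
  shows "cycle_edges vs \<in> orientations S (set vs)"
    and "F \<in> orientations S (set vs) \<Longrightarrow> F = cycle_edges vs \<or> F = (cycle_edges vs)\<inverse>"
proof -
  note D = root_cycleD[OF rc] and adj = adjacency_sub_inverse[OF W rc ST]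
  show "cycle_edges vs \<in> orientations S (set vs)"
    unfolding orientations_def using D(1,2) adj by blast
  assume "F \<in> orientations S (set vs)"
  then have "\<exists>us. F = cycle_edges us \<and> distinct us \<and> 2 \<le> length us \<and> set us = set vs \<and>
      (\<forall>u\<in>set vs. \<forall>v\<in>set vs. u \<noteq> v \<longrightarrow>
        ((u, v) \<in> cycle_edges us \<or> (v, u) \<in> cycle_edges us) = (sub_inverse (set vs) S$u$v \<noteq> 0))"
    by (simp only: orientations_def mem_Collect_eq)
  then obtain us where F: "F = cycle_edges us" and us: "distinct us" "2 \<le> length us" "set us = set vs"
    and eq: "\<forall>u\<in>set vs. \<forall>v\<in>set vs. u \<noteq> v \<longrightarrow>
        ((u, v) \<in> cycle_edges us \<or> (v, u) \<in> cycle_edges us) = (sub_inverse (set vs) S$u$v \<noteq> 0)"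
    by (elim exE conjE)
  have sub: "cycle_edges us \<subseteq> cycle_edges vs \<union> (cycle_edges vs)\<inverse>"
  proof (rule subrelI)
    fix u v assume uv: "(u, v) \<in> cycle_edges us"
    have K: "u \<in> set vs" "v \<in> set vs" "u \<noteq> v"
      using cycle_edges_set[OF uv] us(3) cycle_edges_irrefl[OF us(1,2) uv] by auto
    then have "sub_inverse (set vs) S$u$v \<noteq> 0" using eq uv by blast
    then show "(u, v) \<in> cycle_edges vs \<union> (cycle_edges vs)\<inverse>" using adj[OF K] by blast
  qed
  show "F = cycle_edges vs \<or> F = (cycle_edges vs)\<inverse>"
  proof (cases "3 \<le> length us")
    case True
    then show ?thesis using cycle_edges_same_adjacency[OF D(1) us(1) _ us(3) sub] F by blast
  next
    case False
    then have "length us = 2" using us(2) by simp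
    then obtain a b where ab: "us = [a, b]" by (auto simp: numeral_2_eq_2 length_Suc_conv)
    have "length vs = 2" using us D(1) \<open>length us = 2\<close> by (metis distinct_card)
    then obtain c d where cd: "vs = [c, d]" by (auto simp: numeral_2_eq_2 length_Suc_conv)
    have "cycle_edges us = {(a, b), (b, a)}" "cycle_edges vs = {(c, d), (d, c)}"
      by (simp_all add: ab cd cycle_edges_def)
    moreover have "{a, b} = {c, d}" using us(3) ab cd by simp
    ultimately show ?thesis using F by (auto simp: doubleton_eq_iff)
  qed
qed

text \<open>A solution is supplied by \<open>weight_linear_solution\<close>. Uniqueness needs a
  nonzero coefficient, which genericity reduces to one favourable choice of third moments.\<close>

lemma weight_linear_iff:
  assumes W: "terminal W" and rc: "root_cycle E W vs" and ST: "agrees W S T"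
    and \<pi>: "orient_perm vs \<pi>" and len: "3 \<le> length vs"
    and uvw: "(u, v) \<in> perm_edges vs \<pi>" "(v, w) \<in> perm_edges vs \<pi>"
  shows "weight_linear S T u v w l \<longleftrightarrow> l = reparam \<Lambda> \<pi>$u$v"
proof -
  note D = root_cycleD[OF rc]
  have K: "u \<in> set vs" "v \<in> set vs" "w \<in> set vs" using perm_edges_set uvw by metis+
  then have inW: "u \<in> W" "v \<in> W" "w \<in> W" using D(3) by auto
  have "u \<noteq> w"
    using uvw cycle_edges_no_2_cycle[OF D(1) len] by (auto simp: perm_edges_def split: if_splits)
  then have ne: "u \<noteq> v" "v \<noteq> w" "u \<noteq> w"
    using perm_edges_neq[OF D(1,2)] uvw by blast+
  have inj: "\<pi> a = \<pi> b \<longleftrightarrow> a = b" for a b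
    using orient_perm_permutes[OF \<pi>] by (metis permutes_inj injD)
  have \<pi>K: "\<pi> a \<in> set vs" if "a \<in> set vs" for a
    using orient_perm_permutes[OF \<pi>] that by (simp add: permutes_in_image)
  have \<pi>W: "\<pi> u \<in> W" "\<pi> v \<in> W" "\<pi> w \<in> W" using \<pi>K K D(3) by blast+
  obtain k where k: "k \<noteq> 0"
    "\<And>a. a \<in> W \<Longrightarrow> B$a$v = reparam \<Lambda> \<pi>$u$v * B$a$u + k * of_bool (a = \<pi> v)"
    using reparam_recursion[OF W rc \<pi> uvw(1)] by blast
  obtain k' where k': "k' \<noteq> 0"
    "\<And>a. a \<in> W \<Longrightarrow> B$a$w = reparam \<Lambda> \<pi>$v$w * B$a$v + k' * of_bool (a = \<pi> w)"
    using reparam_recursion[OF W rc \<pi> uvw(2)] by blast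
  \<comment> \<open>Third moments on the noise terms entering at \<open>v\<close> and at
    \<open>u\<close>; the one entering at \<open>w\<close> differs from both because the cycle has
    at least three vertices.\<close>
  have "orient_det (S0 W) (third_of W B (axis (\<pi> v) 1 + axis (\<pi> u) 1)) u v w \<noteq> 0"
  proof (rule orient_det_nonzero[OF k(2) k'(2)])
    show "reparam \<Lambda> \<pi>$v$w \<noteq> 0" using reparam_support[OF rc \<pi> K(2,3)] uvw(2) by blast
    show "B$\<pi> w$u \<noteq> 0" "B$\<pi> v$v \<noteq> 0" "B$\<pi> u$u \<noteq> 0"
      using root_cycle_B_nz[OF W rc] \<pi>K K by auto
    show "w2$\<pi> w \<noteq> 0" using w2_pos[of "\<pi> w"] by simp
    show "\<pi> v \<noteq> \<pi> w" "\<pi> v \<noteq> \<pi> u" "\<pi> w \<noteq> \<pi> u" using inj ne by auto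
  qed (assumption | fact \<pi>W k(1) k'(1))+
  then have det: "orient_det (S0 W) (T0 W) u v w \<noteq> 0"
    using generic[OF moment_testsI(4)] by blast
  have "weight_linear S T u v w l \<longleftrightarrow> weight_linear (S0 W) (T0 W) u v w l" for l
    using inW agreesD[OF ST] unfolding weight_linear_eq orient_det_eq by simp
  moreover have "weight_linear (S0 W) (T0 W) u v w (reparam \<Lambda> \<pi>$u$v)"
    by (rule weight_linear_solution[OF k(2) \<pi>W(2)])
  ultimately show ?thesis using det unfolding weight_linear_eq by (metis mult_left_cancel)
qed

text \<open>Each quadratic has as roots the weight in \<Lambda> and the inverse of the opposite
  weight. A mixed pair has product 1 and is excluded by invertibility; the two consistent pairs do
  not have product 1.\<close>

lemma root_cycle_2:
  assumes W: "terminal W" and rc: "root_cycle E W [a, b]" and ST: "agrees W S T"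
    and L: "\<And>i j. (i, j) \<noteq> (a, b) \<Longrightarrow> (i, j) \<noteq> (b, a) \<Longrightarrow> L$i$j = 0"
  shows "weight_quadratic S T a b (L$a$b) \<and> weight_quadratic S T b a (L$b$a) \<and> invertible (mat 1 - L) \<longleftrightarrow>
    L$a$b = \<Lambda>$a$b \<and> L$b$a = \<Lambda>$b$a \<or> L$a$b = 1 / \<Lambda>$b$a \<and> L$b$a = 1 / \<Lambda>$a$b"
proof -
  note D = root_cycleD[OF rc]
  have ab: "a \<noteq> b" "a \<in> W" "b \<in> W" using D(1,3) by auto
  have e: "(a, b) \<in> cycle_edges [a, b]" "(b, a) \<in> cycle_edges [a, b]" by (auto simp: cycle_edges_def)
  have nz: "\<Lambda>$a$b \<noteq> 0" "\<Lambda>$b$a \<noteq> 0" using root_cycle_coeff_nz[OF rc] e by auto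
  have quad: "weight_quadratic S T u v t \<longleftrightarrow> t = \<Lambda>$u$v \<or> t = 1 / \<Lambda>$v$u"
    if uv: "(u, v) \<in> cycle_edges [a, b]" "(v, u) \<in> cycle_edges [a, b]" for u v t
  proof -
    have K: "u \<in> set [a, b]" "v \<in> set [a, b]" "u \<noteq> v"
      using cycle_edges_set[OF uv(1)] root_cycle_edge_neq[OF rc uv(1)] by auto
    have inW: "u \<in> W" "v \<in> W" using K D(3) by blast+
    have nz: "\<Lambda>$v$u \<noteq> 0" by (rule root_cycle_coeff_nz[OF rc uv(2)])
    have "weight_quadratic S T u v t \<longleftrightarrow> weight_quadratic (S0 W) (T0 W) u v t"
      using inW agreesD[OF ST] unfolding weight_quadratic_def by simp
    also have "\<dots> \<longleftrightarrow> t = \<Lambda>$u$v \<or> t * B$v$u = B$v$v"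
      using root_cycle_recursion[OF W rc uv(1)] inW root_cycle_B_nz[OF W rc K(2,1)]
        root_cycle_d22_nz[OF W rc K]
      by (intro weight_quadratic_roots) auto
    also have "B$v$u = \<Lambda>$v$u * B$v$v"
      using root_cycle_recursion[OF W rc uv(2) inW(2)] K(3) by simp
    finally show ?thesis
      using root_cycle_B_nz[OF W rc K(2,2)] nz by (auto simp: field_simps)
  qed
  \<comment> \<open>Going once around the cycle multiplies by the product and adds the noise of
    \<open>a\<close>, so a product of 1 would give \<open>0 = 1\<close>.\<close>
  have "\<Lambda>$a$b * \<Lambda>$b$a \<noteq> 1"
  proof
    assume 1: "\<Lambda>$a$b * \<Lambda>$b$a = 1"
    have "B$a$a = \<Lambda>$b$a * B$a$b + 1" "B$a$b = \<Lambda>$a$b * B$a$a"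
      using root_cycle_recursion[OF W rc e(2) ab(2)] root_cycle_recursion[OF W rc e(1) ab(2)] ab(1) by auto
    then have "B$a$a = (\<Lambda>$a$b * \<Lambda>$b$a) * B$a$a + 1" by (simp add: mult_ac)
    then show False using 1 by simp
  qed
  moreover have "invertible (mat 1 - L) \<longleftrightarrow> L$a$b * L$b$a \<noteq> 1"
    by (rule invertible_one_minus_2_cycle[OF ab(1) L])
  moreover have "1 / \<Lambda>$b$a * (1 / \<Lambda>$a$b) \<noteq> 1"
    using calculation(1) nz by (auto simp: divide_simps mult.commute)
  ultimately show ?thesis
    unfolding quad[OF e] quad[OF e(2,1)] using nz by auto
qed

text \<open>\<pi>' may differ from \<pi>: on a 2-cycle both permutations have the same edges, and
  the choice of roots decides between them. On longer cycles the weights are unique and \<pi>' is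
  \<pi>.\<close>

lemma cycle_weights_root_cycle:
  assumes W: "terminal W" and rc: "root_cycle E W vs" and ST: "agrees W S T"
  shows "\<And>\<pi>. orient_perm vs \<pi> \<Longrightarrow> cycle_weights S T (set vs) (perm_edges vs \<pi>) \<noteq> {}"
    and "\<And>\<pi> L. \<lbrakk>orient_perm vs \<pi>; L \<in> cycle_weights S T (set vs) (perm_edges vs \<pi>)\<rbrakk> \<Longrightarrow>
      \<exists>\<pi>'. orient_perm vs \<pi>' \<and> perm_edges vs \<pi>' = perm_edges vs \<pi> \<and>
        L = (\<chi> i j. if i \<in> set vs \<and> j \<in> set vs then reparam \<Lambda> \<pi>'$i$j else 0)"
proof -
  note D = root_cycleD[OF rc]
  define R where "R \<pi> = (\<chi> i j. if i \<in> set vs \<and> j \<in> set vs then reparam \<Lambda> \<pi>$i$j else 0)" for \<pi>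
  have supp: "R \<pi>$i$j \<noteq> 0 \<longleftrightarrow> (i, j) \<in> perm_edges vs \<pi>" if "orient_perm vs \<pi>" for \<pi> i j
    using reparam_support[OF rc that] perm_edges_set[of i j vs \<pi>] by (auto simp: R_def)
  have "cycle_weights S T (set vs) (perm_edges vs \<pi>) \<noteq> {} \<and>
    (\<forall>L\<in>cycle_weights S T (set vs) (perm_edges vs \<pi>).
      \<exists>\<pi>'. orient_perm vs \<pi>' \<and> perm_edges vs \<pi>' = perm_edges vs \<pi> \<and> L = R \<pi>')"
    if \<pi>: "orient_perm vs \<pi>" for \<pi>
  proof (cases "length vs = 2")
    case True
    then obtain a b where vs: "vs = [a, b]" by (auto simp: numeral_2_eq_2 length_Suc_conv)
    have ce: "cycle_edges vs = {(a, b), (b, a)}" by (simp add: vs cycle_edges_def)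
    have pe: "perm_edges vs \<pi> = {(a, b), (b, a)}" for \<pi> unfolding perm_edges_def ce by auto
    have ab: "a \<noteq> b" using D(1) vs by auto
    have card: "card (set vs) = 2" using ab vs by simp
    have nz: "\<Lambda>$a$b \<noteq> 0" "\<Lambda>$b$a \<noteq> 0" using root_cycle_coeff_nz[OF rc] ce by auto
    obtain \<sigma> where \<sigma>: "\<sigma> permutes set vs" "\<And>j. j \<in> set vs \<Longrightarrow> (j, \<sigma> j) \<in> cycle_edges vs"
      using successor_permutation[OF D(1)] by blast
    have o\<sigma>: "orient_perm vs \<sigma>" using \<sigma> by (simp add: orient_perm_def)
    have oid: "orient_perm vs id" by (simp add: orient_perm_def)
    have \<sigma>ab: "\<sigma> a = b" "\<sigma> b = a" using \<sigma>(2)[of a] \<sigma>(2)[of b] ab unfolding ce by (auto simp: vs)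
    have Rid: "R id$a$b = \<Lambda>$a$b" "R id$b$a = \<Lambda>$b$a" by (simp_all add: R_def reparam_id vs)
    have R\<sigma>: "R \<sigma>$a$b = 1 / \<Lambda>$b$a" "R \<sigma>$b$a = 1 / \<Lambda>$a$b"
      using ab by (simp_all add: R_def reparam_nth vs \<sigma>ab N_offdiag)
    have R0: "R \<pi>$i$j = 0" if "orient_perm vs \<pi>" "(i, j) \<noteq> (a, b)" "(i, j) \<noteq> (b, a)" for \<pi> i j
      using supp[OF that(1), of i j] that(2,3) unfolding pe by auto
    have eqR: "L = R \<tau> \<longleftrightarrow> (\<forall>i j. (i, j) \<noteq> (a, b) \<longrightarrow> (i, j) \<noteq> (b, a) \<longrightarrow> L$i$j = 0) \<and>
        L$a$b = R \<tau>$a$b \<and> L$b$a = R \<tau>$b$a" (is "_ \<longleftrightarrow> ?rhs") if \<tau>: "orient_perm vs \<tau>" for \<tau> L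
    proof
      assume "L = R \<tau>"
      then show ?rhs using R0[OF \<tau>] by simp
    next
      assume rhs: ?rhs
      have "L$i$j = R \<tau>$i$j" for i j
      proof -
        consider "(i, j) = (a, b)" | "(i, j) = (b, a)" | "(i, j) \<noteq> (a, b)" "(i, j) \<noteq> (b, a)" by blast
        then show ?thesis using rhs R0[OF \<tau>, of i j] by cases simp_all
      qed
      then show "L = R \<tau>" by (simp add: vec_eq_iff)
    qed
    have cw: "L \<in> cycle_weights S T (set vs) (perm_edges vs \<pi>) \<longleftrightarrow> L = R id \<or> L = R \<sigma>" for L
    proof -
      have "L \<in> cycle_weights S T (set vs) (perm_edges vs \<pi>) \<longleftrightarrow>
          (\<forall>i j. (i, j) \<noteq> (a, b) \<longrightarrow> (i, j) \<noteq> (b, a) \<longrightarrow> L$i$j = 0) \<and>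
          (weight_quadratic S T a b (L$a$b) \<and> weight_quadratic S T b a (L$b$a) \<and> invertible (mat 1 - L))"
        unfolding cycle_weights_def pe by (auto simp: card)
      also have "\<dots> \<longleftrightarrow> (\<forall>i j. (i, j) \<noteq> (a, b) \<longrightarrow> (i, j) \<noteq> (b, a) \<longrightarrow> L$i$j = 0) \<and>
          (L$a$b = R id$a$b \<and> L$b$a = R id$b$a \<or> L$a$b = R \<sigma>$a$b \<and> L$b$a = R \<sigma>$b$a)"
        unfolding Rid R\<sigma> by (intro conj_cong refl root_cycle_2[OF W rc[unfolded vs] ST]) blast
      also have "\<dots> \<longleftrightarrow> L = R id \<or> L = R \<sigma>"
        unfolding eqR[OF oid] eqR[OF o\<sigma>] by (rule conj_disj_distribL)
      finally show ?thesis .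
    qed
    then show ?thesis using oid o\<sigma> unfolding pe by blast
  next
    case False
    then have len: "3 \<le> length vs" using D(2) by simp
    then have card: "card (set vs) \<noteq> 2" using distinct_card[OF D(1)] by simp
    have lin: "weight_linear S T u v w l \<longleftrightarrow> l = R \<pi>$u$v"
      if "(u, v) \<in> perm_edges vs \<pi>" "(v, w) \<in> perm_edges vs \<pi>" for u v w l
      using weight_linear_iff[OF W rc ST \<pi> len that] perm_edges_set[OF that(1)] by (simp add: R_def)
    have zero: "R \<pi>$i$j = 0" if "(i, j) \<notin> perm_edges vs \<pi>" for i j using supp[OF \<pi>] that by blast
    have "R \<pi> \<in> cycle_weights S T (set vs) (perm_edges vs \<pi>)"
      unfolding cycle_weights_def using card lin zero by auto
    moreover have "L = R \<pi>" if L: "L \<in> cycle_weights S T (set vs) (perm_edges vs \<pi>)" for L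
    proof -
      have "L$u$v = R \<pi>$u$v" for u v
      proof (cases "(u, v) \<in> perm_edges vs \<pi>")
        case True
        then obtain w where w: "(v, w) \<in> perm_edges vs \<pi>"
          using perm_edges_out perm_edges_set by metis
        have "weight_linear S T u v w (L$u$v)"
          using L card True w unfolding cycle_weights_def by auto
        then show ?thesis using lin[OF True w] by simp
      next
        case False
        then show ?thesis using L zero unfolding cycle_weights_def by auto
      qed
      then show ?thesis by (simp add: vec_eq_iff)
    qed
    ultimately show ?thesis using \<pi> by blast
  qed
  then show "\<And>\<pi>. orient_perm vs \<pi> \<Longrightarrow> cycle_weights S T (set vs) (perm_edges vs \<pi>) \<noteq> {}"
    "\<And>\<pi> L. \<lbrakk>orient_perm vs \<pi>; L \<in> cycle_weights S T (set vs) (perm_edges vs \<pi>)\<rbrakk> \<Longrightarrow>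
      \<exists>\<pi>'. orient_perm vs \<pi>' \<and> perm_edges vs \<pi>' = perm_edges vs \<pi> \<and>
        L = (\<chi> i j. if i \<in> set vs \<and> j \<in> set vs then reparam \<Lambda> \<pi>'$i$j else 0)"
    unfolding R_def by blast+
qed

lemma orientations_perm_edges:
  assumes W: "terminal W" and rc: "root_cycle E W vs" and ST: "agrees W S T"
    and F: "F \<in> orientations S (set vs)"
  obtains \<pi> where "orient_perm vs \<pi>" "F = perm_edges vs \<pi>"
proof -
  obtain \<sigma> where \<sigma>: "\<sigma> permutes set vs" "\<And>j. j \<in> set vs \<Longrightarrow> (j, \<sigma> j) \<in> cycle_edges vs"
    using successor_permutation[OF root_cycleD(1)[OF rc]] by blast
  have "\<sigma> (hd vs) \<noteq> hd vs"
    using \<sigma>(2)[of "hd vs"] root_cycle_edge_neq[OF rc] root_cycleD(6)[OF rc] by fastforce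
  then have "\<sigma> \<noteq> id" by auto
  then show ?thesis
    using orientations_root_cycle(2)[OF W rc ST F] that[of id] that[of \<sigma>] \<sigma>
    by (auto simp: orient_perm_def perm_edges_def)
qed

text \<open>All that the induction needs about a root cycle: whatever is chosen, the weights come
  from some permutation, and the chosen edges are exactly where they are nonzero.\<close>

lemma root_cycle_choices:
  assumes W: "terminal W" and rc: "root_cycle E W vs" and ST: "agrees W S T"
  shows "orientations S (set vs) \<noteq> {}"
    and "F \<in> orientations S (set vs) \<Longrightarrow> cycle_weights S T (set vs) F \<noteq> {}"
    and "F \<in> orientations S (set vs) \<Longrightarrow> L \<in> cycle_weights S T (set vs) F \<Longrightarrow>
      \<exists>\<pi>. orient_perm vs \<pi> \<and> F = {(i, j). L$i$j \<noteq> 0} \<and>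
        L = (\<chi> i j. if i \<in> set vs \<and> j \<in> set vs then reparam \<Lambda> \<pi>$i$j else 0)"
proof -
  show "orientations S (set vs) \<noteq> {}" using orientations_root_cycle(1)[OF assms] by blast
  assume F: "F \<in> orientations S (set vs)"
  obtain \<pi> where \<pi>: "orient_perm vs \<pi>" "F = perm_edges vs \<pi>"
    using orientations_perm_edges[OF assms F] by blast
  show "cycle_weights S T (set vs) F \<noteq> {}"
    using cycle_weights_root_cycle(1)[OF assms \<pi>(1)] \<pi>(2) by simp
  assume L: "L \<in> cycle_weights S T (set vs) F"
  then obtain \<pi>' where \<pi>': "orient_perm vs \<pi>'" "perm_edges vs \<pi>' = F"
    "L = (\<chi> i j. if i \<in> set vs \<and> j \<in> set vs then reparam \<Lambda> \<pi>'$i$j else 0)"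
    using cycle_weights_root_cycle(2)[OF assms \<pi>(1)] \<pi>(2) by blast
  have "(i, j) \<in> F \<longleftrightarrow> L$i$j \<noteq> 0" for i j
    using reparam_support[OF rc \<pi>'(1), of i j] perm_edges_set[of i j vs \<pi>'] \<pi>'(2)
    unfolding \<pi>'(3) by auto
  then have "F = {(i, j). L$i$j \<noteq> 0}" by auto
  then show "\<exists>\<pi>. orient_perm vs \<pi> \<and> F = {(i, j). L$i$j \<noteq> 0} \<and>
        L = (\<chi> i j. if i \<in> set vs \<and> j \<in> set vs then reparam \<Lambda> \<pi>$i$j else 0)"
    using \<pi>' by blast
qed

end

section \<open>Genericity\<close>

lemma borel_measurable_det:
  assumes "\<And>i j. (\<lambda>x. A x$i$j) \<in> borel_measurable M"
  shows "(\<lambda>x. det (A x :: real^'n::finite^'n)) \<in> borel_measurable M"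
  unfolding det_def using assms by measurable

text \<open>Cramer's rule, for measurability in the entries. On singular matrices
  \<open>matrix_inv\<close> is one fixed unspecified matrix, its defining predicate being constantly
  false, so that case is measurable too.\<close>

lemma matrix_inv_nth:
  fixes A :: "real^'n::finite^'n"
  shows "matrix_inv A$i$j = (if det A = 0 then (SOME X :: real^'n^'n. False)$i$j
    else det (\<chi> k l. if l = i then axis j 1$k else A$k$l) / det A)"
proof (cases "det A = 0")
  case True
  then have "\<not> invertible A" by (simp add: invertible_det_nz)
  then have "(\<lambda>X. A ** X = mat 1 \<and> X ** A = mat 1) = (\<lambda>_. False)"
    by (auto simp: invertible_def)
  then have "matrix_inv A = (SOME X. False)" by (simp only: matrix_inv_def)
  then show ?thesis using True by simp
next
  case False
  then have "A ** matrix_inv A = mat 1" by (intro matrix_inv_right) (simp add: invertible_det_nz)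
  then have "(\<Sum>l\<in>UNIV. A$k$l * matrix_inv A$l$j) = of_bool (k = j)" for k
    by (simp flip: matrix_mult_nth mat_1_nth)
  then have "A *v (\<chi> l. matrix_inv A$l$j) = axis j 1"
    by (simp add: vec_eq_iff matrix_vector_mult_def axis_def)
  then have "(\<chi> l. matrix_inv A$l$j) = (\<chi> k. det (\<chi> i l. if l = k then axis j 1$i else A$i$l) / det A)"
    using cramer[OF False] by blast
  then have "(\<chi> l. matrix_inv A$l$j)$i = (\<chi> k. det (\<chi> i l. if l = k then axis j 1$i else A$i$l) / det A)$i"
    by simp
  then show ?thesis using False by simp
qed

lemma borel_measurable_matrix_inv:
  assumes [measurable]: "\<And>i j. (\<lambda>x. A x$i$j) \<in> borel_measurable M"
  shows "(\<lambda>x. matrix_inv (A x :: real^'n::finite^'n)$i$j) \<in> borel_measurable M"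
proof -
  have [measurable]: "(\<lambda>x. det (A x)) \<in> borel_measurable M"
    by (rule borel_measurable_det) measurable
  have [measurable]: "(\<lambda>x. det (\<chi> k l. if l = i then axis j 1$k else A x$k$l)) \<in> borel_measurable M"
    by (rule borel_measurable_det) (simp add: if_distrib)
  show ?thesis unfolding matrix_inv_nth by measurable
qed

lemma borel_measurable_regression:
  assumes [measurable]: "\<And>i j. (\<lambda>x. S x$i$j) \<in> borel_measurable M"
  shows "(\<lambda>x. regression (S x :: real^'n::finite^'n) C b a) \<in> borel_measurable M"
proof -
  have [measurable]: "(\<lambda>x. sub_inverse C (S x)$c$a) \<in> borel_measurable M" for c
    unfolding sub_inverse_def by (rule borel_measurable_matrix_inv) simp
  show ?thesis unfolding regression_def by measurable
qed

lemma borel_measurable_moment_test: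
  assumes f: "f \<in> moment_tests"
    and [measurable]: "\<And>i j. (\<lambda>x. S x$i$j) \<in> borel_measurable M" "\<And>i j k. (\<lambda>x. T x$i$j$k) \<in> borel_measurable M"
  shows "(\<lambda>x. f (S x :: real^'n::finite^'n) (T x)) \<in> borel_measurable M"
proof -
  have [measurable]: "(\<lambda>x. regression (S x) C b a) \<in> borel_measurable M" for C b a
    by (rule borel_measurable_regression) measurable
  show ?thesis
    using f unfolding moment_tests_def
    by (elim UnE CollectE exE conjE)
      (simp_all add: d22_def d33_eq residual_test_def resid_def orient_det_eq)
qed

lemma line_poly_moment_test:
  assumes f: "f \<in> moment_tests" and T: "\<And>i j k. line_poly (\<lambda>x. T x$i$j$k)"
  shows "line_poly (\<lambda>x. f S (T x))"
  using f unfolding moment_tests_def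
  by (elim UnE CollectE exE conjE)
    (auto simp: d22_def d33_eq residual_test_def resid_def orient_det_eq
      intro!: line_poly_diff line_poly_add line_poly_mult line_poly_sum T line_poly_const)

lemma continuous_on_moment_test:
  assumes f: "f \<in> moment_tests" and T: "\<And>i j k. continuous_on A (\<lambda>x. T x$i$j$k)"
  shows "continuous_on A (\<lambda>x. f S (T x))"
  using f unfolding moment_tests_def
  by (elim UnE CollectE exE conjE)
    (auto simp: d22_def d33_eq residual_test_def resid_def orient_det_eq intro!: continuous_intros T)

lemma finite_moment_tests:
  "finite (moment_tests :: (real^'n::finite^'n \<Rightarrow> real^'n^'n^'n \<Rightarrow> real) set)"
proof -
  let ?R = "range (\<lambda>(u :: 'n, v) S T. d22 S T u v) \<union> range (\<lambda>(u :: 'n, v) S T. d33 S T u v) \<union>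
      range (\<lambda>(C :: 'n set, c, d) S T. residual_test S T C c d) \<union>
      range (\<lambda>(u :: 'n, v, w) S T. orient_det S T u v w)"
  have "moment_tests \<subseteq> ?R"
    unfolding moment_tests_def by (auto simp: image_def)
  moreover have "finite ?R" by (intro finite_UnI finite_imageI finite)
  ultimately show ?thesis by (rule finite_subset)
qed

definition coeffs_of :: "'n::finite digraph \<Rightarrow> ('n \<times> 'n \<Rightarrow> real) \<Rightarrow> real^'n^'n" where
  "coeffs_of E p = (\<chi> i j. if (i, j) \<in> E then p (i, j) else 0)"

lemma coeffs_of_restrict:
  assumes "\<Lambda> \<in> edge_coeffs E"
  shows "coeffs_of E (\<lambda>e\<in>E. \<Lambda>$fst e$snd e) = \<Lambda>"
  using assms by (auto simp: coeffs_of_def edge_coeffs_def vec_eq_iff)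

lemma sigma_finite_PiM_lborel: "sigma_finite_measure (\<Pi>\<^sub>M e\<in>E. lborel :: real measure)" if "finite E" for E
proof -
  interpret product_sigma_finite "\<lambda>_. lborel :: real measure"
    by (simp add: product_sigma_finite_def lborel.sigma_finite_measure_axioms)
  show ?thesis using that by (rule sigma_finite)
qed

lemma AE_PiM_lborel_neq_zero:
  assumes "finite E" "e \<in> E"
  shows "AE p in (\<Pi>\<^sub>M e\<in>E. lborel :: real measure). p e \<noteq> 0"
proof -
  interpret product_sigma_finite "\<lambda>_. lborel :: real measure"
    by (simp add: product_sigma_finite_def lborel.sigma_finite_measure_axioms)
  let ?A = "\<lambda>e'. if e' = e then {0} else UNIV :: real set"
  have "emeasure (\<Pi>\<^sub>M e\<in>E. lborel) (Pi\<^sub>E E ?A) = (\<Prod>e'\<in>E. emeasure lborel (?A e'))"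
    using assms(1) by (intro emeasure_PiM) auto
  also have "\<dots> = 0" using assms by (auto intro!: prod_zero bexI[of _ e])
  finally have "Pi\<^sub>E E ?A \<in> null_sets (\<Pi>\<^sub>M e\<in>E. lborel)"
    using assms(1) by (auto simp: null_sets_def intro!: sets_PiM_I_finite)
  then have "AE p in (\<Pi>\<^sub>M e\<in>E. lborel). p \<notin> Pi\<^sub>E E ?A" by (rule AE_not_in)
  then show ?thesis
    by (rule AE_mp) (use assms in \<open>auto intro!: AE_I2 simp: space_PiM PiE_iff\<close>)
qed

text \<open>All \<open>W\<close> and all tests are included because the null set is fixed before the
  run. The condition also makes sense where I - \<Lambda> is singular, as \<open>matrix_inv\<close>
  is total.\<close>

definition generic_parameter :: "'n::finite digraph \<Rightarrow> real^'n^'n \<Rightarrow> real^'n \<Rightarrow> real^'n \<Rightarrow> bool" where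
  "generic_parameter E \<Lambda> w2 w3 \<longleftrightarrow>
     (\<forall>(u, v) \<in> E. \<Lambda>$u$v \<noteq> 0) \<and> (\<forall>a. w2$a \<noteq> 0) \<and> (\<forall>a. w3$a \<noteq> 0) \<and>
     (\<forall>(u, v) \<in> E. (v, u) \<in> E \<longrightarrow> \<Lambda>$u$v * w2$u + \<Lambda>$v$u * w2$v \<noteq> 0) \<and>
     (\<forall>W. \<forall>f \<in> moment_tests. let B = matrix_inv (mat 1 - \<Lambda>) in
        f (second_of W B w2) (third_of W B w3) = 0 \<longrightarrow>
        (\<forall>z. f (second_of W B w2) (third_of W B z) = 0))"

text \<open>With the coefficients \<open>p\<close> held fixed, null sets are found in the space of
  noise moments; only the nonvanishing of the coefficients themselves is decided in the factor
  \<open>P\<close>.\<close>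

lemma AE_generic_parameter:
  fixes E :: "'n::finite digraph"
  assumes E: "irrefl E"
  shows "AE (p, w2, w3) in parameter_measure E. generic_parameter E (coeffs_of E p) w2 w3"
proof -
  define P where "P = (\<Pi>\<^sub>M e\<in>E. lborel :: real measure)"
  define M where "M = P \<Otimes>\<^sub>M (lborel :: ((real^'n) \<times> (real^'n)) measure)"
  have PM: "parameter_measure E = M"
    by (simp add: parameter_measure_def M_def P_def lborel_prod)
  have P: "sigma_finite_measure P" unfolding P_def by (rule sigma_finite_PiM_lborel) simp
  interpret pair: pair_sigma_finite P "lborel :: ((real^'n) \<times> (real^'n)) measure"
    using P by (simp add: pair_sigma_finite_def lborel.sigma_finite_measure_axioms)
  have c_meas [measurable]: "(\<lambda>p. coeffs_of E p$i$j) \<in> borel_measurable P" for i j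
  proof (cases "(i, j) \<in> E")
    case True
    then have "(\<lambda>p. p (i, j)) \<in> measurable P lborel" unfolding P_def by (rule measurable_component_singleton)
    then show ?thesis using True by (simp add: coeffs_of_def)
  qed (simp add: coeffs_of_def)
  have fst_meas [measurable]: "(\<lambda>x. fst x$a) \<in> borel_measurable (borel :: ((real^'n) \<times> (real^'n)) measure)" for a
    by (intro borel_measurable_continuous_onI continuous_intros)
  have snd_meas [measurable]: "(\<lambda>x. snd x$a) \<in> borel_measurable (borel :: ((real^'n) \<times> (real^'n)) measure)" for a
    by (intro borel_measurable_continuous_onI continuous_intros)
  have lin: "linear (\<lambda>c. (0 :: real^'n, c) :: (real^'n) \<times> (real^'n))"
    by (auto intro!: linearI)
  have coord: "line_poly (\<lambda>c::real^'n. (x + c)$a)" "continuous_on UNIV (\<lambda>c::real^'n. (x + c)$a)" for x a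
  proof -
    have "linear (\<lambda>c::real^'n. c$a)" by (auto intro!: linearI)
    from line_poly_add[OF line_poly_const[of "x$a"] line_poly_linear[OF this]]
    show "line_poly (\<lambda>c::real^'n. (x + c)$a)" by simp
    show "continuous_on UNIV (\<lambda>c::real^'n. (x + c)$a)" by (intro continuous_intros)
  qed
  have lift: "AE y in M. Q (fst y)" if "AE p in P. Q p" "Measurable.pred P Q" for Q
    unfolding M_def
  proof (rule pair.AE_pair_measure)
    have [measurable]: "Measurable.pred P Q" by (rule that(2))
    show "{y \<in> space (P \<Otimes>\<^sub>M lborel). Q (fst y)} \<in> sets (P \<Otimes>\<^sub>M lborel)" by measurable
    show "AE p in P. AE x in lborel. Q (fst (p, x))" using that(1) by eventually_elim simp
  qed
  have edge: "AE p in P. coeffs_of E p$u$v \<noteq> 0" if "(u, v) \<in> E" for u v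
  proof -
    have "AE p in P. p (u, v) \<noteq> 0" unfolding P_def using that by (intro AE_PiM_lborel_neq_zero) auto
    then show ?thesis by eventually_elim (use that in \<open>simp add: coeffs_of_def\<close>)
  qed
  have edges: "AE y in M. coeffs_of E (fst y)$u$v \<noteq> 0" if "(u, v) \<in> E" for u v
    by (rule lift[OF edge[OF that]]) measurable
  \<comment> \<open>Serves all conditions linear in the noise moments: nonzero \<open>w2\<close>,
    nonzero \<open>w3\<close>, and the 2-cycle condition, whose coefficient vector depends on
    \<open>p\<close>.\<close>
  have linear_form: "AE y in M. c (fst y) \<bullet> snd y \<noteq> 0"
    if c: "c \<in> borel_measurable P" "AE p in P. c p \<noteq> 0" for c :: "_ \<Rightarrow> (real^'n) \<times> (real^'n)"
  proof -
    note c(1) [measurable]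
    have "AE (p, x) in M. c p \<bullet> x = 0 \<longrightarrow> (\<forall>d. c p \<bullet> (x + d) = 0)"
      unfolding M_def
    proof (intro AE_poly_zero_imp_zero[OF P, where g = "\<lambda>d. d"])
      show "line_poly (\<lambda>d. c p \<bullet> (x + d))" for p x
        unfolding inner_add_right
        by (intro line_poly_add line_poly_const line_poly_linear linearI) (simp_all add: inner_add_right)
    qed (auto intro!: continuous_intros linearI simp: case_prod_beta')
    moreover have "AE y in M. c (fst y) \<noteq> 0" by (rule lift[OF c(2)]) measurable
    ultimately show ?thesis
    proof eventually_elim
      case (elim y)
      show ?case
      proof
        assume "c (fst y) \<bullet> snd y = 0"
        \<comment> \<open>Moving by the coefficient vector itself adds its squared norm to the
          form.\<close>
        then have "c (fst y) \<bullet> (snd y + c (fst y)) = 0" using elim(1) unfolding case_prod_beta' by blast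
        then show False using \<open>c (fst y) \<bullet> snd y = 0\<close> elim(2) by (simp add: inner_add_right)
      qed
    qed
  qed
  have w2: "AE y in M. fst (snd y)$a \<noteq> 0" for a
    using linear_form[of "\<lambda>_. (axis a 1, 0)"] by (simp add: inner_prod_def inner_axis' axis_eq_0_iff zero_prod_def)
  have w3: "AE y in M. snd (snd y)$a \<noteq> 0" for a
    using linear_form[of "\<lambda>_. (0, axis a 1)"] by (simp add: inner_prod_def inner_axis' axis_eq_0_iff zero_prod_def)
  have two: "AE y in M. coeffs_of E (fst y)$u$v * fst (snd y)$u + coeffs_of E (fst y)$v$u * fst (snd y)$v \<noteq> 0"
    if uv: "(u, v) \<in> E" for u v
  proof -
    define c where "c p = (coeffs_of E p$u$v *\<^sub>R axis u 1 + coeffs_of E p$v$u *\<^sub>R axis v 1 :: real^'n,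
      0 :: real^'n)" for p
    have "u \<noteq> v" using E uv by (auto simp: irrefl_def)
    then have "fst (c p)$u = coeffs_of E p$u$v" for p by (simp add: c_def axis_def)
    then have nz: "c p \<noteq> 0" if "coeffs_of E p$u$v \<noteq> 0" for p using that by (metis fst_zero zero_index)
    have "AE p in P. c p \<noteq> 0" using edge[OF uv] by eventually_elim (rule nz)
    moreover have "c \<in> borel_measurable P" unfolding c_def by measurable
    ultimately show ?thesis
      using linear_form[of c] by (simp add: c_def inner_prod_def inner_add_left inner_axis')
  qed
  \<comment> \<open>Only directions \<open>(0, c)\<close> are moved, so \<open>B\<close> and the
    second moments stay fixed.\<close>
  have tests: "AE y in M. let B = matrix_inv (mat 1 - coeffs_of E (fst y)) in
        f (second_of W B (fst (snd y))) (third_of W B (snd (snd y))) = 0 \<longrightarrow>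
        (\<forall>z. f (second_of W B (fst (snd y))) (third_of W B z) = 0)"
    if f: "f \<in> moment_tests" for f W
  proof -
    define B where "B p = matrix_inv (mat 1 - coeffs_of E p)" for p
    have [measurable]: "(\<lambda>p. B p$i$j) \<in> borel_measurable P" for i j
      unfolding B_def by (rule borel_measurable_matrix_inv) simp
    have "AE (p, x) in M. f (second_of W (B p) (fst x)) (third_of W (B p) (snd x)) = 0 \<longrightarrow>
        (\<forall>c. f (second_of W (B p) (fst (x + (0, c)))) (third_of W (B p) (snd (x + (0, c)))) = 0)"
      unfolding M_def
    proof (intro AE_poly_zero_imp_zero[OF P _ lin])
      show "(\<lambda>(p, x). f (second_of W (B p) (fst x)) (third_of W (B p) (snd x)))
          \<in> borel_measurable (P \<Otimes>\<^sub>M (borel :: ((real^'n) \<times> (real^'n)) measure))"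
        unfolding case_prod_beta'
        by (rule borel_measurable_moment_test[OF f]) (simp_all add: second_of_def third_of_def)
      fix p and x :: "(real^'n) \<times> (real^'n)"
      have lp: "line_poly (\<lambda>c. third_of W (B p) (snd x + c)$i$j$k)"
        and ct: "continuous_on UNIV (\<lambda>c. third_of W (B p) (snd x + c)$i$j$k)" for i j k
        using coord[of "snd x"] coord[of 0] unfolding third_of_def
        by (auto intro!: line_poly_sum line_poly_mult line_poly_const continuous_intros simp del: vector_add_component)
      show "line_poly (\<lambda>c. f (second_of W (B p) (fst (x + (0, c)))) (third_of W (B p) (snd (x + (0, c)))))"
        "continuous_on UNIV (\<lambda>c. f (second_of W (B p) (fst (x + (0, c)))) (third_of W (B p) (snd (x + (0, c)))))"
        unfolding fst_add snd_add fst_conv snd_conv add_0_right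
        by (rule line_poly_moment_test[OF f lp], rule continuous_on_moment_test[OF f ct])
    qed
    then show ?thesis
    proof eventually_elim
      case (elim y)
      have "f (second_of W (B (fst y)) (fst (snd y))) (third_of W (B (fst y)) z) = 0"
        if "f (second_of W (B (fst y)) (fst (snd y))) (third_of W (B (fst y)) (snd (snd y))) = 0" for z
      proof -
        have "\<forall>c. f (second_of W (B (fst y)) (fst (snd y))) (third_of W (B (fst y)) (snd (snd y) + c)) = 0"
          using elim that by (simp add: case_prod_beta')
        from this[rule_format, of "z - snd (snd y)"] show ?thesis by simp
      qed
      then show ?case by (simp add: B_def Let_def)
    qed
  qed
  have "AE y in M. (\<forall>e\<in>E. coeffs_of E (fst y)$fst e$snd e \<noteq> 0) \<and>
      (\<forall>a\<in>UNIV. fst (snd y)$a \<noteq> 0) \<and> (\<forall>a\<in>UNIV. snd (snd y)$a \<noteq> 0) \<and>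
      (\<forall>e\<in>E. coeffs_of E (fst y)$fst e$snd e * fst (snd y)$fst e + coeffs_of E (fst y)$snd e$fst e * fst (snd y)$snd e \<noteq> 0) \<and>
      (\<forall>W\<in>UNIV. \<forall>f\<in>moment_tests. let B = matrix_inv (mat 1 - coeffs_of E (fst y)) in
        f (second_of W B (fst (snd y))) (third_of W B (snd (snd y))) = 0 \<longrightarrow>
        (\<forall>z. f (second_of W B (fst (snd y))) (third_of W B z) = 0))"
    by (intro AE_conjI AE_finite_allI finite_moment_tests edges w2 w3 two tests) auto
  then show ?thesis
    unfolding PM by eventually_elim (auto simp: generic_parameter_def case_prod_beta')
qed

lemma null_set_of_nongeneric_parameters:
  fixes E :: "'n::finite digraph"
  assumes "irrefl E"
  obtains N where "N \<in> null_sets (parameter_measure E)"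
    "\<And>\<Lambda> \<Omega>2 \<Omega>3. \<Lambda> \<in> edge_coeffs E \<Longrightarrow> parameters E \<Lambda> \<Omega>2 \<Omega>3 \<notin> N \<Longrightarrow>
      generic_parameter E \<Lambda> (\<chi> a. \<Omega>2$a$a) (\<chi> a. \<Omega>3$a$a$a)"
proof -
  obtain N where N: "{y \<in> space (parameter_measure E). \<not> (case y of (p, w2, w3) \<Rightarrow> generic_parameter E (coeffs_of E p) w2 w3)} \<subseteq> N"
    "emeasure (parameter_measure E) N = 0" "N \<in> sets (parameter_measure E)"
    using AE_E[OF AE_generic_parameter[OF assms]] by blast
  show ?thesis
  proof
    show "N \<in> null_sets (parameter_measure E)" using N by auto
    fix \<Lambda> :: "real^'n^'n" and \<Omega>2 :: "real^'n^'n" and \<Omega>3 :: "real^'n^'n^'n"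
    assume \<Lambda>: "\<Lambda> \<in> edge_coeffs E" and notin: "parameters E \<Lambda> \<Omega>2 \<Omega>3 \<notin> N"
    have out: "parameters E \<Lambda> \<Omega>2 \<Omega>3 \<notin> {y \<in> space (parameter_measure E).
        \<not> (case y of (p, w2, w3) \<Rightarrow> generic_parameter E (coeffs_of E p) w2 w3)}"
      by (rule contra_subsetD[OF N(1) notin])
    have "parameters E \<Lambda> \<Omega>2 \<Omega>3 \<in> space (parameter_measure E)"
      by (auto simp: parameters_def parameter_measure_def space_pair_measure space_PiM)
    then have "case parameters E \<Lambda> \<Omega>2 \<Omega>3 of (p, w2, w3) \<Rightarrow> generic_parameter E (coeffs_of E p) w2 w3"
      using out by simp
    then show "generic_parameter E \<Lambda> (\<chi> a. \<Omega>2$a$a) (\<chi> a. \<Omega>3$a$a$a)"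
      by (simp add: parameters_def coeffs_of_restrict[OF \<Lambda>])
  qed
qed

section \<open>Correctness of the algorithm\<close>

context lsem_generic
begin

text \<open>The invariant of the rounds. Parent-closedness of a component together with everything
  earlier is what the regression between components rests on; since \<pi> preserves each component,
  blocks can be treated separately.\<close>

definition decomposition :: "'n set \<Rightarrow> 'n set set list \<Rightarrow> ('n \<Rightarrow> 'n) \<Rightarrow> bool" where
  "decomposition W Ls \<pi> \<longleftrightarrow> \<Union>(\<Union>(set Ls)) = W \<and> \<pi> permutes W \<and> (\<forall>j. (j, \<pi> j) \<in> E\<^sup>=) \<and>
     (\<forall>k<length Ls. \<forall>D\<in>Ls ! k. D \<inter> earlier Ls k = {} \<and> (\<forall>D'\<in>Ls ! k. D' \<noteq> D \<longrightarrow> D \<inter> D' = {}) \<and>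
        parent_closed E W (earlier Ls k \<union> D) \<and> \<pi> ` D \<subseteq> D)"

lemma decompositionD:
  assumes "decomposition W Ls \<pi>"
  shows "\<Union>(\<Union>(set Ls)) = W" "\<pi> permutes W" "(j, \<pi> j) \<in> E\<^sup>="
    and "k < length Ls \<Longrightarrow> D \<in> Ls ! k \<Longrightarrow> D \<inter> earlier Ls k = {} \<and>
      (\<forall>D'\<in>Ls ! k. D' \<noteq> D \<longrightarrow> D \<inter> D' = {}) \<and> parent_closed E W (earlier Ls k \<union> D) \<and> \<pi> ` D \<subseteq> D"
proof -
  note * = assms[unfolded decomposition_def]
  show "\<Union>(\<Union>(set Ls)) = W" by (rule *[THEN conjunct1])
  show "\<pi> permutes W" by (rule *[THEN conjunct2, THEN conjunct1])
  show "(j, \<pi> j) \<in> E\<^sup>=" by (rule *[THEN conjunct2, THEN conjunct2, THEN conjunct1, THEN spec])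
  assume "k < length Ls" "D \<in> Ls ! k"
  then show "D \<inter> earlier Ls k = {} \<and>
      (\<forall>D'\<in>Ls ! k. D' \<noteq> D \<longrightarrow> D \<inter> D' = {}) \<and> parent_closed E W (earlier Ls k \<union> D) \<and> \<pi> ` D \<subseteq> D"
    by (rule *[THEN conjunct2, THEN conjunct2, THEN conjunct2, THEN spec, THEN mp, THEN bspec])
qed

definition block_coeffs :: "'n set set \<Rightarrow> ('n \<Rightarrow> 'n) \<Rightarrow> real^'n^'n" where
  "block_coeffs \<D> \<pi> = (\<chi> i j. if \<exists>D\<in>\<D>. i \<in> D \<and> j \<in> D then reparam \<Lambda> \<pi>$i$j else 0)"

lemma reparam_cong: "\<pi> j = \<pi>' j \<Longrightarrow> reparam \<Lambda> \<pi>$i$j = reparam \<Lambda> \<pi>'$i$j"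
  by (simp add: reparam_def)

lemma earlier_Cons: "earlier (\<D> # Ls) k = (case k of 0 \<Rightarrow> {} | Suc m \<Rightarrow> \<Union>\<D> \<union> earlier Ls m)"
proof (cases k)
  case (Suc m)
  have "{..<Suc m} = insert 0 (Suc ` {..<m})" by (rule lessThan_Suc_eq_insert_0)
  then show ?thesis by (simp add: Suc earlier_def)
qed (simp add: earlier_def)

text \<open>The permutations of the current round and of the later ones have disjoint supports, so
  their composition restricts to each. The coefficient blocks do not overlap, hence no entry cancels
  in the sum.\<close>

lemma decomposition_Cons:
  assumes D: "\<Union>\<D> \<subseteq> W" "\<And>D. D \<in> \<D> \<Longrightarrow> parent_closed E W D"
    "\<And>D D'. D \<in> \<D> \<Longrightarrow> D' \<in> \<D> \<Longrightarrow> D \<noteq> D' \<Longrightarrow> D \<inter> D' = {}"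
    and \<pi>0: "\<pi>0 permutes \<Union>\<D>" "\<And>j. (j, \<pi>0 j) \<in> E\<^sup>=" "\<And>D. D \<in> \<D> \<Longrightarrow> \<pi>0 ` D \<subseteq> D"
    and dec: "decomposition (W - \<Union>\<D>) Ls \<pi>1"
  obtains \<pi> where "decomposition W (\<D> # Ls) \<pi>"
    "block_coeffs (\<Union>(set (\<D> # Ls))) \<pi> = block_coeffs \<D> \<pi>0 + block_coeffs (\<Union>(set Ls)) \<pi>1"
    "{(i, j). block_coeffs (\<Union>(set (\<D> # Ls))) \<pi>$i$j \<noteq> 0} =
      {(i, j). block_coeffs \<D> \<pi>0$i$j \<noteq> 0} \<union> {(i, j). block_coeffs (\<Union>(set Ls)) \<pi>1$i$j \<noteq> 0}"
proof -
  define A where "A = \<Union>\<D>"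
  define \<pi> where "\<pi> = \<pi>1 \<circ> \<pi>0"
  note un = decompositionD(1)[OF dec, folded A_def]
  note \<pi>1 = decompositionD(2,3)[OF dec, folded A_def]
  note lev = decompositionD(4)[OF dec, folded A_def]
  have later: "D \<subseteq> W - A" if "D \<in> \<Union>(set Ls)" for D using un that by blast
  have \<pi>A: "\<pi> j = \<pi>0 j" if "j \<in> A" for j
  proof -
    have "\<pi>0 j \<in> A" using permutes_in_image[OF \<pi>0(1), of j] that by (simp only: A_def)
    then show ?thesis using \<pi>1(1) by (auto simp: \<pi>_def permutes_not_in)
  qed
  have \<pi>W: "\<pi> j = \<pi>1 j" if "j \<notin> A" for j
    using \<pi>0(1) that by (simp add: \<pi>_def A_def permutes_not_in)
  have perm: "\<pi> permutes W"
  proof -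
    have "\<pi>0 permutes W" using \<pi>0(1) D(1) by (rule permutes_subset)
    moreover have "\<pi>1 permutes W" using \<pi>1(1) by (rule permutes_subset) auto
    ultimately show ?thesis unfolding \<pi>_def by (rule permutes_compose)
  qed
  have clA: "parent_closed E W A" using D(2) unfolding A_def parent_closed_def by blast
  show ?thesis
  proof
    show "decomposition W (\<D> # Ls) \<pi>"
      unfolding decomposition_def
    proof (intro conjI allI impI ballI)
      show "\<Union>(\<Union>(set (\<D> # Ls))) = W" using un D(1) by (auto simp: A_def)
      show "\<pi> permutes W" by (rule perm)
      show "(j, \<pi> j) \<in> E\<^sup>=" for j using \<pi>A \<pi>W \<pi>0(2) \<pi>1(2) by (cases "j \<in> A") auto
      fix k D assume k: "k < length (\<D> # Ls)" and Dk: "D \<in> (\<D> # Ls) ! k"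
      show "D \<inter> earlier (\<D> # Ls) k = {}"
      proof (cases k)
        case (Suc m)
        then have m: "m < length Ls" "D \<in> Ls ! m" using k Dk by auto
        then have "D \<in> \<Union>(set Ls)" using nth_mem by blast
        then have "D \<subseteq> W - A" by (rule later)
        moreover have "D \<inter> earlier Ls m = {}" using lev[OF m] by (rule conjunct1)
        moreover have "earlier (\<D> # Ls) k = A \<union> earlier Ls m" by (simp add: Suc earlier_Cons A_def)
        ultimately show ?thesis by (simp only:) blast
      qed (simp add: earlier_Cons)
      show "D \<inter> D' = {}" if "D' \<in> (\<D> # Ls) ! k" "D' \<noteq> D" for D'
      proof (cases k)
        case 0
        then show ?thesis using assms(3)[of D D'] Dk that by auto
      next
        case (Suc m)
        then have m: "m < length Ls" "D \<in> Ls ! m" "D' \<in> Ls ! m" using k Dk that(1) by auto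
        then show ?thesis using lev[OF m(1,2), THEN conjunct2, THEN conjunct1] that(2) by blast
      qed
      show "parent_closed E W (earlier (\<D> # Ls) k \<union> D)"
      proof (cases k)
        case 0
        then show ?thesis using assms(2)[of D] Dk by (simp add: earlier_Cons)
      next
        case (Suc m)
        then have m: "m < length Ls" "D \<in> Ls ! m" using k Dk by auto
        then have "parent_closed E (W - A) (earlier Ls m \<union> D)"
          by (intro lev[THEN conjunct2, THEN conjunct2, THEN conjunct1])
        then have "parent_closed E W (A \<union> (earlier Ls m \<union> D))"
          using clA unfolding parent_closed_def by blast
        then show ?thesis by (simp add: Suc earlier_Cons A_def Un_assoc)
      qed
      show "\<pi> ` D \<subseteq> D"
      proof (cases k)
        case 0
        then have "D \<in> \<D>" "D \<subseteq> A" using Dk by (auto simp: A_def)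
        then show ?thesis using \<pi>0(3)[of D] \<pi>A by (metis image_cong subsetD)
      next
        case (Suc m)
        then have m: "m < length Ls" "D \<in> Ls ! m" using k Dk by auto
        then have "D \<in> \<Union>(set Ls)" using nth_mem by blast
        then have "D \<subseteq> W - A" by (rule later)
        then have "\<pi> ` D = \<pi>1 ` D" using \<pi>W by (intro image_cong) auto
        then show ?thesis using lev[OF m] by simp
      qed
    qed
    have entry: "block_coeffs (\<Union>(set (\<D> # Ls))) \<pi>$i$j =
        (if \<exists>D\<in>\<D>. i \<in> D \<and> j \<in> D then reparam \<Lambda> \<pi>0$i$j else
         if \<exists>D\<in>\<Union>(set Ls). i \<in> D \<and> j \<in> D then reparam \<Lambda> \<pi>1$i$j else 0)" for i j
    proof -
      consider "\<exists>D\<in>\<D>. i \<in> D \<and> j \<in> D"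
        | "\<not> (\<exists>D\<in>\<D>. i \<in> D \<and> j \<in> D)" "\<exists>D\<in>\<Union>(set Ls). i \<in> D \<and> j \<in> D"
        | "\<not> (\<exists>D\<in>\<D>. i \<in> D \<and> j \<in> D)" "\<not> (\<exists>D\<in>\<Union>(set Ls). i \<in> D \<and> j \<in> D)" by blast
      then show ?thesis
      proof cases
        case 1
        then have "j \<in> A" by (auto simp: A_def)
        then have "reparam \<Lambda> \<pi>$i$j = reparam \<Lambda> \<pi>0$i$j" by (intro reparam_cong \<pi>A)
        then show ?thesis using 1 by (auto simp: block_coeffs_def)
      next
        case 2
        then have "j \<notin> A" using later by blast
        then have "reparam \<Lambda> \<pi>$i$j = reparam \<Lambda> \<pi>1$i$j" by (intro reparam_cong \<pi>W)
        then show ?thesis using 2 by (auto simp: block_coeffs_def)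
      next
        case 3
        then show ?thesis by (auto simp: block_coeffs_def)
      qed
    qed
    have disj: "\<not> (\<exists>D\<in>\<Union>(set Ls). i \<in> D \<and> j \<in> D)" if "\<exists>D\<in>\<D>. i \<in> D \<and> j \<in> D" for i j
    proof -
      have "j \<in> A" using that by (auto simp: A_def)
      then show ?thesis using later by blast
    qed
    have sum: "block_coeffs (\<Union>(set (\<D> # Ls))) \<pi>$i$j =
        block_coeffs \<D> \<pi>0$i$j + block_coeffs (\<Union>(set Ls)) \<pi>1$i$j"
      and zero: "block_coeffs \<D> \<pi>0$i$j = 0 \<or> block_coeffs (\<Union>(set Ls)) \<pi>1$i$j = 0" for i j
      unfolding entry using disj[of i j] by (auto simp: block_coeffs_def)
    show "block_coeffs (\<Union>(set (\<D> # Ls))) \<pi> = block_coeffs \<D> \<pi>0 + block_coeffs (\<Union>(set Ls)) \<pi>1"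
      using sum by (simp add: vec_eq_iff)
    have "block_coeffs (\<Union>(set (\<D> # Ls))) \<pi>$i$j \<noteq> 0 \<longleftrightarrow>
        block_coeffs \<D> \<pi>0$i$j \<noteq> 0 \<or> block_coeffs (\<Union>(set Ls)) \<pi>1$i$j \<noteq> 0" for i j
      using sum[of i j] zero[of i j] by auto
    then show "{(i, j). block_coeffs (\<Union>(set (\<D> # Ls))) \<pi>$i$j \<noteq> 0} =
      {(i, j). block_coeffs \<D> \<pi>0$i$j \<noteq> 0} \<union> {(i, j). block_coeffs (\<Union>(set Ls)) \<pi>1$i$j \<noteq> 0}" by auto
  qed
qed

text \<open>Choices in the cycles of one round are independent. As the cycles are disjoint, the
  permutations \<open>p C\<close> glue to one.\<close>

lemma combine_orientations:
  assumes \<D>: "\<And>C C'. C \<in> \<D> \<Longrightarrow> C' \<in> \<D> \<Longrightarrow> C \<noteq> C' \<Longrightarrow> C \<inter> C' = {}"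
    and p: "\<And>C. C \<in> \<D> \<Longrightarrow> p C permutes C" "\<And>C j. C \<in> \<D> \<Longrightarrow> (j, p C j) \<in> E\<^sup>="
    and L: "\<And>C. C \<in> \<D> \<Longrightarrow> L C = (\<chi> i j. if i \<in> C \<and> j \<in> C then reparam \<Lambda> (p C)$i$j else 0)"
    and F: "\<And>C. C \<in> \<D> \<Longrightarrow> F C = {(i, j). L C$i$j \<noteq> 0}"
  obtains \<pi> where "\<pi> permutes \<Union>\<D>" "\<And>j. (j, \<pi> j) \<in> E\<^sup>=" "\<And>C. C \<in> \<D> \<Longrightarrow> \<pi> ` C \<subseteq> C"
    "(\<Sum>C\<in>\<D>. L C) = block_coeffs \<D> \<pi>" "(\<Union>C\<in>\<D>. F C) = {(i, j). block_coeffs \<D> \<pi>$i$j \<noteq> 0}"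
proof -
  define comp where "comp j = (SOME C. C \<in> \<D> \<and> j \<in> C)" for j
  define \<pi> where "\<pi> j = (if j \<in> \<Union>\<D> then p (comp j) j else j)" for j
  have uniq: "C = C'" if "C \<in> \<D>" "C' \<in> \<D>" "j \<in> C" "j \<in> C'" for C C' j
    using \<D>[OF that(1,2)] that by blast
  have comp: "comp j = C" if "C \<in> \<D>" "j \<in> C" for C j
  proof -
    have "\<exists>C. C \<in> \<D> \<and> j \<in> C" using that by blast
    then have "comp j \<in> \<D> \<and> j \<in> comp j" unfolding comp_def by (rule someI_ex)
    then show ?thesis by (intro uniq[OF _ that(1) _ that(2)]) simp_all
  qed
  have \<pi>C: "\<pi> j = p C j" if "C \<in> \<D>" "j \<in> C" for C j
    using comp[OF that] that by (auto simp: \<pi>_def)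
  have inC: "\<pi> j \<in> C" if "C \<in> \<D>" "j \<in> C" for C j
    using \<pi>C[OF that] p(1)[OF that(1)] that(2) by (simp add: permutes_in_image)
  have inj: "inj_on \<pi> (\<Union>\<D>)"
  proof (rule inj_onI)
    fix i j assume "i \<in> \<Union>\<D>" "j \<in> \<Union>\<D>" and eq: "\<pi> i = \<pi> j"
    then obtain C C' where C: "C \<in> \<D>" "i \<in> C" "C' \<in> \<D>" "j \<in> C'" by blast
    have "\<pi> i \<in> C" "\<pi> i \<in> C'" using inC[OF C(1,2)] inC[OF C(3,4)] eq by simp_all
    then have CC: "C = C'" by (rule uniq[OF C(1,3)])
    have "p C i = p C j" using \<pi>C[OF C(1,2)] \<pi>C[OF C(3,4)] eq CC by simp
    then show "i = j" using permutes_inj[OF p(1)[OF C(1)]] by (simp add: inj_eq)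
  qed
  have perm: "\<pi> permutes \<Union>\<D>"
  proof (rule bij_imp_permutes)
    have "\<pi> ` \<Union>\<D> \<subseteq> \<Union>\<D>" using inC by blast
    then show "bij_betw \<pi> (\<Union>\<D>) (\<Union>\<D>)" using inj by (simp add: bij_betw_def endo_inj_surj)
  qed (simp add: \<pi>_def)
  have entry: "(\<Sum>C\<in>\<D>. L C)$i$j = block_coeffs \<D> \<pi>$i$j" for i j
  proof (cases "\<exists>C\<in>\<D>. i \<in> C \<and> j \<in> C")
    case True
    then obtain C where C: "C \<in> \<D>" "i \<in> C" "j \<in> C" by blast
    have "(\<Sum>C\<in>\<D>. L C)$i$j = (\<Sum>C\<in>\<D>. L C$i$j)" by simp
    also have "\<dots> = (\<Sum>C'\<in>\<D>. if C' = C then L C$i$j else 0)"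
      using uniq C by (intro sum.cong) (auto simp: L)
    also have "\<dots> = reparam \<Lambda> (p C)$i$j" using C by (simp add: L)
    also have "\<dots> = reparam \<Lambda> \<pi>$i$j" using \<pi>C C by (intro reparam_cong) auto
    finally show ?thesis using True by (simp add: block_coeffs_def)
  next
    case False
    have "(\<Sum>C\<in>\<D>. L C)$i$j = (\<Sum>C\<in>\<D>. L C$i$j)" by simp
    also have "\<dots> = 0" using False by (intro sum.neutral) (auto simp: L)
    finally show ?thesis using False by (auto simp: block_coeffs_def)
  qed
  show ?thesis
  proof
    show "\<pi> permutes \<Union>\<D>" by (rule perm)
    show "(j, \<pi> j) \<in> E\<^sup>=" for j
    proof (cases "j \<in> \<Union>\<D>")
      case True
      then obtain C where C: "C \<in> \<D>" "j \<in> C" by blast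
      show ?thesis unfolding \<pi>C[OF C] by (rule p(2)[OF C(1)])
    qed (auto simp: \<pi>_def)
    show "C \<in> \<D> \<Longrightarrow> \<pi> ` C \<subseteq> C" for C using inC by blast
    show "(\<Sum>C\<in>\<D>. L C) = block_coeffs \<D> \<pi>" using entry by (simp add: vec_eq_iff)
    have "(\<exists>C\<in>\<D>. L C$i$j \<noteq> 0) \<longleftrightarrow> block_coeffs \<D> \<pi>$i$j \<noteq> 0" for i j
    proof
      assume "\<exists>C\<in>\<D>. L C$i$j \<noteq> 0"
      then obtain C where C: "C \<in> \<D>" "L C$i$j \<noteq> 0" by blast
      then have ij: "i \<in> C" "j \<in> C" by (auto simp: L split: if_splits)
      then have "reparam \<Lambda> (p C)$i$j = reparam \<Lambda> \<pi>$i$j" using \<pi>C C by (intro reparam_cong) auto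
      then show "block_coeffs \<D> \<pi>$i$j \<noteq> 0" using C ij by (auto simp: block_coeffs_def L)
    next
      assume nz: "block_coeffs \<D> \<pi>$i$j \<noteq> 0"
      show "\<exists>C\<in>\<D>. L C$i$j \<noteq> 0"
      proof (rule ccontr)
        assume "\<not> ?thesis"
        then have "(\<Sum>C\<in>\<D>. L C)$i$j = 0" by simp
        then show False using nz entry[of i j] by simp
      qed
    qed
    moreover have "(\<Union>C\<in>\<D>. F C) = (\<Union>C\<in>\<D>. {(i, j). L C$i$j \<noteq> 0})" using F by simp
    ultimately show "(\<Union>C\<in>\<D>. F C) = {(i, j). block_coeffs \<D> \<pi>$i$j \<noteq> 0}" by auto
  qed
qed

theorem part1_correct:
  assumes "choice_rule ori" "choice_rule wt" "terminal W" "agrees W S T"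
  shows "\<exists>Ls \<pi>. decomposition W Ls \<pi> \<and>
    part1 ori wt W S T = Some (Ls, {(i, j). block_coeffs (\<Union>(set Ls)) \<pi>$i$j \<noteq> 0}, block_coeffs (\<Union>(set Ls)) \<pi>)"
  using assms(3,4)
proof (induction "card W" arbitrary: W S T rule: less_induct)
  case less
  note W = less.prems(1) and ST = less.prems(2)
  have step: "\<exists>Ls \<pi>. decomposition (W - A) Ls \<pi> \<and>
      part1 ori wt (W - A) (residual_second A S) (residual_third A S T) =
        Some (Ls, {(i, j). block_coeffs (\<Union>(set Ls)) \<pi>$i$j \<noteq> 0}, block_coeffs (\<Union>(set Ls)) \<pi>)"
    if "A \<noteq> {}" "A \<subseteq> W" "parent_closed E W A" for A
  proof (rule less.hyps)
    have "W - A \<subset> W" using that by blast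
    then show "card (W - A) < card W" by (intro psubset_card_mono) auto
    show "terminal (W - A)" using W that(3) by (rule terminal_diff)
    show "agrees (W - A) (residual_second A S) (residual_third A S T)"
      using agrees_residual[OF W that(3,2) ST] .
  qed
  consider "W = {}" | "W \<noteq> {}" "root_nodes W S T \<noteq> {}" | "W \<noteq> {}" "root_nodes W S T = {}" by blast
  then show ?case
  proof cases
    case 1
    have "decomposition W [] id" by (auto simp: decomposition_def 1 permutes_id)
    moreover have "block_coeffs {} id = 0" by (simp add: block_coeffs_def vec_eq_iff)
    ultimately show ?thesis
      using 1 by (intro exI[of _ "[]"] exI[of _ id]) (simp add: part1.simps[of ori wt "{}"])
  next
    case 2
    define A where "A = root_nodes W S T"
    define \<D> where "\<D> = (\<lambda>r. {r}) ` A"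
    have A: "A \<noteq> {}" "A \<subseteq> W" "\<And>r p. r \<in> A \<Longrightarrow> p \<in> W \<Longrightarrow> (p, r) \<notin> E"
      using 2 root_nodes_eq[OF W ST] by (auto simp: A_def)
    have UD: "\<Union>\<D> = A" by (auto simp: \<D>_def)
    have "parent_closed E W A" using A(3) by (auto simp: parent_closed_def)
    then obtain Ls \<pi>1 where rec: "decomposition (W - A) Ls \<pi>1"
      "part1 ori wt (W - A) (residual_second A S) (residual_third A S T) =
        Some (Ls, {(i, j). block_coeffs (\<Union>(set Ls)) \<pi>1$i$j \<noteq> 0}, block_coeffs (\<Union>(set Ls)) \<pi>1)"
      using step[OF A(1,2)] by blast
    obtain \<pi> where \<pi>: "decomposition W (\<D> # Ls) \<pi>"
      "block_coeffs (\<Union>(set (\<D> # Ls))) \<pi> = block_coeffs \<D> id + block_coeffs (\<Union>(set Ls)) \<pi>1"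
    proof (rule decomposition_Cons[of \<D> W id Ls \<pi>1])
      show "\<Union>\<D> \<subseteq> W" using A UD by simp
      show "parent_closed E W D" if "D \<in> \<D>" for D
        using that A(3) by (auto simp: \<D>_def parent_closed_def)
      show "decomposition (W - \<Union>\<D>) Ls \<pi>1" using rec(1) UD by simp
    qed (auto simp: \<D>_def permutes_id)
    \<comment> \<open>The components are singletons, and \<open>reparam \<Lambda> id\<close> has
      zero diagonal.\<close>
    have "block_coeffs \<D> id = 0"
      by (auto simp: block_coeffs_def vec_eq_iff \<D>_def reparam_nth)
    then have "block_coeffs (\<Union>(set (\<D> # Ls))) \<pi> = block_coeffs (\<Union>(set Ls)) \<pi>1" using \<pi>(2) by simp
    moreover have "part1 ori wt W S T =
        Some (\<D> # Ls, {(i, j). block_coeffs (\<Union>(set Ls)) \<pi>1$i$j \<noteq> 0}, block_coeffs (\<Union>(set Ls)) \<pi>1)"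
      using 2 rec(2) by (subst part1.simps) (simp add: Let_def \<D>_def flip: A_def)
    ultimately show ?thesis using \<pi>(1) by metis
  next
    case 3
    define \<D> where "\<D> = root_cycles W S T"
    define orient where "orient C = ori (orientations S C)" for C
    define L where "L C = wt (cycle_weights S T C (orient C))" for C
    have parent: "\<exists>p\<in>W. (p, r) \<in> E" if "r \<in> W" for r
      using 3 root_nodes_eq[OF W ST] that by auto
    have \<D>: "\<D> = {set vs |vs. root_cycle E W vs}"
      unfolding \<D>_def by (rule root_cycles_eq[OF W ST 3(1) parent])
    \<comment> \<open>Without root nodes every vertex of \<open>W\<close> has a parent in
      \<open>W\<close>, so \<open>W\<close> contains a root cycle and the run does not get
      stuck.\<close>
    have "parent_closed E W W" by (auto simp: parent_closed_def)
    then obtain vs0 where "root_cycle E W vs0"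
      using root_cycle_exists[OF irrefl acyc subset_refl 3(1)] parent by blast
    then have ne: "set vs0 \<in> \<D>" "set vs0 \<noteq> {}" using root_cycleD(6) by (auto simp: \<D>)
    have Dprop: "C \<subseteq> W" "parent_closed E W C" if "C \<in> \<D>" for C
      using that root_cycleD(3,4) by (auto simp: \<D>)
    have disj: "C \<inter> C' = {}" if "C \<in> \<D>" "C' \<in> \<D>" "C \<noteq> C'" for C C'
      using that root_cycles_disjoint[OF acyc] unfolding \<D> by blast
    have good: "orientations S C \<noteq> {}" "cycle_weights S T C (orient C) \<noteq> {}"
      "\<exists>\<pi>. \<pi> permutes C \<and> (\<forall>j. (j, \<pi> j) \<in> E\<^sup>=) \<and> orient C = {(i, j). L C$i$j \<noteq> 0} \<and>
        L C = (\<chi> i j. if i \<in> C \<and> j \<in> C then reparam \<Lambda> \<pi>$i$j else 0)" if CD: "C \<in> \<D>" for C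
    proof -
      obtain vs where C: "C = set vs" and rc: "root_cycle E W vs" using CD unfolding \<D> by blast
      note choices = root_cycle_choices[OF W rc ST]
      show o: "orientations S C \<noteq> {}" unfolding C by (rule choices(1))
      then have F: "orient C \<in> orientations S (set vs)"
        using assms(1) C by (auto simp: choice_rule_def orient_def)
      show cw: "cycle_weights S T C (orient C) \<noteq> {}" unfolding C using choices(2) F C by blast
      then have "L C \<in> cycle_weights S T (set vs) (orient C)"
        using assms(2) C by (auto simp: choice_rule_def L_def)
      then obtain \<pi> where \<pi>: "orient_perm vs \<pi>" "orient C = {(i, j). L C$i$j \<noteq> 0}"
        "L C = (\<chi> i j. if i \<in> set vs \<and> j \<in> set vs then reparam \<Lambda> \<pi>$i$j else 0)"
        using choices(3)[OF F] by blast
      have "(j, \<pi> j) \<in> E\<^sup>=" for j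
      proof (cases "\<pi> = id \<or> j \<notin> set vs")
        case True
        then show ?thesis using orient_perm_permutes[OF \<pi>(1)] by (auto simp: permutes_not_in)
      next
        case False
        then show ?thesis using \<pi>(1) root_cycleD(5)[OF rc] by (auto simp: orient_perm_def)
      qed
      then show "\<exists>\<pi>. \<pi> permutes C \<and> (\<forall>j. (j, \<pi> j) \<in> E\<^sup>=) \<and> orient C = {(i, j). L C$i$j \<noteq> 0} \<and>
        L C = (\<chi> i j. if i \<in> C \<and> j \<in> C then reparam \<Lambda> \<pi>$i$j else 0)"
        using \<pi> orient_perm_permutes[OF \<pi>(1)] C by blast
    qed
    define Q where "Q C \<pi> \<longleftrightarrow> \<pi> permutes C \<and> (\<forall>j. (j, \<pi> j) \<in> E\<^sup>=) \<and> orient C = {(i, j). L C$i$j \<noteq> 0} \<and>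
        L C = (\<chi> i j. if i \<in> C \<and> j \<in> C then reparam \<Lambda> \<pi>$i$j else 0)" for C \<pi>
    define p where "p C = (SOME \<pi>. Q C \<pi>)" for C
    have "Q C (p C)" if "C \<in> \<D>" for C
    proof -
      have "\<exists>\<pi>. Q C \<pi>" unfolding Q_def by (rule good(3)[OF that])
      then show ?thesis unfolding p_def by (rule someI_ex)
    qed
    note p = this[unfolded Q_def]
    obtain \<pi>0 where \<pi>0: "\<pi>0 permutes \<Union>\<D>" "\<And>j. (j, \<pi>0 j) \<in> E\<^sup>=" "\<And>C. C \<in> \<D> \<Longrightarrow> \<pi>0 ` C \<subseteq> C"
      "(\<Sum>C\<in>\<D>. L C) = block_coeffs \<D> \<pi>0" "(\<Union>C\<in>\<D>. orient C) = {(i, j). block_coeffs \<D> \<pi>0$i$j \<noteq> 0}"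
    proof (rule combine_orientations[of \<D> p L orient])
      show "C \<inter> C' = {}" if "C \<in> \<D>" "C' \<in> \<D>" "C \<noteq> C'" for C C' using that by (rule disj)
      fix C assume C: "C \<in> \<D>"
      show "p C permutes C" by (rule p[OF C, THEN conjunct1])
      show "(j, p C j) \<in> E\<^sup>=" for j by (rule p[OF C, THEN conjunct2, THEN conjunct1, THEN spec])
      show "orient C = {(i, j). L C$i$j \<noteq> 0}"
        by (rule p[OF C, THEN conjunct2, THEN conjunct2, THEN conjunct1])
      show "L C = (\<chi> i j. if i \<in> C \<and> j \<in> C then reparam \<Lambda> (p C)$i$j else 0)"
        by (rule p[OF C, THEN conjunct2, THEN conjunct2, THEN conjunct2])
    qed (rule that)
    have cl: "parent_closed E W (\<Union>\<D>)" using Dprop(2) unfolding parent_closed_def by blast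
    have UW: "\<Union>\<D> \<subseteq> W" using Dprop(1) by (rule Union_least)
    have Une: "\<Union>\<D> \<noteq> {}" using ne by auto
    obtain Ls \<pi>1 where rec: "decomposition (W - \<Union>\<D>) Ls \<pi>1"
      "part1 ori wt (W - \<Union>\<D>) (residual_second (\<Union>\<D>) S) (residual_third (\<Union>\<D>) S T) =
        Some (Ls, {(i, j). block_coeffs (\<Union>(set Ls)) \<pi>1$i$j \<noteq> 0}, block_coeffs (\<Union>(set Ls)) \<pi>1)"
      using step[OF Une UW cl] by blast
    obtain \<pi> where \<pi>: "decomposition W (\<D> # Ls) \<pi>"
      "block_coeffs (\<Union>(set (\<D> # Ls))) \<pi> = block_coeffs \<D> \<pi>0 + block_coeffs (\<Union>(set Ls)) \<pi>1"
      "{(i, j). block_coeffs (\<Union>(set (\<D> # Ls))) \<pi>$i$j \<noteq> 0} =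
        {(i, j). block_coeffs \<D> \<pi>0$i$j \<noteq> 0} \<union> {(i, j). block_coeffs (\<Union>(set Ls)) \<pi>1$i$j \<noteq> 0}"
      by (rule decomposition_Cons[OF UW Dprop(2) disj \<pi>0(1,2,3) rec(1)])
    have "\<not> (\<D> = {} \<or> (\<exists>C\<in>\<D>. orientations S C = {} \<or> cycle_weights S T C (orient C) = {}))"
      using ne(1) good(1,2) by auto
    then have "part1 ori wt W S T = Some (\<D> # Ls,
        (\<Union>C\<in>\<D>. orient C) \<union> {(i, j). block_coeffs (\<Union>(set Ls)) \<pi>1$i$j \<noteq> 0},
        (\<Sum>C\<in>\<D>. L C) + block_coeffs (\<Union>(set Ls)) \<pi>1)"
      using 3 rec(2)
      by (subst part1.simps) (simp add: Let_def L_def flip: \<D>_def orient_def)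
    then show ?thesis using \<pi> unfolding \<pi>0(4,5) by metis
  qed
qed

text \<open>Let \<open>A\<close> be the vertices before the component \<open>D0\<close> of
  \<open>d\<close>. As \<open>\<pi> d\<close> lies in \<open>D0\<close> and the union of
  \<open>A\<close> and \<open>D0\<close> is parent-closed, \<open>B ** N = mat 1\<close> makes the
  sum over \<open>D0\<close> the negative of the sum over \<open>A\<close>. Applying the block of
  \<open>N\<close> on \<open>A\<close> leaves \<open>- N$c$\<pi> d\<close>, which after scaling is
  the entry of \<open>reparam\<close>.\<close>

lemma part2_eq:
  assumes dec: "decomposition UNIV Ls \<pi>"
  shows "part2 Ls (block_coeffs (\<Union>(set Ls)) \<pi>) (S0 UNIV)$c$d =
    (if \<exists>D\<in>\<Union>(set Ls). c \<in> D \<and> d \<in> D then 0 else reparam \<Lambda> \<pi>$c$d)"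
proof -
  define L where "L = block_coeffs (\<Union>(set Ls)) \<pi>"
  note un = decompositionD(1)[OF dec] and edge = decompositionD(3)[OF dec] and lev = decompositionD(4)[OF dec]
  have nz: "N$j$\<pi> j \<noteq> 0" for j using edge N_nz by blast
  have sub: "D \<subseteq> earlier Ls m" if "k < m" "D \<in> Ls ! k" for k m D
    using that unfolding earlier_def by blast
  obtain k0 D0 where D0: "k0 < length Ls" "D0 \<in> Ls ! k0" "d \<in> D0"
    using un by (metis UNIV_I UnionE in_set_conv_nth)
  have uniq: "k = k0 \<and> D = D0" if kD: "k < length Ls" "D \<in> Ls ! k" "d \<in> D" for k D
  proof -
    consider "k < k0" | "k0 < k" | "k = k0" by linarith
    then show ?thesis
    proof cases
      case 1
      then show ?thesis using sub[OF 1 kD(2)] lev[OF D0(1,2)] kD(3) D0(3) by blast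
    next
      case 2
      then show ?thesis using sub[OF 2 D0(2)] lev[OF kD(1,2)] kD(3) D0(3) by blast
    next
      case 3
      then show ?thesis using lev[OF D0(1,2)] kD D0(3) by blast
    qed
  qed
  define A where "A = earlier Ls k0"
  have D0A: "D0 \<inter> A = {}" and cl: "parent_closed E UNIV (A \<union> D0)" and \<pi>D0: "\<pi> d \<in> D0"
    using lev[OF D0(1,2)] D0(3) by (auto simp: A_def)
  have clA: "parent_closed E UNIV A"
    unfolding parent_closed_def
  proof clarify
    fix p c assume pc: "(p, c) \<in> E" "c \<in> A"
    then obtain m D where m: "m < k0" "D \<in> Ls ! m" "c \<in> D" unfolding A_def earlier_def by blast
    then have "parent_closed E UNIV (earlier Ls m \<union> D)" using lev D0(1) by simp
    then have "p \<in> earlier Ls m \<union> D" using pc m parent_closedD by fastforce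
    moreover have "earlier Ls m \<subseteq> A" using m(1) unfolding A_def earlier_def by fastforce
    ultimately show "p \<in> A" using sub[OF m(1,2)] by (auto simp: A_def)
  qed
  define f where "f k D = (if c \<in> earlier Ls k \<and> d \<in> D
    then \<Sum>e\<in>D. regression (S0 UNIV) (earlier Ls k) e c * (mat 1 - L)$e$d else 0)" for k D
  have f0: "f k D = 0" if kD: "k < length Ls" "D \<in> Ls ! k" "\<not> (k = k0 \<and> D = D0)" for k D
  proof -
    have "d \<notin> D" using uniq[OF kD(1,2)] kD(3) by blast
    then show ?thesis by (simp add: f_def)
  qed
  have "part2 Ls L (S0 UNIV)$c$d = (\<Sum>k<length Ls. \<Sum>D\<in>Ls ! k. f k D)"
    by (simp add: part2_def f_def)
  also have "\<dots> = (\<Sum>k<length Ls. if k = k0 then f k0 D0 else 0)"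
  proof (rule sum.cong)
    fix k assume "k \<in> {..<length Ls}"
    then have k: "k < length Ls" by simp
    show "(\<Sum>D\<in>Ls ! k. f k D) = (if k = k0 then f k0 D0 else 0)"
    proof (cases "k = k0")
      case True
      have "(\<Sum>D\<in>Ls ! k0. f k0 D) = (\<Sum>D\<in>Ls ! k0. if D = D0 then f k0 D0 else 0)"
        using f0[OF D0(1)] by (intro sum.cong refl) simp
      then show ?thesis using True D0(2) by simp
    next
      case False
      then have "(\<Sum>D\<in>Ls ! k. f k D) = 0" using f0[OF k] by (intro sum.neutral) simp
      then show ?thesis using False by simp
    qed
  qed simp
  also have "\<dots> = f k0 D0" using D0(1) by simp
  finally have part2: "part2 Ls L (S0 UNIV)$c$d = f k0 D0" .
  have D0U: "D0 \<in> \<Union>(set Ls)" using nth_mem[OF D0(1)] D0(2) by blast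
  have same: "(\<exists>D\<in>\<Union>(set Ls). c \<in> D \<and> d \<in> D) \<longleftrightarrow> c \<in> D0"
  proof
    assume "\<exists>D\<in>\<Union>(set Ls). c \<in> D \<and> d \<in> D"
    then obtain k D where "k < length Ls" "D \<in> Ls ! k" "c \<in> D" "d \<in> D" by (auto simp: in_set_conv_nth)
    then show "c \<in> D0" using uniq by blast
  qed (use D0U D0(3) in blast)
  consider "c \<in> D0" | "c \<in> A" | "c \<notin> D0" "c \<notin> A" by blast
  then have "f k0 D0 = (if c \<in> D0 then 0 else reparam \<Lambda> \<pi>$c$d)"
  proof cases
    case 1
    then show ?thesis using D0A by (auto simp: f_def A_def)
  next
    case 2
    have cD0: "c \<notin> D0" using 2 D0A by blast
    have Le: "(mat 1 - L)$e$d = N$e$\<pi> d / N$d$\<pi> d" if "e \<in> D0" for e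
    proof -
      have "L$e$d = reparam \<Lambda> \<pi>$e$d"
        unfolding L_def block_coeffs_def using D0U D0(3) that by auto
      then show ?thesis by (simp add: reparam_nth mat_1_nth)
    qed
    have inner: "(\<Sum>e\<in>D0. B$m$e * N$e$\<pi> d) = - (\<Sum>e\<in>A. B$m$e * N$e$\<pi> d)" if m: "m \<in> A" for m
    proof -
      have "m \<noteq> \<pi> d" using m \<pi>D0 D0A by blast
      then have "0 = (\<Sum>e\<in>UNIV. B$m$e * N$e$\<pi> d)" unfolding B_N by simp
      also have "\<dots> = (\<Sum>e\<in>A \<union> D0. B$m$e * N$e$\<pi> d)"
        using N_entering[OF cl] \<pi>D0 by (intro sum.mono_neutral_right) auto
      also have "\<dots> = (\<Sum>e\<in>A. B$m$e * N$e$\<pi> d) + (\<Sum>e\<in>D0. B$m$e * N$e$\<pi> d)"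
        using D0A by (intro sum.union_disjoint) auto
      finally show ?thesis by simp
    qed
    have "f k0 D0 = (\<Sum>e\<in>D0. (\<Sum>m\<in>A. N$c$m * B$m$e) * (N$e$\<pi> d / N$d$\<pi> d))"
      using 2 D0(3) Le regression_closed[OF terminal_UNIV clA _ 2 UNIV_I]
      by (auto simp: f_def A_def intro!: sum.cong)
    also have "\<dots> = (\<Sum>m\<in>A. N$c$m * (\<Sum>e\<in>D0. B$m$e * N$e$\<pi> d)) / N$d$\<pi> d"
      unfolding sum_distrib_left sum_distrib_right sum_divide_distrib
      by (subst sum.swap) (simp add: mult_ac)
    also have "(\<Sum>m\<in>A. N$c$m * (\<Sum>e\<in>D0. B$m$e * N$e$\<pi> d)) = - (\<Sum>m\<in>A. \<Sum>e\<in>A. N$c$m * B$m$e * N$e$\<pi> d)"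
      using inner by (simp add: sum_distrib_left mult.assoc flip: sum_negf)
    also have "(\<Sum>m\<in>A. \<Sum>e\<in>A. N$c$m * B$m$e * N$e$\<pi> d) = (\<Sum>e\<in>A. (\<Sum>m\<in>A. N$c$m * B$m$e) * N$e$\<pi> d)"
      unfolding sum_distrib_right by (rule sum.swap)
    also have "\<dots> = (\<Sum>e\<in>A. if e = c then N$c$\<pi> d else 0)"
      using N_B_closed[OF terminal_UNIV clA _ 2] by (intro sum.cong) auto
    also have "\<dots> = N$c$\<pi> d" using 2 by simp
    finally show ?thesis using cD0 D0(3) by (auto simp: reparam_nth)
  next
    case 3
    have "N$c$\<pi> d = 0" using N_entering[OF cl] \<pi>D0 3 by blast
    moreover have "c \<noteq> d" using 3 D0(3) by blast
    ultimately show ?thesis using 3 by (simp add: f_def A_def reparam_nth)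
  qed
  then show ?thesis using part2 same by (simp add: L_def)
qed

theorem causal_graph_discovery_correct:
  assumes "choice_rule ori" "choice_rule wt" "agrees UNIV S T"
  obtains \<pi> where "bij \<pi>" "\<And>j. (j, \<pi> j) \<in> E\<^sup>="
    "causal_graph_discovery ori wt S T = Some (permute_graph \<pi> E, reparam \<Lambda> \<pi>)"
proof -
  obtain Ls \<pi> where dec: "decomposition UNIV Ls \<pi>" and p1: "part1 ori wt UNIV S T =
      Some (Ls, {(i, j). block_coeffs (\<Union>(set Ls)) \<pi>$i$j \<noteq> 0}, block_coeffs (\<Union>(set Ls)) \<pi>)"
    using part1_correct[OF assms(1,2) terminal_UNIV assms(3)] by blast
  define L where "L = block_coeffs (\<Union>(set Ls)) \<pi>"
  have S: "S = S0 UNIV" using agreesD(1)[OF assms(3)] by (simp add: vec_eq_iff)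
  have \<pi>: "\<pi> permutes UNIV" "\<And>j. (j, \<pi> j) \<in> E\<^sup>=" by (rule decompositionD(2)[OF dec], rule decompositionD(3)[OF dec])
  have nz: "N$j$\<pi> j \<noteq> 0" for j using \<pi>(2) N_nz by blast
  have L: "L$c$d = (if \<exists>D\<in>\<Union>(set Ls). c \<in> D \<and> d \<in> D then reparam \<Lambda> \<pi>$c$d else 0)" for c d
    by (simp add: L_def block_coeffs_def)
  note p2 = part2_eq[OF dec, folded L_def]
  have sum: "L + part2 Ls L S = reparam \<Lambda> \<pi>"
    unfolding S vec_eq_iff by (auto simp: L p2)
  have "L$c$d \<noteq> 0 \<or> part2 Ls L S$c$d \<noteq> 0 \<longleftrightarrow> reparam \<Lambda> \<pi>$c$d \<noteq> 0" for c d
    unfolding S by (auto simp: L p2)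
  moreover have "reparam \<Lambda> \<pi>$c$d \<noteq> 0 \<longleftrightarrow> (c, d) \<in> permute_graph \<pi> E" for c d
  proof (cases "c = d")
    case True
    then show ?thesis using nz by (simp add: reparam_nth permute_graph_def)
  next
    case False
    then show ?thesis using nz[of d] N_nz[of c "\<pi> d"] by (auto simp: reparam_nth permute_graph_def)
  qed
  ultimately have "{(i, j). L$i$j \<noteq> 0} \<union> {(c, d). part2 Ls L S$c$d \<noteq> 0} = permute_graph \<pi> E" by auto
  then have "causal_graph_discovery ori wt S T = Some (permute_graph \<pi> E, reparam \<Lambda> \<pi>)"
    using p1 sum by (simp add: causal_graph_discovery_def flip: L_def)
  then show ?thesis using that \<pi> permutes_bij by blast
qed

end

lemma lsem_generic_of_law:
  fixes E :: "'n::finite digraph" and \<nu> :: "(real^'n) measure"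
  assumes E: "irrefl E" "cycle_disjoint E" and \<Lambda>: "\<Lambda> \<in> edge_coeffs E"
    and gen: "generic_parameter E \<Lambda> (\<chi> a. second_moments \<nu>$a$a) (\<chi> a. third_moments \<nu>$a$a$a)"
  shows "lsem_generic E \<Lambda> (\<chi> a. second_moments \<nu>$a$a) (\<chi> a. third_moments \<nu>$a$a$a)"
proof -
  note g = gen[unfolded generic_parameter_def Let_def]
  have "\<Lambda> \<in> edge_coeffs_star E" using \<Lambda> g by (auto simp: edge_coeffs_star_def)
  then interpret lsem_coeffs E \<Lambda> using E by unfold_locales
  have B: "B = matrix_inv (mat 1 - \<Lambda>)" by (simp add: B_def N_def)
  show ?thesis
  proof
    \<comment> \<open>Second moments on the diagonal are integrals of squares, so generic
      nonvanishing means positivity.\<close>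
    have "0 \<le> second_moments \<nu>$a$a" for a by (simp add: second_moments_def)
    moreover have "second_moments \<nu>$a$a \<noteq> 0" for a using g by simp
    ultimately show "0 < (\<chi> a. second_moments \<nu>$a$a)$a" for a by (simp add: less_le)
    show "\<Lambda>$u$v * (\<chi> a. second_moments \<nu>$a$a)$u + \<Lambda>$v$u * (\<chi> a. second_moments \<nu>$a$a)$v \<noteq> 0"
      if "(u, v) \<in> E" "(v, u) \<in> E" for u v
      using g that by blast
    show "f (second_of W B (\<chi> a. second_moments \<nu>$a$a)) (third_of W B z) = 0"
      if "f \<in> moment_tests"
        "f (second_of W B (\<chi> a. second_moments \<nu>$a$a)) (third_of W B (\<chi> a. third_moments \<nu>$a$a$a)) = 0"
      for f W z
      using g that unfolding B by blast
  qed
qed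

theorem corollary4p13:
  fixes E :: "'n::finite digraph"
  assumes "irrefl E" and "cycle_disjoint E"
  shows "\<exists>N \<in> null_sets (parameter_measure E).
    \<forall>\<Lambda> \<nu> S T ori wt.
      \<Lambda> \<in> edge_coeffs E \<longrightarrow> noise_law \<nu> \<longrightarrow>
      S = second_moments (lsem_law \<Lambda> \<nu>) \<longrightarrow> T = third_moments (lsem_law \<Lambda> \<nu>) \<longrightarrow>
      (S, T) \<in> moment_model E \<longrightarrow>
      parameters E \<Lambda> (second_moments \<nu>) (third_moments \<nu>) \<notin> N \<longrightarrow>
      choice_rule ori \<longrightarrow> choice_rule wt \<longrightarrow>
      (\<exists>E' \<Lambda>'. causal_graph_discovery ori wt S T = Some (E', \<Lambda>') \<and>
        irrefl E' \<and> dist_equivalent E E' \<and>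
        \<Lambda>' \<in> edge_coeffs_star E' \<and>
        (\<exists>\<nu>'. noise_law \<nu>' \<and> lsem_law \<Lambda>' \<nu>' = lsem_law \<Lambda> \<nu>) \<and>
        {H. irrefl H \<and> dist_equivalent E H} =
          {permute_graph \<pi> E' | \<pi>. factors_through_cycles \<pi> E'})"
proof -
  obtain N where N: "N \<in> null_sets (parameter_measure E)"
    and gen: "\<And>\<Lambda> \<Omega>2 \<Omega>3. \<Lambda> \<in> edge_coeffs E \<Longrightarrow> parameters E \<Lambda> \<Omega>2 \<Omega>3 \<notin> N \<Longrightarrow>
      generic_parameter E \<Lambda> (\<chi> a. \<Omega>2$a$a) (\<chi> a. \<Omega>3$a$a$a)"
    by (rule null_set_of_nongeneric_parameters[OF assms(1)]) (rule that)
  show ?thesis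
  proof (intro bexI[OF _ N] allI impI)
    fix \<Lambda> and \<nu> :: "(real^'n) measure" and S T
      and ori :: "'n digraph set \<Rightarrow> 'n digraph" and wt :: "(real^'n^'n) set \<Rightarrow> real^'n^'n"
    assume \<Lambda>: "\<Lambda> \<in> edge_coeffs E" and \<nu>: "noise_law \<nu>"
      and S: "S = second_moments (lsem_law \<Lambda> \<nu>)" and T: "T = third_moments (lsem_law \<Lambda> \<nu>)"
      and notin: "parameters E \<Lambda> (second_moments \<nu>) (third_moments \<nu>) \<notin> N"
      and choice: "choice_rule ori" "choice_rule wt"
    define w2 where "w2 = (\<chi> a. second_moments \<nu>$a$a)"
    define w3 where "w3 = (\<chi> a. third_moments \<nu>$a$a$a)"
    have g: "generic_parameter E \<Lambda> w2 w3" unfolding w2_def w3_def by (rule gen[OF \<Lambda> notin])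
    interpret lsem_generic E \<Lambda> w2 w3
      using lsem_generic_of_law[OF assms \<Lambda>] g unfolding w2_def w3_def .
    have B: "B = matrix_inv (mat 1 - \<Lambda>)" by (simp add: B_def N_def)
    have agrees: "agrees UNIV S T"
      unfolding agrees_def S T lsem_law_def second_moments_linear_image[OF \<nu>]
        third_moments_linear_image[OF \<nu>] second_of_def third_of_def B
      by (simp add: transpose_def w2_def w3_def)
    obtain \<pi> where \<pi>: "bij \<pi>" "\<And>j. (j, \<pi> j) \<in> E\<^sup>="
      and out: "causal_graph_discovery ori wt S T = Some (permute_graph \<pi> E, reparam \<Lambda> \<pi>)"
      by (rule causal_graph_discovery_correct[OF choice agrees]) (rule that)
    define E' where "E' = permute_graph \<pi> E"
    have irr: "irrefl E'" unfolding E'_def by (rule irrefl_permute_graph)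
    have equiv: "dist_equivalent E E'"
      unfolding E'_def by (rule dist_equivalent_permute_graph[OF assms(1) \<pi>])
    have coeffs: "reparam \<Lambda> \<pi> \<in> edge_coeffs_star E'"
      unfolding E'_def
      by (rule reparam_edge_coeffs_star[OF assms(1) irrefl_permute_graph \<pi>(1) permute_graph_reflcl[OF \<pi>(2)] star])
    have inv: "invertible (mat 1 - \<Lambda>)" using inv_N by (simp only: N_def)
    have nz: "(mat 1 - \<Lambda>)$j$\<pi> j \<noteq> 0" for j using N_nz[of j "\<pi> j"] \<pi>(2)[of j] by (simp only: N_def)
    obtain \<nu>' where \<nu>': "noise_law \<nu>'" "lsem_law (reparam \<Lambda> \<pi>) \<nu>' = lsem_law \<Lambda> \<nu>"
      "\<And>i. third_moments \<nu>$\<pi> i$\<pi> i$\<pi> i \<noteq> 0 \<Longrightarrow> third_moments \<nu>'$i$i$i \<noteq> 0"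
      by (rule lsem_law_reparam[OF \<nu> inv \<pi>(1) nz]) (rule that)
    have "third_moments \<nu>$a$a$a \<noteq> 0" for a using g by (simp add: generic_parameter_def w3_def)
    \<comment> \<open>The equivalence class is described from \<open>E'\<close>, so the noise \<nu>'
      belonging to it must have nonzero third moments as well.\<close>
    then have w': "third_moments \<nu>'$a$a$a \<noteq> 0" for a using \<nu>'(3) by blast
    have class_eq: "{H. irrefl H \<and> dist_equivalent E H} = {permute_graph \<sigma> E' | \<sigma>. factors_through_cycles \<sigma> E'}"
    proof (intro set_eqI iffI)
      fix H assume "H \<in> {H. irrefl H \<and> dist_equivalent E H}"
      then have H: "irrefl H" "dist_equivalent E' H" using equiv by (auto simp: dist_equivalent_def)
      show "H \<in> {permute_graph \<sigma> E' | \<sigma>. factors_through_cycles \<sigma> E'}"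
        by (rule dist_equivalent_imp_permute_graph[OF irr H coeffs \<nu>'(1) w']) blast
    next
      fix H assume "H \<in> {permute_graph \<sigma> E' | \<sigma>. factors_through_cycles \<sigma> E'}"
      then obtain \<sigma> where H: "H = permute_graph \<sigma> E'" and \<sigma>: "factors_through_cycles \<sigma> E'" by blast
      have "dist_equivalent E' H"
        unfolding H using \<sigma> unfolding factors_through_cycles_iff
        by (intro dist_equivalent_permute_graph[OF irr]) auto
      then show "H \<in> {H. irrefl H \<and> dist_equivalent E H}"
        using equiv irrefl_permute_graph unfolding H by (auto simp: dist_equivalent_def)
    qed
    show "\<exists>E' \<Lambda>'. causal_graph_discovery ori wt S T = Some (E', \<Lambda>') \<and>
        irrefl E' \<and> dist_equivalent E E' \<and> \<Lambda>' \<in> edge_coeffs_star E' \<and>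
        (\<exists>\<nu>'. noise_law \<nu>' \<and> lsem_law \<Lambda>' \<nu>' = lsem_law \<Lambda> \<nu>) \<and>
        {H. irrefl H \<and> dist_equivalent E H} =
          {permute_graph \<pi> E' | \<pi>. factors_through_cycles \<pi> E'}"
      by (rule exI[of _ E'], rule exI[of _ "reparam \<Lambda> \<pi>"],
          intro conjI exI[of _ \<nu>'] out[folded E'_def] irr equiv coeffs \<nu>'(1,2) class_eq)
  qed
qed

end
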